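(* Let $\mathbb K$ be an algebraically closed field of characteristic zero, let $A=(a,b)\in\mathbb K^2$ and $d\in\mathbb K\setminus\{0\}$, and let $\mathcal C\subset\mathbb K^2$ be a rational affine plane algebraic curve which is neither of the two lines $y_1\pm\sqrt{-1}\,y_2=0$, is not the circle $(y_1-a)^2+(y_2-b)^2=d^2$, and is not a line through $A$. Let $\mathfrak C(\mathcal C)$ be the conchoid of $\mathcal C$ from the focus $A$ and distance $d$. The following statements are equivalent: (1) $\mathfrak C(\mathcal C)$ is reducible. (2) $\mathfrak C(\mathcal C)$ has exactly two components and they are rational. (3) There exists an rdf proper parametrization of $\mathcal C$. (4) Every proper parametrization of $\mathcal C$ is rdf. (5) There exists a proper parametrization of $\mathcal C$ whose reparametrizing curve is reducible. (6) The reparametrizing curve of every proper parametrization of $\mathcal C$ is reducible.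
   Context: Let $f$ be the irreducible defining polynomial of $\mathcal C$. For $P=(P_1,P_2)$ write $\|P\|^2=P_1^2+P_2^2$ (no conjugation). The conchoid $\mathfrak C(\mathcal C)$ is the Zariski closure in $\mathbb K^2$ of the set of points $\bar x\in\mathbb K^2$ for which there exist $\bar y\in\mathbb K^2$ and $\lambda\in\mathbb K$ with $f(\bar y)=0$, $\|\bar x-\bar y\|^2=d^2$ and $\bar x=A+\lambda(\bar y-A)$. A (rational) parametrization of an irreducible plane curve is a pair $\mathcal P(t)\in\mathbb K(t)^2$, not both entries constant, whose values are Zariski dense in the curve; it is proper if it is birational. A curve is rational if it is irreducible and has a parametrization. A parametrization $\mathcal P(t)$ of $\mathcal C$ is rdf (at rational distance to the focus $A$) if $\|\mathcal P(t)-A\|^2=m(t)^2$ for some $m(t)\in\mathbb K(t)$. Reparametrizing curve: for a parametrization $\mathcal P(t)=(P_1(t),P_2(t))$ of $\mathcal C$, the reparametrizing curve $\mathfrak G(\mathcal P)$ is the plane curve defined by the primitive part with respect to $x_2$ of the numerator of $-2x_2(P_1(x_1)-a)+(x_2^2-1)(P_2(x_1)-b)$. Components of a plane curve are the curves defined by the non-constant irreducible factors over $\mathbb K$ of its defining polynomial. *)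

theory Defs
  imports "HOL-Computational_Algebra.Computational_Algebra"
begin

section \<open>Plane algebraic curves\<close>

text \<open>
  The sort \<open>field_gcd\<close> is no restriction on the field: in every field one may take
  \<open>normalize x = (if x = 0 then 0 else 1)\<close> and the gcd operations it induces. It makes the
  univariate polynomials a gcd ring in the library, which reduced fractions and primitive
  parts need.

  A bivariate polynomial is a value of type \<open>'a poly poly\<close>, where the indeterminate of the inner
  polynomials is the first coordinate and that of the outer polynomial is the second.
\<close>

definition eval2 :: "'a::comm_ring_1 poly poly \<Rightarrow> 'a \<times> 'a \<Rightarrow> 'a" where
  "eval2 h y = poly (poly h [:snd y:]) (fst y)"

definition zero_set :: "'a::comm_ring_1 poly poly \<Rightarrow> ('a \<times> 'a) set" where
  "zero_set h = {y. eval2 h y = 0}"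

definition zariski_closure :: "('a::comm_ring_1 \<times> 'a) set \<Rightarrow> ('a \<times> 'a) set" where
  "zariski_closure S = {y. \<forall>g. (\<forall>z\<in>S. eval2 g z = 0) \<longrightarrow> eval2 g y = 0}"

text \<open>
  A plane curve is the zero set of a non-constant squarefree polynomial, its defining
  polynomial. Over an algebraically closed field this polynomial is unique up to a constant factor.
  Note that \<open>squarefree h\<close> excludes \<open>h = 0\<close>.
\<close>

definition defining_poly :: "'a::field poly poly \<Rightarrow> ('a \<times> 'a) set \<Rightarrow> bool" where
  "defining_poly h C \<longleftrightarrow> squarefree h \<and> \<not> is_unit h \<and> C = zero_set h"

definition irreducible_curve :: "('a::field \<times> 'a) set \<Rightarrow> bool" where
  "irreducible_curve C \<longleftrightarrow> (\<exists>h. defining_poly h C \<and> irreducible h)"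

definition reducible_curve :: "('a::field \<times> 'a) set \<Rightarrow> bool" where
  "reducible_curve C \<longleftrightarrow> (\<exists>h. defining_poly h C \<and> \<not> irreducible h)"

definition curve_components :: "('a::field \<times> 'a) set \<Rightarrow> ('a \<times> 'a) set set" where
  "curve_components C = {zero_set g | g. \<exists>h. defining_poly h C \<and> irreducible g \<and> g dvd h}"

section \<open>Rational parametrizations\<close>

abbreviation const_rf :: "'a::field \<Rightarrow> 'a poly fract" where
  "const_rf c \<equiv> to_fract [:c:]"

text \<open>
  \<open>quot_of_fract\<close> gives the numerator and denominator in lowest terms, so a rational function is
  undefined exactly at its poles.
\<close>

definition rf_defined :: "'a::field_gcd poly fract \<Rightarrow> 'a \<Rightarrow> bool" where
  "rf_defined r t \<longleftrightarrow> poly (snd (quot_of_fract r)) t \<noteq> 0"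

definition rf_eval :: "'a::field_gcd poly fract \<Rightarrow> 'a \<Rightarrow> 'a" where
  "rf_eval r t = poly (fst (quot_of_fract r)) t / poly (snd (quot_of_fract r)) t"

definition par_defined :: "'a::field_gcd poly fract \<times> 'a poly fract \<Rightarrow> 'a \<Rightarrow> bool" where
  "par_defined P t \<longleftrightarrow> rf_defined (fst P) t \<and> rf_defined (snd P) t"

definition par_eval :: "'a::field_gcd poly fract \<times> 'a poly fract \<Rightarrow> 'a \<Rightarrow> 'a \<times> 'a" where
  "par_eval P t = (rf_eval (fst P) t, rf_eval (snd P) t)"

definition parametrization ::
    "'a::field_gcd poly fract \<times> 'a poly fract \<Rightarrow> ('a \<times> 'a) set \<Rightarrow> bool" where
  "parametrization P C \<longleftrightarrow>
     \<not> (fst P \<in> range const_rf \<and> snd P \<in> range const_rf) \<and>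
     zariski_closure (par_eval P ` {t. par_defined P t}) = C"

text \<open>
  Properness: the rational map \<open>t \<mapsto> P(t)\<close> from the line to \<open>C\<close> has a rational inverse \<open>u / v\<close>.
  Each of the two composites is defined somewhere and is the identity wherever it is defined. On an
  irreducible curve, being defined somewhere means being defined on a dense open subset.
\<close>

definition birational_par ::
    "'a::field_gcd poly fract \<times> 'a poly fract \<Rightarrow> ('a \<times> 'a) set \<Rightarrow> bool" where
  "birational_par P C \<longleftrightarrow> (\<exists>u v.
     (\<exists>t. par_defined P t \<and> eval2 v (par_eval P t) \<noteq> 0) \<and>
     (\<forall>t. par_defined P t \<and> eval2 v (par_eval P t) \<noteq> 0 \<longrightarrow>
        eval2 u (par_eval P t) / eval2 v (par_eval P t) = t) \<and>
     (\<exists>y\<in>C. eval2 v y \<noteq> 0 \<and> par_defined P (eval2 u y / eval2 v y)) \<and>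
     (\<forall>y\<in>C. eval2 v y \<noteq> 0 \<and> par_defined P (eval2 u y / eval2 v y) \<longrightarrow>
        par_eval P (eval2 u y / eval2 v y) = y))"

definition proper_parametrization ::
    "'a::field_gcd poly fract \<times> 'a poly fract \<Rightarrow> ('a \<times> 'a) set \<Rightarrow> bool" where
  "proper_parametrization P C \<longleftrightarrow> parametrization P C \<and> birational_par P C"

definition rational_curve :: "('a::field_gcd \<times> 'a) set \<Rightarrow> bool" where
  "rational_curve C \<longleftrightarrow> irreducible_curve C \<and> (\<exists>P. parametrization P C)"

section \<open>Conchoids and reparametrizing curves\<close>

definition sqnorm :: "'b::comm_ring_1 \<times> 'b \<Rightarrow> 'b" where
  "sqnorm p = (fst p)\<^sup>2 + (snd p)\<^sup>2"

definition conchoid :: "'a::field \<times> 'a \<Rightarrow> 'a \<Rightarrow> ('a \<times> 'a) set \<Rightarrow> ('a \<times> 'a) set" where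
  "conchoid A d C = zariski_closure
     {(x1, x2). \<exists>y1 y2 l. (y1, y2) \<in> C \<and> sqnorm (x1 - y1, x2 - y2) = d\<^sup>2 \<and>
        x1 = fst A + l * (y1 - fst A) \<and> x2 = snd A + l * (y2 - snd A)}"

definition rdf :: "'a::field \<times> 'a \<Rightarrow> 'a poly fract \<times> 'a poly fract \<Rightarrow> bool" where
  "rdf A P \<longleftrightarrow> (\<exists>m. sqnorm (fst P - const_rf (fst A), snd P - const_rf (snd A)) = m\<^sup>2)"

text \<open>
  The expression below is an element of \<open>K(x\<^sub>1)[x\<^sub>2]\<close>, with \<open>[:0, 1:]\<close> denoting \<open>x\<^sub>2\<close>.
  \<open>primitive_part_fract\<close> multiplies it by the least common denominator of its coefficients,
  which gives the numerator in \<open>K[x\<^sub>1][x\<^sub>2]\<close>, and takes the primitive part of that with respect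
  to \<open>x\<^sub>2\<close>.
\<close>

definition reparam_poly ::
    "'a::field_gcd \<times> 'a \<Rightarrow> 'a poly fract \<times> 'a poly fract \<Rightarrow> 'a poly poly" where
  "reparam_poly A P = primitive_part_fract
     (smult (- 2 * (fst P - const_rf (fst A))) [:0, 1:] +
      smult (snd P - const_rf (snd A)) ([:0, 1:]\<^sup>2 - 1))"

definition reparam_curve ::
    "'a::field_gcd \<times> 'a \<Rightarrow> 'a poly fract \<times> 'a poly fract \<Rightarrow> ('a \<times> 'a) set" where
  "reparam_curve A P = zero_set (reparam_poly A P)"

end

theory Submission
  imports Defs
begin

text \<open>
  All statements are equivalent to one condition on a single proper parametrization \<open>P\<close>: that
  \<open>n = \<parallel>P - A\<parallel>\<^sup>2\<close> is a square in \<open>K(t)\<close>.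

  A proper parametrization exists by Lueroth's theorem (\<open>lueroth_normal_form\<close>,
  \<open>lueroth_proper\<close>), and every other parametrization is \<open>P\<close> composed with a rational function
  (\<open>factor_through_proper\<close>). A square root of \<open>n\<close> can be composed with that function, so being rdf
  does not depend on the proper parametrization (\<open>rdf_transfer\<close>). The reparametrizing
  curve is reducible under the same condition: its equation is a quadratic polynomial in \<open>x\<^sub>2\<close> over
  \<open>K(x\<^sub>1)\<close> with discriminant \<open>4 n\<close> (\<open>reparam_curve_reducible_iff\<close>).

  The points of the conchoid over \<open>y\<close> are \<open>y + \<mu> (y - A)\<close> with \<open>\<mu>\<^sup>2 \<parallel>y - A\<parallel>\<^sup>2 = d\<^sup>2\<close>. Over the curve
  this is a double cover, given by \<open>\<mu> = d / \<surd>n\<close>. If \<open>n\<close> is not a square, the conchoid has its generic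
  point in the quadratic extension \<open>K(t)(\<mu>)\<close>, which is a field, so its ideal is prime
  (\<open>vanishing_on_points_prime\<close>). If \<open>n = m\<^sup>2\<close>, the cover splits into the two rational branches
  \<open>P \<plusminus> (d / m) (P - A)\<close>, neither of which is a point since the curve is neither the circle nor a line
  through \<open>A\<close>. That the two branches are different curves is the least obvious step: a
  coincidence would move \<open>t\<close> to some \<open>t'\<close> with the same direction \<open>(P - A) / m\<close> but with
  \<open>m(t') = m(t) + 2 d\<close>, and iterating this would give infinitely many points in the direction of a
  general one (\<open>branches_distinct\<close>).

  Rational functions are handled through their values: a rational function is a function on \<open>K\<close> that
  agrees with a quotient of polynomials outside a finite set, and identities between rational
  functions are identities at all but finitely many points.
\<close>

section \<open>Rational functions up to finitely many points\<close>

lemma MOST_contr: "\<forall>\<^sub>\<infinity>t::'a::field_char_0. P t \<Longrightarrow> \<forall>\<^sub>\<infinity>t. \<not> P t \<Longrightarrow> False"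
  using eventually_conj[of P cofinite "\<lambda>t. \<not> P t"] infinite_UNIV_char_0[where 'a='a] by simp

lemma MOST_ex: "\<forall>\<^sub>\<infinity>t::'a::field_char_0. P t \<Longrightarrow> \<exists>t. P t"
  using MOST_contr[of P] ALL_MOST[of "\<lambda>t. \<not> P t"] by blast

lemma MOST_notin: "finite B \<Longrightarrow> \<forall>\<^sub>\<infinity>t. t \<notin> B"
  by (simp add: eventually_cofinite)

lemma MOST_poly_nonzero: "p \<noteq> 0 \<Longrightarrow> \<forall>\<^sub>\<infinity>t::'a::idom. poly p t \<noteq> 0"
  using poly_roots_finite[of p] by (simp add: eventually_cofinite)

lemma MOST_poly_zero: "\<forall>\<^sub>\<infinity>t::'a::field_char_0. poly p t = 0 \<Longrightarrow> p = 0"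
  using MOST_poly_nonzero[of p] MOST_contr by blast

text \<open>
  Only the values at all but finitely many arguments matter, so that the value of a quotient at a
  pole is irrelevant and rational functions can be added, multiplied and composed as functions.
\<close>

definition rat_germ :: "('a::field \<Rightarrow> 'a) \<Rightarrow> bool" where
  "rat_germ F \<longleftrightarrow> (\<exists>p q. q \<noteq> 0 \<and> (\<forall>\<^sub>\<infinity>t. F t = poly p t / poly q t))"

lemma rat_germI: "q \<noteq> 0 \<Longrightarrow> \<forall>\<^sub>\<infinity>t. F t = poly p t / poly q t \<Longrightarrow> rat_germ F"
  by (auto simp: rat_germ_def)

lemma rat_germ_cong: "rat_germ F \<Longrightarrow> \<forall>\<^sub>\<infinity>t. G t = F t \<Longrightarrow> rat_germ G"
  unfolding rat_germ_def by (elim exE conjE, rule exI, rule exI, rule conjI, assumption)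
    (auto elim: eventually_elim2)

lemma rat_germ_poly: "rat_germ (\<lambda>t. poly p t)"
  by (rule rat_germI[of 1 _ p]) auto

lemma rat_germ_const: "rat_germ (\<lambda>t. c)"
  using rat_germ_poly[of "[:c:]"] by simp

lemma rat_germ_id: "rat_germ (\<lambda>t. t)"
  using rat_germ_poly[of "[:0,1:]"] by simp

lemma rat_germ_add:
  assumes "rat_germ F" "rat_germ G" shows "rat_germ (\<lambda>t. F t + G t)"
proof -
  obtain p q p' q' where 1: "q \<noteq> 0" "\<forall>\<^sub>\<infinity>t. F t = poly p t / poly q t"
    and 2: "q' \<noteq> 0" "\<forall>\<^sub>\<infinity>t. G t = poly p' t / poly q' t"
    using assms by (auto simp: rat_germ_def)
  have "\<forall>\<^sub>\<infinity>t. F t + G t = poly (p*q'+p'*q) t / poly (q*q') t"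
    using 1(2) 2(2) MOST_poly_nonzero[OF 1(1)] MOST_poly_nonzero[OF 2(1)]
    by eventually_elim (simp add: field_simps)
  thus ?thesis by (rule rat_germI[rotated]) (use 1(1) 2(1) in simp)
qed

lemma rat_germ_mult:
  assumes "rat_germ F" "rat_germ G" shows "rat_germ (\<lambda>t. F t * G t)"
proof -
  obtain p q p' q' where 1: "q \<noteq> 0" "\<forall>\<^sub>\<infinity>t. F t = poly p t / poly q t"
    and 2: "q' \<noteq> 0" "\<forall>\<^sub>\<infinity>t. G t = poly p' t / poly q' t"
    using assms by (auto simp: rat_germ_def)
  have "\<forall>\<^sub>\<infinity>t. F t * G t = poly (p*p') t / poly (q*q') t"
    using 1(2) 2(2) by eventually_elim simp
  thus ?thesis by (rule rat_germI[rotated]) (use 1(1) 2(1) in simp)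
qed

lemma rat_germ_inverse:
  assumes "rat_germ F" shows "rat_germ (\<lambda>t. inverse (F t))"
proof -
  obtain p q where 1: "q \<noteq> 0" "\<forall>\<^sub>\<infinity>t. F t = poly p t / poly q t"
    using assms by (auto simp: rat_germ_def)
  show ?thesis
  proof (cases "p = 0")
    case True
    have "\<forall>\<^sub>\<infinity>t. inverse (F t) = 0" using 1(2) by eventually_elim (simp add: True)
    thus ?thesis by (rule rat_germ_cong[where F = "\<lambda>t. 0", OF rat_germ_const])
  next
    case False
    have "\<forall>\<^sub>\<infinity>t. inverse (F t) = poly q t / poly p t" using 1(2) by eventually_elim simp
    thus ?thesis using False by (rule rat_germI[rotated])
  qed
qed

lemma rat_germ_uminus: "rat_germ F \<Longrightarrow> rat_germ (\<lambda>t. - F t)"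
  using rat_germ_mult[OF rat_germ_const[of "-1"], of F] by simp

lemma rat_germ_diff: "rat_germ F \<Longrightarrow> rat_germ G \<Longrightarrow> rat_germ (\<lambda>t. F t - G t)"
  using rat_germ_add[OF _ rat_germ_uminus, of F G] by simp

lemma rat_germ_divide: "rat_germ F \<Longrightarrow> rat_germ G \<Longrightarrow> rat_germ (\<lambda>t. F t / G t)"
  using rat_germ_mult[OF _ rat_germ_inverse, of F G] by (simp add: field_simps)

lemma rat_germ_power: "rat_germ F \<Longrightarrow> rat_germ (\<lambda>t. F t ^ n)"
  by (induction n) (auto intro: rat_germ_const rat_germ_mult)

lemmas rat_germ_intros = rat_germ_const rat_germ_id rat_germ_poly rat_germ_add rat_germ_mult
  rat_germ_inverse rat_germ_uminus rat_germ_diff rat_germ_divide rat_germ_power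

text \<open>
  This replaces the fact that \<open>K(t)\<close> is a field: a property of the form \<open>F = 0\<close> or \<open>F = G\<close> holds almost
  everywhere or fails almost everywhere.
\<close>

lemma rat_germ_zero_or_nonzero:
  fixes F :: "'a::field_char_0 \<Rightarrow> 'a"
  assumes "rat_germ F"
  shows "(\<forall>\<^sub>\<infinity>t. F t = 0) \<or> (\<forall>\<^sub>\<infinity>t. F t \<noteq> 0)"
proof -
  obtain p q where 1: "q \<noteq> 0" "\<forall>\<^sub>\<infinity>t. F t = poly p t / poly q t"
    using assms by (auto simp: rat_germ_def)
  show ?thesis
  proof (cases "p = 0")
    case True
    have "\<forall>\<^sub>\<infinity>t. F t = 0" using 1(2) by eventually_elim (simp add: True)
    thus ?thesis ..
  next
    case False
    have "\<forall>\<^sub>\<infinity>t. F t \<noteq> 0"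
      using 1(2) MOST_poly_nonzero[OF 1(1)] MOST_poly_nonzero[OF False] by eventually_elim simp
    thus ?thesis ..
  qed
qed

lemma rat_germ_eq_or_neq:
  fixes F :: "'a::field_char_0 \<Rightarrow> 'a"
  assumes "rat_germ F" "rat_germ G"
  shows "(\<forall>\<^sub>\<infinity>t. F t = G t) \<or> (\<forall>\<^sub>\<infinity>t. F t \<noteq> G t)"
  using rat_germ_zero_or_nonzero[OF rat_germ_diff[OF assms]] by simp

definition nonconst :: "('a::field \<Rightarrow> 'a) \<Rightarrow> bool" where
  "nonconst F \<longleftrightarrow> rat_germ F \<and> (\<forall>c. \<not> (\<forall>\<^sub>\<infinity>t. F t = c))"

lemma nonconst_rat_germ: "nonconst F \<Longrightarrow> rat_germ F"
  by (simp add: nonconst_def)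

lemma nonconst_neq: "nonconst (F :: 'a::field_char_0 \<Rightarrow> 'a) \<Longrightarrow> \<forall>\<^sub>\<infinity>t. F t \<noteq> c"
  using rat_germ_eq_or_neq[OF nonconst_rat_germ rat_germ_const, of F c]
  unfolding nonconst_def by blast

lemma nonconst_notin:
  fixes F :: "'a::field_char_0 \<Rightarrow> 'a"
  assumes "nonconst F" "finite B" shows "\<forall>\<^sub>\<infinity>t. F t \<notin> B"
proof -
  have "\<forall>\<^sub>\<infinity>t. \<forall>c\<in>B. F t \<noteq> c"
    by (intro eventually_ball_finite[OF assms(2)] ballI nonconst_neq[OF assms(1)])
  thus ?thesis by eventually_elim auto
qed

text \<open>
  A non-constant rational function has finite fibres, so it pulls finite sets back to finite sets.
\<close>

lemma nonconst_MOST: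
  fixes F :: "'a::field_char_0 \<Rightarrow> 'a"
  assumes "nonconst F" "\<forall>\<^sub>\<infinity>t. P t" shows "\<forall>\<^sub>\<infinity>t. P (F t)"
  using nonconst_notin[OF assms(1), of "{t. \<not> P t}"] assms(2) by (simp add: eventually_cofinite)

lemma nonconst_id: "nonconst (\<lambda>t::'a::field_char_0. t)"
proof -
  have "\<not> (\<forall>\<^sub>\<infinity>t::'a. t = c)" for c
  proof
    assume "\<forall>\<^sub>\<infinity>t::'a. t = c"
    hence "\<forall>\<^sub>\<infinity>t. poly [:-c,1:] t = 0" by eventually_elim simp
    from MOST_poly_zero[OF this] show False by simp
  qed
  thus ?thesis by (simp add: nonconst_def rat_germ_id)
qed

lemma rat_germ_compose:
  fixes F :: "'a::field_char_0 \<Rightarrow> 'a"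
  assumes "rat_germ F" "nonconst s" shows "rat_germ (\<lambda>t. F (s t))"
proof -
  obtain p q where 1: "q \<noteq> 0" "\<forall>\<^sub>\<infinity>t. F t = poly p t / poly q t"
    using assms by (auto simp: rat_germ_def)
  have "rat_germ (\<lambda>t. poly p (s t))" for p
  proof (induction p)
    case 0 thus ?case by (simp add: rat_germ_const)
  next
    case (pCons a p) thus ?case
      by (simp add: rat_germ_const rat_germ_add rat_germ_mult nonconst_rat_germ[OF assms(2)])
  qed
  hence "rat_germ (\<lambda>t. poly p (s t) / poly q (s t))" by (intro rat_germ_divide)
  thus ?thesis by (rule rat_germ_cong) (rule nonconst_MOST[OF assms(2) 1(2)])
qed

subsection \<open>Elements of the rational function field as functions\<close>

text \<open>
  The value of a fraction can be computed from any representation, not only from the reduced one,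
  as long as the zeros of both denominators are avoided.
\<close>

lemma rf_eval_fract:
  fixes r :: "'a::field_gcd poly fract"
  assumes "q \<noteq> 0" "r = to_fract p / to_fract q"
  shows "\<forall>\<^sub>\<infinity>t. rf_eval r t = poly p t / poly q t"
proof -
  obtain a b where ab: "quot_of_fract r = (a, b)" by force
  have b: "b \<noteq> 0" using snd_quot_of_fract_nonzero[of r] ab by simp
  have "r = to_fract a / to_fract b"
    using Fract_quot_of_fract[of r] ab by (simp add: Fract_conv_to_fract)
  hence "to_fract (a * q) = to_fract (p * b)" using assms b by (simp add: field_simps)
  hence eq: "a * q = p * b" by (simp only: to_fract_eq_iff)
  have "poly a t * poly q t = poly p t * poly b t" for t
    using arg_cong[OF eq, of "\<lambda>x. poly x t"] by simp
  moreover have "\<forall>\<^sub>\<infinity>t. poly b t \<noteq> 0" "\<forall>\<^sub>\<infinity>t. poly q t \<noteq> 0"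
    using b assms(1) by (auto intro: MOST_poly_nonzero)
  ultimately show ?thesis
    by - (erule (1) eventually_elim2, simp add: rf_eval_def ab frac_eq_eq)
qed

lemma rf_defined_MOST: "\<forall>\<^sub>\<infinity>t. rf_defined r t"
  unfolding rf_defined_def by (rule MOST_poly_nonzero) simp

lemma par_defined_MOST: "\<forall>\<^sub>\<infinity>t. par_defined P t"
  unfolding par_defined_def using rf_defined_MOST by (intro eventually_conj)

lemma fract_as_quotient:
  obtains p q where "q \<noteq> 0" "(r :: 'a::field_gcd poly fract) = to_fract p / to_fract q"
  using Fract_quot_of_fract[of r, symmetric] snd_quot_of_fract_nonzero[of r]
  by (metis Fract_conv_to_fract)

lemma rat_germ_rf_eval: "rat_germ (rf_eval r)"
  unfolding rf_eval_def
  by (rule rat_germI[of "snd (quot_of_fract r)" _ "fst (quot_of_fract r)"]) auto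

lemma rf_eval_const: "\<forall>\<^sub>\<infinity>t. rf_eval (const_rf c) t = c"
  using rf_eval_fract[of 1 "const_rf c" "[:c:]"] by simp

lemma rf_eval_add: "\<forall>\<^sub>\<infinity>t. rf_eval (r + s) t = rf_eval r t + rf_eval s t"
proof -
  obtain p q where 1: "q \<noteq> 0" "r = to_fract p / to_fract q" by (rule fract_as_quotient)
  obtain p' q' where 2: "q' \<noteq> 0" "s = to_fract p' / to_fract q'" by (rule fract_as_quotient)
  have "r + s = to_fract (p * q' + p' * q) / to_fract (q * q')"
    using 1 2 by (simp add: field_simps)
  from rf_eval_fract[OF no_zero_divisors[OF 1(1) 2(1)] this] rf_eval_fract[OF 1]
    rf_eval_fract[OF 2] MOST_poly_nonzero[OF 1(1)] MOST_poly_nonzero[OF 2(1)]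
  show ?thesis by eventually_elim (simp add: add_frac_eq)
qed

lemma rf_eval_mult: "\<forall>\<^sub>\<infinity>t. rf_eval (r * s) t = rf_eval r t * rf_eval s t"
proof -
  obtain p q where 1: "q \<noteq> 0" "r = to_fract p / to_fract q" by (rule fract_as_quotient)
  obtain p' q' where 2: "q' \<noteq> 0" "s = to_fract p' / to_fract q'" by (rule fract_as_quotient)
  have "r * s = to_fract (p * p') / to_fract (q * q')"
    using 1 2 by simp
  from rf_eval_fract[OF no_zero_divisors[OF 1(1) 2(1)] this] rf_eval_fract[OF 1]
    rf_eval_fract[OF 2]
  show ?thesis by eventually_elim simp
qed

lemma rf_eval_uminus: "\<forall>\<^sub>\<infinity>t. rf_eval (- s) t = - rf_eval s t"
proof -
  obtain p q where 1: "q \<noteq> 0" "s = to_fract p / to_fract q" by (rule fract_as_quotient)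
  have "- s = to_fract (- p) / to_fract q" using 1 by simp
  from rf_eval_fract[OF 1(1) this] rf_eval_fract[OF 1] show ?thesis by eventually_elim simp
qed

lemma rf_eval_diff: "\<forall>\<^sub>\<infinity>t. rf_eval (r - s) t = rf_eval r t - rf_eval s t"
  using rf_eval_add[of r "- s"] rf_eval_uminus[of s] by eventually_elim simp

lemma rf_eval_eq_iff:
  fixes r s :: "'a::{field_char_0,field_gcd} poly fract"
  shows "(\<forall>\<^sub>\<infinity>t. rf_eval r t = rf_eval s t) \<longleftrightarrow> r = s"
proof
  assume *: "\<forall>\<^sub>\<infinity>t. rf_eval r t = rf_eval s t"
  obtain p q where 1: "q \<noteq> 0" "r = to_fract p / to_fract q" by (rule fract_as_quotient)
  obtain p' q' where 2: "q' \<noteq> 0" "s = to_fract p' / to_fract q'" by (rule fract_as_quotient)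
  have "\<forall>\<^sub>\<infinity>t. poly (p * q' - p' * q) t = 0"
    using * rf_eval_fract[OF 1] rf_eval_fract[OF 2]
      MOST_poly_nonzero[OF 1(1)] MOST_poly_nonzero[OF 2(1)]
    by eventually_elim (simp add: field_simps)
  hence "p * q' - p' * q = 0" by (rule MOST_poly_zero)
  hence "to_fract (p * q') = to_fract (p' * q)" by simp
  hence "to_fract p * to_fract q' = to_fract p' * to_fract q"
    by (simp only: to_fract_mult)
  moreover have "to_fract q \<noteq> (0 :: 'a poly fract)" "to_fract q' \<noteq> (0 :: 'a poly fract)"
    using 1(1) 2(1) by simp_all
  ultimately show "r = s" unfolding 1(2) 2(2) using frac_eq_eq by blast
qed simp

lemma rat_germ_fract:
  fixes F :: "'a::field_gcd \<Rightarrow> 'a"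
  assumes "rat_germ F" obtains r where "\<forall>\<^sub>\<infinity>t. rf_eval r t = F t"
proof -
  obtain p q where 1: "q \<noteq> 0" "\<forall>\<^sub>\<infinity>t. F t = poly p t / poly q t"
    using assms by (auto simp: rat_germ_def)
  have "\<forall>\<^sub>\<infinity>t. rf_eval (to_fract p / to_fract q) t = F t"
    using rf_eval_fract[OF 1(1) refl] 1(2) by eventually_elim simp
  thus ?thesis by (rule that)
qed

subsection \<open>Evaluation of bivariate polynomials\<close>

lemma eval2_add [simp]: "eval2 (g + h) y = eval2 g y + eval2 h y"
  and eval2_mult [simp]: "eval2 (g * h) y = eval2 g y * eval2 h y"
  and eval2_diff [simp]: "eval2 (g - h) y = eval2 g y - eval2 h y"
  and eval2_uminus [simp]: "eval2 (- g) y = - eval2 g y"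
  and eval2_power [simp]: "eval2 (g ^ n) y = eval2 g y ^ n"
  and eval2_0 [simp]: "eval2 0 y = 0"
  and eval2_1 [simp]: "eval2 1 y = 1"
  and eval2_smult [simp]: "eval2 (smult c g) y = poly c (fst y) * eval2 g y"
  for y :: "'a::comm_ring_1 \<times> 'a"
  by (simp_all add: eval2_def)

lemma eval2_pCons [simp]: "eval2 (pCons c g) y = poly c (fst y) + snd y * eval2 g y"
  by (simp add: eval2_def)

lemma eval2_sum: "eval2 (sum f I) y = (\<Sum>i\<in>I. eval2 (f i) y)"
  by (induction I rule: infinite_finite_induct) auto

lemma poly_closed:
  assumes "\<And>c. Q (\<lambda>z. c)" "\<And>F G. Q F \<Longrightarrow> Q G \<Longrightarrow> Q (\<lambda>z. F z + G z)"
    "\<And>F G. Q F \<Longrightarrow> Q G \<Longrightarrow> Q (\<lambda>z. F z * G z)" "Q F"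
  shows "Q (\<lambda>z. poly p (F z :: 'a::comm_ring_1))"
  by (induction p) (simp_all add: assms)

text \<open>
  Induction over a bivariate polynomial. It shows that substituting functions of a certain shape,
  such as quotients with a controlled denominator, yields a function of that shape.
\<close>

lemma eval2_closed:
  assumes "\<And>c. Q (\<lambda>z. c)" "\<And>F G. Q F \<Longrightarrow> Q G \<Longrightarrow> Q (\<lambda>z. F z + G z)"
    "\<And>F G. Q F \<Longrightarrow> Q G \<Longrightarrow> Q (\<lambda>z. F z * G z)" "Q F1" "Q F2"
  shows "Q (\<lambda>z. eval2 g (F1 z, F2 z :: 'a::comm_ring_1))"
  by (induction g) (simp_all add: assms poly_closed)

lemma rat_germ_eval2:
  "rat_germ (\<lambda>t. fst (X t)) \<Longrightarrow> rat_germ (\<lambda>t. snd (X t)) \<Longrightarrow> rat_germ (\<lambda>t. eval2 g (X t))"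
  using eval2_closed[of rat_germ "\<lambda>t. fst (X t)" "\<lambda>t. snd (X t)" g]
  by (simp add: rat_germ_intros)

section \<open>Plane curves and bivariate polynomials\<close>

text \<open>
  Gauss's lemma, in the form in which factors found over the fraction field descend to the ring.
\<close>

lemma primitive_dvd_smultD:
  fixes r g :: "'b::{factorial_ring_gcd,semiring_gcd_mult_normalize} poly"
  assumes "content r = 1" "c \<noteq> 0" "r dvd smult c g"
  shows "r dvd g"
proof -
  obtain q where q: "smult c g = r * q" using assms(3) by (elim dvdE)
  have "content q = content (smult c g)" unfolding q by (simp add: content_mult assms(1))
  hence "c dvd content q" by simp
  hence "[:c:] dvd q" by (simp add: const_poly_dvd_iff_dvd_content)
  then obtain q' where "q = [:c:] * q'" by (elim dvdE)
  hence "[:c:] * g = [:c:] * (r * q')" using q by (simp add: mult_ac)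
  hence "g = r * q'" using assms(2) by (subst (asm) mult_left_cancel) auto
  thus ?thesis by simp
qed

text \<open>
  An element of least degree in the ideal of \<open>g\<close> and \<open>h\<close> divides both up to constants, by
  pseudo-division; its primitive part is then a common divisor, hence a unit.
\<close>

lemma coprime_bezout_const:
  fixes g h :: "'b::{factorial_ring_gcd,semiring_gcd_mult_normalize} poly"
  assumes "coprime g h"
  obtains U V w where "w \<noteq> 0" "U * g + V * h = [:w:]"
proof -
  define I where "I = {U * g + V * h | U V. True}"
  have Ig: "g \<in> I" unfolding I_def by (rule CollectI, rule exI[of _ 1], rule exI[of _ 0]) simp
  have Ih: "h \<in> I" unfolding I_def by (rule CollectI, rule exI[of _ 0], rule exI[of _ 1]) simp
  have sub: "smult a x - y * z \<in> I" if "x \<in> I" "y \<in> I" for a x y z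
  proof -
    obtain U V where "x = U * g + V * h" using \<open>x \<in> I\<close> by (auto simp: I_def)
    moreover obtain U' V' where "y = U' * g + V' * h" using \<open>y \<in> I\<close> by (auto simp: I_def)
    ultimately have "smult a x - y * z = (smult a U - U' * z) * g + (smult a V - V' * z) * h"
      by (simp add: algebra_simps smult_add_right)
    thus ?thesis by (auto simp: I_def)
  qed
  have "g \<noteq> 0 \<or> h \<noteq> 0" using assms by auto
  hence ex: "\<exists>x. x \<in> I \<and> x \<noteq> 0" using Ig Ih by blast
  define r where "r = (ARG_MIN degree x. x \<in> I \<and> x \<noteq> 0)"
  obtain x0 where "x0 \<in> I \<and> x0 \<noteq> 0" using ex by blast
  from arg_min_nat_lemma[of "\<lambda>x. x \<in> I \<and> x \<noteq> 0", OF this, of degree]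
  have r: "r \<in> I" "r \<noteq> 0" and rmin: "\<And>x. x \<in> I \<Longrightarrow> x \<noteq> 0 \<Longrightarrow> degree r \<le> degree x"
    unfolding r_def by auto
  have dvd: "primitive_part r dvd x" if x: "x \<in> I" for x
  proof -
    obtain a q where a: "a \<noteq> 0" "smult a x = r * q + pseudo_mod x r"
      using pseudo_mod(1)[OF r(2), of x] by blast
    have "pseudo_mod x r = smult a x - r * q" using a(2) by simp
    hence "pseudo_mod x r \<in> I" using sub[OF x r(1)] by simp
    hence "pseudo_mod x r = 0" using pseudo_mod(2)[OF r(2), of x] rmin by fastforce
    hence "r dvd smult a x" using a(2) by simp
    hence "primitive_part r dvd smult a x"
      by (metis content_times_primitive_part dvd_trans dvd_smult dvd_refl)
    thus ?thesis by (rule primitive_dvd_smultD[rotated 2]) (simp_all add: r a)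
  qed
  have "is_unit (primitive_part r)"
    using dvd[OF Ig] dvd[OF Ih] assms by (rule coprime_common_divisor[rotated])
  hence "degree (primitive_part r) = 0"
    by (auto simp: is_unit_poly_iff simp del: degree_primitive_part)
  hence "degree r = 0" by simp
  then obtain w where "r = [:w:]" by (elim degree_eq_zeroE)
  thus ?thesis using r that by (auto simp: I_def)
qed

subsection \<open>Specialisation of the first coordinate\<close>

text \<open>
  The univariate polynomial \<open>g(x, -)\<close>; fixing the second coordinate instead is \<open>poly g [:y:]\<close>.
\<close>

definition specialize :: "'a::comm_ring_1 \<Rightarrow> 'a poly poly \<Rightarrow> 'a poly" where
  "specialize x g = map_poly (\<lambda>c. poly c x) g"

lemma coeff_specialize [simp]: "coeff (specialize x g) i = poly (coeff g i) x"
  by (simp add: specialize_def coeff_map_poly)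

lemma poly_specialize: "poly (specialize x g) y = eval2 g (x, y)"
  by (induction g) (simp_all add: specialize_def map_poly_pCons)

lemma eval2_conv_poly: "eval2 g (x, y) = poly (poly g [:y:]) x"
  by (simp add: eval2_def)

lemma degree_specialize_le: "degree (specialize x g) \<le> degree g"
  by (rule degree_le) (simp add: coeff_eq_0)

lemma specialize_eq_0D: "specialize x (g :: 'a::field poly poly) = 0 \<Longrightarrow> [:[:-x, 1:]:] dvd g"
  by (subst const_poly_dvd_iff) (metis coeff_specialize coeff_0 poly_eq_0_iff_dvd)

lemma is_unit_poly_poly_iff: "is_unit (h :: 'a::field poly poly) \<longleftrightarrow> (\<exists>c. c \<noteq> 0 \<and> h = [:[:c:]:])"
  by (auto simp: is_unit_poly_iff dvd_field_iff)

text \<open>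
  A combination \<open>U h + V g = w(x)\<close> leaves finitely many vertical lines, and a line on which both
  polynomials vanish identically would give a common factor.
\<close>

lemma finite_zero_set_Int:
  fixes h g :: "'a::{field_char_0,field_gcd} poly poly"
  assumes "coprime h g"
  shows "finite (zero_set h \<inter> zero_set g)"
proof -
  obtain U V w where w: "w \<noteq> 0" "U * h + V * g = [:w:]"
    by (rule coprime_bezout_const[OF assms])
  have "zero_set h \<inter> zero_set g \<subseteq>
      (SIGMA x:{x. poly w x = 0}. {y. poly (specialize x h) y = 0 \<and> poly (specialize x g) y = 0})"
  proof safe
    fix x y assume xy: "(x, y) \<in> zero_set h" "(x, y) \<in> zero_set g"
    thus "poly (specialize x h) y = 0" "poly (specialize x g) y = 0" by (simp_all add: zero_set_def poly_specialize)
    have "eval2 (U * h + V * g) (x, y) = 0" using xy by (simp add: zero_set_def)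
    thus "poly w x = 0" by (simp add: w)
  qed
  moreover have "finite {y. poly (specialize x h) y = 0 \<and> poly (specialize x g) y = 0}" for x
  proof -
    have "\<not> (specialize x h = 0 \<and> specialize x g = 0)"
    proof
      assume "specialize x h = 0 \<and> specialize x g = 0"
      hence "is_unit [:[:-x, 1:]:]" using specialize_eq_0D coprime_common_divisor[OF assms] by blast
      thus False by (simp add: is_unit_poly_poly_iff)
    qed
    thus ?thesis
      using poly_roots_finite[of "specialize x h"] poly_roots_finite[of "specialize x g"]
      by (cases "specialize x h = 0") (auto elim: rev_finite_subset)
  qed
  ultimately show ?thesis
    using poly_roots_finite[OF w(1)] by (meson finite_SigmaI finite_subset)
qed

lemma infinite_zero_set:
  fixes h :: "'a::{alg_closed_field,field_char_0} poly poly"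
  assumes "h \<noteq> 0" "\<not> is_unit h"
  shows "infinite (zero_set h)"
proof (cases "degree h = 0")
  case True
  then obtain f where f: "h = [:f:]" by (elim degree_eq_zeroE)
  have "degree f > 0"
    using assms by (cases "degree f = 0") (auto simp: f is_unit_poly_poly_iff elim!: degree_eq_zeroE)
  then obtain x where "poly f x = 0" using alg_closed_imp_poly_has_root by blast
  hence "Pair x ` UNIV \<subseteq> zero_set h" by (auto simp: zero_set_def f)
  moreover have "infinite (Pair x ` (UNIV :: 'a set))"
    using infinite_UNIV_char_0[where 'a='a] by (subst finite_image_iff) (auto intro: inj_onI)
  ultimately show ?thesis by (meson finite_subset)
next
  case False
  have "\<forall>\<^sub>\<infinity>x. x \<in> fst ` zero_set h"
    using MOST_poly_nonzero[OF leading_coeff_neq_0[OF assms(1)]]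
  proof eventually_elim
    case (elim x)
    hence "degree (specialize x h) = degree h"
      by (intro antisym degree_specialize_le le_degree) simp
    then obtain y where "poly (specialize x h) y = 0" using False alg_closed_imp_poly_has_root[of "specialize x h"] by auto
    thus ?case by (force simp: zero_set_def poly_specialize)
  qed
  show ?thesis
  proof
    assume "finite (zero_set h)"
    hence "\<forall>\<^sub>\<infinity>x. x \<notin> fst ` zero_set h" by (intro MOST_notin) simp
    thus False using MOST_contr \<open>\<forall>\<^sub>\<infinity>x. x \<in> fst ` zero_set h\<close> by blast
  qed
qed

text \<open>
  The form of the Nullstellensatz that plane curves need. Vanishing on infinitely many points of
  an irreducible curve forces divisibility, because coprime curves meet in finitely many points.
\<close>

lemma irreducible_dvd_iff_infinite:
  fixes h g :: "'a::{alg_closed_field,field_char_0,field_gcd} poly poly"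
  assumes "irreducible h"
  shows "h dvd g \<longleftrightarrow> infinite (zero_set h \<inter> zero_set g)"
proof
  assume "h dvd g"
  hence "zero_set h \<inter> zero_set g = zero_set h" by (auto simp: zero_set_def)
  thus "infinite (zero_set h \<inter> zero_set g)"
    using infinite_zero_set[of h] assms by (auto simp: irreducible_def)
next
  assume "infinite (zero_set h \<inter> zero_set g)"
  hence "\<not> coprime h g" using finite_zero_set_Int by blast
  thus "h dvd g" using prime_elem_imp_coprime[OF irreducible_imp_prime_elem[OF assms]] by blast
qed

lemma irreducible_dvd_iff_zero_set:
  fixes h g :: "'a::{alg_closed_field,field_char_0,field_gcd} poly poly"
  assumes "irreducible h"
  shows "h dvd g \<longleftrightarrow> zero_set h \<subseteq> zero_set g"
proof
  assume "zero_set h \<subseteq> zero_set g"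
  hence "zero_set h \<inter> zero_set g = zero_set h" by auto
  thus "h dvd g"
    using infinite_zero_set[of h] assms irreducible_dvd_iff_infinite[OF assms]
    by (auto simp: irreducible_def)
qed (auto simp: zero_set_def)

lemma zero_set_mono: "g dvd h \<Longrightarrow> zero_set g \<subseteq> zero_set (h :: 'a::idom poly poly)"
  by (auto simp: zero_set_def)

lemma irreducible_factor_exists:
  fixes h :: "'b::factorial_semiring"
  assumes "h \<noteq> 0" "\<not> is_unit h" obtains p where "irreducible p" "p dvd h"
  using prime_divisor_exists[OF assms] prime_imp_prime_elem prime_elem_imp_irreducible by blast

lemma irreducible_associated:
  fixes g h :: "'b::algebraic_semidom"
  assumes "irreducible g" "irreducible h" "g dvd h" shows "h dvd g"
  using irreducibleD'[OF assms(2,3)] irreducible_not_unit[OF assms(1)] by blast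

lemma zero_set_eqI: "g dvd h \<Longrightarrow> h dvd g \<Longrightarrow> zero_set g = zero_set (h :: 'a::idom poly poly)"
  by (auto simp: zero_set_def)

text \<open>
  A second irreducible factor of a squarefree polynomial with the zeros of an irreducible
  polynomial \<open>r\<close> would be associated to \<open>r\<close> as well, so that \<open>r\<^sup>2\<close> would divide it.
\<close>

lemma defining_poly_irreducible:
  fixes r h :: "'a::{alg_closed_field,field_char_0,field_gcd} poly poly"
  assumes "irreducible r" "defining_poly h (zero_set r)"
  shows "irreducible h"
proof -
  have sq: "squarefree h" and nu: "\<not> is_unit h" and zs: "zero_set h = zero_set r"
    using assms(2) by (auto simp: defining_poly_def)
  have h0: "h \<noteq> 0" using sq by auto
  have assoc: "r dvd p" if "irreducible p" "p dvd h" for p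
  proof -
    have "zero_set p \<subseteq> zero_set r" using zero_set_mono[OF that(2)] by (simp only: zs)
    hence "p dvd r" by (simp only: irreducible_dvd_iff_zero_set[OF that(1)])
    thus ?thesis by (rule irreducible_associated[OF that(1) assms(1)])
  qed
  obtain p where p: "irreducible p" "p dvd h" by (rule irreducible_factor_exists[OF h0 nu])
  then obtain k where k: "h = p * k" by (elim dvdE)
  have "is_unit k"
  proof (rule ccontr)
    assume "\<not> is_unit k"
    then obtain p' where p': "irreducible p'" "p' dvd k"
      using irreducible_factor_exists[of k] h0 k by auto
    hence "r dvd k" using assoc[of p'] k by (meson dvd_mult dvd_trans)
    hence "r * r dvd h" unfolding k using assoc[OF p] by (intro mult_dvd_mono)
    hence "is_unit r" using squarefreeD[OF sq] by (simp add: power2_eq_square)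
    thus False using assms(1) by (simp add: irreducible_def)
  qed
  thus ?thesis unfolding k using p(1) by (simp add: irreducible_mult_unit_left mult.commute[of p])
qed

lemma defining_poly_self:
  fixes h :: "'a::{alg_closed_field,field_char_0,field_gcd} poly poly"
  assumes "irreducible h" shows "defining_poly h (zero_set h)"
  using assms by (auto simp: defining_poly_def irreducible_def
    intro!: squarefree_prime_elem irreducible_imp_prime_elem)

lemma not_reducible_zero_set:
  fixes r :: "'a::{alg_closed_field,field_char_0,field_gcd} poly poly"
  assumes "irreducible r" shows "\<not> reducible_curve (zero_set r)"
  using defining_poly_irreducible[OF assms] by (auto simp: reducible_curve_def)

lemma curve_components_irreducible:
  fixes C :: "('a::{alg_closed_field,field_char_0,field_gcd} \<times> 'a) set"
  assumes "irreducible h" "defining_poly h C"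
  shows "curve_components C = {C}"
proof -
  have C: "C = zero_set h" using assms(2) by (simp add: defining_poly_def)
  have "zero_set g = C" if "irreducible g" "g dvd h'" "defining_poly h' C" for g h'
  proof -
    have "zero_set g \<subseteq> zero_set h"
      using zero_set_mono[OF that(2)] that(3) by (simp add: defining_poly_def C)
    hence "g dvd h" by (simp only: irreducible_dvd_iff_zero_set[OF that(1)])
    moreover from this have "h dvd g" by (rule irreducible_associated[OF that(1) assms(1)])
    ultimately show ?thesis unfolding C by (rule zero_set_eqI)
  qed
  hence "curve_components C \<subseteq> {C}" by (auto simp: curve_components_def)
  moreover have "zero_set h \<in> curve_components C"
    unfolding curve_components_def using assms by (intro CollectI exI[of _ h]) auto
  ultimately show ?thesis using C by blast
qed

text \<open>
  How a conchoid or a reparametrizing curve is shown to be reducible with known components.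
\<close>

lemma two_component_curve:
  fixes g h :: "'a::{alg_closed_field,field_char_0,field_gcd} poly poly"
  assumes "irreducible g" "irreducible h" "\<not> g dvd h"
  shows "reducible_curve (zero_set (g * h))"
    and "curve_components (zero_set (g * h)) = {zero_set g, zero_set h}"
    and "zero_set g \<noteq> zero_set h"
proof -
  have "coprime g h"
    using prime_elem_imp_coprime[OF irreducible_imp_prime_elem[OF assms(1)] assms(3)] .
  hence dp: "defining_poly (g * h) (zero_set (g * h))"
    using assms defining_poly_self[of g] defining_poly_self[of h]
    by (auto simp: defining_poly_def is_unit_mult_iff intro: squarefree_mult_coprime)
  moreover have "\<not> irreducible (g * h)"
    using assms by (auto simp: irreducible_def)
  ultimately show "reducible_curve (zero_set (g * h))" by (auto simp: reducible_curve_def)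
  have "zero_set p \<in> {zero_set g, zero_set h}"
    if "irreducible p" "p dvd h'" "defining_poly h' (zero_set (g * h))" for p h'
  proof -
    have "zero_set p \<subseteq> zero_set (g * h)"
      using zero_set_mono[OF that(2)] that(3) by (simp add: defining_poly_def)
    hence "p dvd g * h" by (simp only: irreducible_dvd_iff_zero_set[OF that(1)])
    hence "p dvd g \<or> p dvd h"
      using irreducible_imp_prime_elem[OF that(1)] by (simp add: prime_elem_dvd_mult_iff)
    thus ?thesis
      using irreducible_associated[OF that(1)] assms(1,2) zero_set_eqI[of p] by auto
  qed
  hence "curve_components (zero_set (g * h)) \<subseteq> {zero_set g, zero_set h}"
    by (auto simp: curve_components_def)
  moreover have "zero_set p \<in> curve_components (zero_set (g * h))"
    if "irreducible p" "p dvd g * h" for p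
    unfolding curve_components_def using that dp by (intro CollectI exI[of _ p] conjI exI[of _ "g * h"]) auto
  ultimately show "curve_components (zero_set (g * h)) = {zero_set g, zero_set h}"
    using assms(1,2) by (intro equalityI) auto
  show "zero_set g \<noteq> zero_set h" using assms irreducible_dvd_iff_zero_set[of g h] by auto
qed

section \<open>Implicit equations of parametrized curves\<close>

definition rat_map :: "('a::field \<Rightarrow> 'a \<times> 'a) \<Rightarrow> bool" where
  "rat_map X \<longleftrightarrow> rat_germ (\<lambda>t. fst (X t)) \<and> rat_germ (\<lambda>t. snd (X t))"

definition nonconst_map :: "('a::field \<Rightarrow> 'a \<times> 'a) \<Rightarrow> bool" where
  "nonconst_map X \<longleftrightarrow> rat_map X \<and> (\<forall>c. \<not> (\<forall>\<^sub>\<infinity>t. X t = c))"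

text \<open>
  The Zariski closure of the image of \<open>X\<close>, in a form that is insensitive to finitely many values.
\<close>

definition locus :: "('a::field \<Rightarrow> 'a \<times> 'a) \<Rightarrow> ('a \<times> 'a) set" where
  "locus X = {y. \<forall>g. (\<forall>\<^sub>\<infinity>t. eval2 g (X t) = 0) \<longrightarrow> eval2 g y = 0}"

lemma locusI: "(\<And>g. \<forall>\<^sub>\<infinity>t. eval2 g (X t) = 0 \<Longrightarrow> eval2 g y = 0) \<Longrightarrow> y \<in> locus X"
  by (simp add: locus_def)

lemma locusD: "y \<in> locus X \<Longrightarrow> \<forall>\<^sub>\<infinity>t. eval2 g (X t) = 0 \<Longrightarrow> eval2 g y = 0"
  by (simp add: locus_def)

lemma MOST_eq_cong:
  assumes "\<forall>\<^sub>\<infinity>t. X t = Y t" shows "(\<forall>\<^sub>\<infinity>t. P (X t)) \<longleftrightarrow> (\<forall>\<^sub>\<infinity>t. P (Y t))"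
proof
  assume "\<forall>\<^sub>\<infinity>t. P (X t)" with assms show "\<forall>\<^sub>\<infinity>t. P (Y t)" by eventually_elim simp
next
  assume "\<forall>\<^sub>\<infinity>t. P (Y t)" with assms show "\<forall>\<^sub>\<infinity>t. P (X t)" by eventually_elim simp
qed

lemma locus_cong: "\<forall>\<^sub>\<infinity>t. X t = Y t \<Longrightarrow> locus X = locus Y"
  using MOST_eq_cong[where X = X and Y = Y and P = "\<lambda>z. eval2 g z = 0" for g]
  by (simp add: locus_def)

lemma rat_map_cong: "rat_map X \<Longrightarrow> \<forall>\<^sub>\<infinity>t. Y t = X t \<Longrightarrow> rat_map Y"
  unfolding rat_map_def
  by (elim conjE, intro conjI; erule rat_germ_cong; erule eventually_mono; simp)

lemma nonconst_map_cong: "nonconst_map X \<Longrightarrow> \<forall>\<^sub>\<infinity>t. Y t = X t \<Longrightarrow> nonconst_map Y"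
  unfolding nonconst_map_def
proof (elim conjE, intro conjI allI notI)
  fix c assume "\<forall>\<^sub>\<infinity>t. Y t = X t" "\<forall>c. \<not> (\<forall>\<^sub>\<infinity>t. X t = c)" "\<forall>\<^sub>\<infinity>t. Y t = c"
  moreover from this(1,3) have "\<forall>\<^sub>\<infinity>t. X t = c" by eventually_elim simp
  ultimately show False by blast
qed (rule rat_map_cong)

lemma nonconst_map_rat_map: "nonconst_map X \<Longrightarrow> rat_map X"
  by (simp add: nonconst_map_def)

lemma rat_map_eval2: "rat_map X \<Longrightarrow> rat_germ (\<lambda>t. eval2 g (X t))"
  by (simp add: rat_map_def rat_germ_eval2)

lemma rat_map_vanishing:
  fixes X :: "'a::field_char_0 \<Rightarrow> 'a \<times> 'a"
  assumes "rat_map X"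
  shows "(\<forall>\<^sub>\<infinity>t. eval2 g (X t) = 0) \<or> (\<forall>\<^sub>\<infinity>t. eval2 g (X t) \<noteq> 0)"
  by (rule rat_germ_zero_or_nonzero[OF rat_map_eval2[OF assms]])

lemma nonconst_map_iff:
  fixes X :: "'a::field_char_0 \<Rightarrow> 'a \<times> 'a"
  shows "nonconst_map X \<longleftrightarrow> rat_map X \<and> (nonconst (\<lambda>t. fst (X t)) \<or> nonconst (\<lambda>t. snd (X t)))"
proof -
  have "(\<exists>c. \<forall>\<^sub>\<infinity>t. X t = c) \<longleftrightarrow> (\<exists>c. \<forall>\<^sub>\<infinity>t. fst (X t) = c) \<and> (\<exists>c. \<forall>\<^sub>\<infinity>t. snd (X t) = c)"
    (is "?L \<longleftrightarrow> ?R")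
  proof
    assume ?L
    then obtain c where "\<forall>\<^sub>\<infinity>t. X t = c" ..
    hence "\<forall>\<^sub>\<infinity>t. fst (X t) = fst c" "\<forall>\<^sub>\<infinity>t. snd (X t) = snd c" by (auto elim: eventually_mono)
    thus ?R by blast
  next
    assume ?R
    then obtain c d where "\<forall>\<^sub>\<infinity>t. fst (X t) = c" "\<forall>\<^sub>\<infinity>t. snd (X t) = d" by blast
    hence "\<forall>\<^sub>\<infinity>t. X t = (c, d)" by eventually_elim (simp add: prod_eq_iff)
    thus ?L ..
  qed
  thus ?thesis unfolding nonconst_map_def nonconst_def rat_map_def by blast
qed

lemma nonconst_map_notin:
  fixes X :: "'a::field_char_0 \<Rightarrow> 'a \<times> 'a"
  assumes "nonconst_map X" "finite B" shows "\<forall>\<^sub>\<infinity>t. X t \<notin> B"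
proof -
  have "(\<forall>\<^sub>\<infinity>t. fst (X t) \<notin> fst ` B) \<or> (\<forall>\<^sub>\<infinity>t. snd (X t) \<notin> snd ` B)"
    using assms nonconst_notin[of _ "fst ` B"] nonconst_notin[of _ "snd ` B"]
    unfolding nonconst_map_iff by blast
  thus ?thesis by (elim disjE; elim eventually_mono; blast)
qed


text \<open>
  Gaussian elimination in the coefficient of \<open>x\<^sup>n\<close> leaves one polynomial fewer and one
  coefficient fewer.
\<close>

lemma poly_linear_relation:
  fixes f :: "'i \<Rightarrow> 'a::field poly"
  assumes "finite I" "n < card I" "\<And>i k. i \<in> I \<Longrightarrow> n \<le> k \<Longrightarrow> coeff (f i) k = 0"
  shows "\<exists>c. (\<exists>i\<in>I. c i \<noteq> 0) \<and> (\<Sum>i\<in>I. smult (c i) (f i)) = 0"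
  using assms
proof (induction n arbitrary: I f)
  case 0
  then obtain j where j: "j \<in> I" by fastforce
  have "f i = 0" if "i \<in> I" for i using 0(3)[OF that] by (intro poly_eqI) simp
  thus ?case using j by (intro exI[of _ "\<lambda>_. 1"]) auto
next
  case (Suc n)
  show ?case
  proof (cases "\<forall>i\<in>I. coeff (f i) n = 0")
    case True
    have "coeff (f i) k = 0" if "i \<in> I" "n \<le> k" for i k
      using True Suc.prems(3)[of i k] that by (cases "k = n") auto
    thus ?thesis using Suc.IH[of I f] Suc.prems by auto
  next
    case False
    then obtain j where j: "j \<in> I" "coeff (f j) n \<noteq> 0" by blast
    define r where "r i = coeff (f i) n / coeff (f j) n" for i
    define g where "g i = f i - smult (r i) (f j)" for i
    have "\<exists>c. (\<exists>i\<in>I - {j}. c i \<noteq> 0) \<and> (\<Sum>i\<in>I - {j}. smult (c i) (g i)) = 0"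
    proof (rule Suc.IH)
      show "finite (I - {j})" "n < card (I - {j})" using Suc.prems j by auto
      fix i k assume "i \<in> I - {j}" "n \<le> k"
      thus "coeff (g i) k = 0"
        using Suc.prems(3)[of i k] Suc.prems(3)[of j k] j by (cases "k = n") (auto simp: g_def r_def)
    qed
    then obtain c where c: "\<exists>i\<in>I - {j}. c i \<noteq> 0" "(\<Sum>i\<in>I - {j}. smult (c i) (g i)) = 0" by blast
    define c' where "c' i = (if i = j then - (\<Sum>i\<in>I - {j}. c i * r i) else c i)" for i
    have "(\<Sum>i\<in>I. smult (c' i) (f i)) = smult (c' j) (f j) + (\<Sum>i\<in>I - {j}. smult (c i) (f i))"
      using Suc.prems(1) j(1) by (subst sum.remove[of _ j]) (auto simp: c'_def intro!: sum.cong)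
    also have "\<dots> = (\<Sum>i\<in>I - {j}. smult (c i) (f i) - smult (c i * r i) (f j))"
      by (simp add: c'_def sum_subtractf smult_sum)
    also have "\<dots> = (\<Sum>i\<in>I - {j}. smult (c i) (g i))"
      by (simp add: g_def smult_diff_right)
    finally show ?thesis using c by (intro exI[of _ c'] conjI) (auto simp: c'_def)
  qed
qed

text \<open>
  The \<open>(N + 1)\<^sup>2\<close> monomials of bidegree at most \<open>N\<close> become, after clearing denominators,
  polynomials in \<open>t\<close> whose degree grows only linearly in \<open>N\<close>.
\<close>

lemma implicit_equation_exists:
  fixes X :: "'a::field_char_0 \<Rightarrow> 'a \<times> 'a"
  assumes "rat_map X"
  obtains h where "h \<noteq> 0" "\<forall>\<^sub>\<infinity>t. eval2 h (X t) = 0"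
proof -
  obtain p1 q1 where 1: "q1 \<noteq> 0" "\<forall>\<^sub>\<infinity>t. fst (X t) = poly p1 t / poly q1 t"
    using assms by (auto simp: rat_map_def rat_germ_def)
  obtain p2 q2 where 2: "q2 \<noteq> 0" "\<forall>\<^sub>\<infinity>t. snd (X t) = poly p2 t / poly q2 t"
    using assms by (auto simp: rat_map_def rat_germ_def)
  define M where "M = Suc (degree p1 + degree q1 + degree p2 + degree q2)"
  \<comment> \<open>Then \<open>(N + 1)\<^sup>2\<close> exceeds the number \<open>2 N M + 1\<close> of coefficients.\<close>
  define N where "N = 2 * M"
  define I where "I = {..N} \<times> {..N}"
  define f where "f = (\<lambda>(i, j). p1 ^ i * q1 ^ (N - i) * (p2 ^ j * q2 ^ (N - j)))"
  have deg_pow: "degree (p ^ i * q ^ (N - i)) \<le> N * M"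
    if "degree p \<le> M" "degree q \<le> M" "i \<le> N" for p q :: "'a poly" and i
  proof -
    have "degree (p ^ i * q ^ (N - i)) \<le> i * degree p + (N - i) * degree q"
      using degree_mult_le[of "p ^ i" "q ^ (N - i)"] degree_power_le[of p i]
        degree_power_le[of q "N - i"] by (simp add: mult.commute)
    also have "\<dots> \<le> i * M + (N - i) * M" using that by (intro add_mono mult_le_mono2)
    also have "\<dots> = N * M" using that(3) by (simp flip: add_mult_distrib)
    finally show ?thesis .
  qed
  have deg: "degree (f x) \<le> 2 * (N * M)" if x: "x \<in> I" for x
  proof (cases x)
    case (Pair i j)
    have "degree (f x) \<le> N * M + N * M"
      using degree_mult_le[of "p1 ^ i * q1 ^ (N - i)" "p2 ^ j * q2 ^ (N - j)"]
        deg_pow[of p1 q1 i] deg_pow[of p2 q2 j] x by (simp add: Pair f_def I_def M_def)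
    thus ?thesis by simp
  qed
  have "\<exists>c. (\<exists>x\<in>I. c x \<noteq> 0) \<and> (\<Sum>x\<in>I. smult (c x) (f x)) = 0"
  proof (rule poly_linear_relation[where n = "Suc (2 * (N * M))"])
    show "Suc (2 * (N * M)) < card I"
      by (simp add: I_def N_def M_def algebra_simps)
    show "coeff (f x) k = 0" if "x \<in> I" "Suc (2 * (N * M)) \<le> k" for x k
      using deg[OF that(1)] that(2) by (intro coeff_eq_0) simp
  qed (simp add: I_def)
  then obtain c where c: "\<exists>x\<in>I. c x \<noteq> 0" "(\<Sum>x\<in>I. smult (c x) (f x)) = 0" by blast
  define h where "h = (\<Sum>x\<in>I. monom (monom (c x) (fst x)) (snd x))"
  have "coeff (coeff h j) i = c (i, j)" if "(i, j) \<in> I" for i j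
  proof -
    have "coeff (coeff h j) i = (\<Sum>x\<in>I. if x = (i, j) then c x else 0)"
      unfolding h_def coeff_sum by (rule sum.cong) (auto simp: prod_eq_iff)
    thus ?thesis using that by (simp add: I_def)
  qed
  hence "h \<noteq> 0" using c(1) by fastforce
  moreover have "\<forall>\<^sub>\<infinity>t. eval2 h (X t) = 0"
    using 1(2) 2(2) MOST_poly_nonzero[OF 1(1)] MOST_poly_nonzero[OF 2(1)]
  proof eventually_elim
    case (elim t)
    let ?x = "poly p1 t" and ?u = "poly q1 t" and ?y = "poly p2 t" and ?v = "poly q2 t"
    have "?u ^ N * ?v ^ N * eval2 h (X t) = (\<Sum>x\<in>I. c x * poly (f x) t)"
      unfolding h_def eval2_sum sum_distrib_left
    proof (rule sum.cong)
      fix x assume x: "x \<in> I"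
      then obtain i j where ij: "x = (i, j)" "i \<le> N" "j \<le> N" by (auto simp: I_def)
      have "?u ^ N = ?u ^ i * ?u ^ (N - i)" "?v ^ N = ?v ^ j * ?v ^ (N - j)"
        using ij by (simp_all flip: power_add)
      thus "?u ^ N * ?v ^ N * eval2 (monom (monom (c x) (fst x)) (snd x)) (X t) = c x * poly (f x) t"
        using elim by (simp add: ij f_def eval2_def poly_monom power_divide)
    qed simp
    also have "\<dots> = poly (\<Sum>x\<in>I. smult (c x) (f x)) t" by (simp add: poly_sum)
    finally show ?case using elim by (simp add: c(2))
  qed
  ultimately show ?thesis by (rule that)
qed

text \<open>
  The ideal of a rational map is prime.
\<close>

lemma prod_mset_vanishing:
  fixes X :: "'a::field_char_0 \<Rightarrow> 'a \<times> 'a"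
  assumes "rat_map X" "\<forall>\<^sub>\<infinity>t. eval2 (prod_mset A) (X t) = 0"
  shows "\<exists>a\<in>#A. \<forall>\<^sub>\<infinity>t. eval2 a (X t) = 0"
  using assms(2)
proof (induction A)
  case empty
  thus ?case using MOST_contr[of "\<lambda>t. False"] by simp
next
  case (add a A)
  show ?case
  proof (cases "\<forall>\<^sub>\<infinity>t. eval2 a (X t) = 0")
    case False
    hence "\<forall>\<^sub>\<infinity>t. eval2 a (X t) \<noteq> 0" using rat_map_vanishing[OF assms(1)] by blast
    with add.prems have "\<forall>\<^sub>\<infinity>t. eval2 (prod_mset A) (X t) = 0" by eventually_elim simp
    from add.IH[OF this] show ?thesis by auto
  qed auto
qed

text \<open>
  Some irreducible factor \<open>h\<close> of an implicit equation vanishes on the image. A further equation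
  shares infinitely many zeros with \<open>h\<close>, so \<open>h\<close> generates the ideal.
\<close>

theorem locus_irreducible:
  fixes X :: "'a::{alg_closed_field,field_char_0,field_gcd} \<Rightarrow> 'a \<times> 'a"
  assumes "nonconst_map X"
  obtains h where "irreducible h" "locus X = zero_set h"
    "\<And>g. (\<forall>\<^sub>\<infinity>t. eval2 g (X t) = 0) \<longleftrightarrow> h dvd g"
proof -
  note rat = nonconst_map_rat_map[OF assms]
  obtain h0 where h0: "h0 \<noteq> 0" "\<forall>\<^sub>\<infinity>t. eval2 h0 (X t) = 0"
    by (rule implicit_equation_exists[OF rat])
  obtain A where A: "\<And>x. x \<in># A \<Longrightarrow> prime x" "normalize (prod_mset A) = normalize h0"
    using prime_factorization_exists'[OF h0(1)] by blast
  have "h0 dvd prod_mset A" using A(2) by (simp add: associated_iff_dvd)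
  then obtain k where "prod_mset A = h0 * k" by (elim dvdE)
  with h0(2) have "\<forall>\<^sub>\<infinity>t. eval2 (prod_mset A) (X t) = 0" by (elim eventually_mono) simp
  then obtain h where h: "h \<in># A" "\<forall>\<^sub>\<infinity>t. eval2 h (X t) = 0"
    using prod_mset_vanishing[OF rat] by blast
  have irr: "irreducible h" using A(1)[OF h(1)] by (simp add: prime_elem_imp_irreducible)
  have iff: "(\<forall>\<^sub>\<infinity>t. eval2 g (X t) = 0) \<longleftrightarrow> h dvd g" for g
  proof
    assume g: "\<forall>\<^sub>\<infinity>t. eval2 g (X t) = 0"
    have "infinite (zero_set h \<inter> zero_set g)"
    proof
      assume "finite (zero_set h \<inter> zero_set g)"
      from nonconst_map_notin[OF assms this] g h(2) have "\<forall>\<^sub>\<infinity>t::'a. False"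
        by eventually_elim (simp add: zero_set_def)
      thus False using MOST_ex by blast
    qed
    thus "h dvd g" using irreducible_dvd_iff_infinite[OF irr] by blast
  next
    assume "h dvd g"
    then obtain k where "g = h * k" by (elim dvdE)
    thus "\<forall>\<^sub>\<infinity>t. eval2 g (X t) = 0" using h(2) by (elim eventually_mono) simp
  qed
  have "locus X = zero_set h"
  proof (intro equalityI subsetI)
    fix y assume "y \<in> locus X"
    thus "y \<in> zero_set h" using locusD[OF _ h(2)] by (simp add: zero_set_def)
  next
    fix y assume y: "y \<in> zero_set h"
    show "y \<in> locus X"
    proof (rule locusI)
      fix g assume "\<forall>\<^sub>\<infinity>t. eval2 g (X t) = 0"
      hence "h dvd g" by (simp add: iff)
      thus "eval2 g y = 0" using y by (auto simp: zero_set_def)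
    qed
  qed
  with irr iff show ?thesis by (intro that)
qed

subsection \<open>Parametrizations\<close>

lemma rat_map_par_eval: "rat_map (par_eval P)"
  by (simp add: rat_map_def par_eval_def rat_germ_rf_eval)

text \<open>
  On the parameters where both components are defined, every polynomial in them is a quotient whose
  denominator has no zero there. This transports identities from almost all of these parameters to
  all of them.
\<close>

lemma par_eval_regular:
  fixes P :: "'a::{field_char_0,field_gcd} poly fract \<times> 'a poly fract"
  obtains p q where "\<And>t. par_defined P t \<Longrightarrow> poly q t \<noteq> 0"
    "\<And>t. par_defined P t \<Longrightarrow> eval2 g (par_eval P t) = poly p t / poly q t"
proof -
  define Q where "Q F \<longleftrightarrow> (\<exists>p q. \<forall>t. par_defined P t \<longrightarrow> poly q t \<noteq> 0 \<and> F t = poly p t / poly q t)"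
    for F :: "'a \<Rightarrow> 'a"
  have "Q (\<lambda>t. eval2 g (rf_eval (fst P) t, rf_eval (snd P) t))"
  proof (rule eval2_closed)
    show "Q (\<lambda>t. c)" for c unfolding Q_def by (intro exI[of _ "[:c:]"] exI[of _ 1]) simp
    show "Q (rf_eval (fst P))" "Q (rf_eval (snd P))"
      unfolding Q_def rf_eval_def by (auto simp: par_defined_def rf_defined_def)
  next
    fix F G assume "Q F" "Q G"
    then obtain p q p' q' where *: "\<And>t. par_defined P t \<Longrightarrow> poly q t \<noteq> 0 \<and> F t = poly p t / poly q t"
      "\<And>t. par_defined P t \<Longrightarrow> poly q' t \<noteq> 0 \<and> G t = poly p' t / poly q' t"
      unfolding Q_def by metis
    show "Q (\<lambda>t. F t + G t)" unfolding Q_def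
      by (rule exI[of _ "p * q' + p' * q"], rule exI[of _ "q * q'"]) (use * in \<open>simp add: add_frac_eq\<close>)
    show "Q (\<lambda>t. F t * G t)" unfolding Q_def
      by (rule exI[of _ "p * p'"], rule exI[of _ "q * q'"]) (use * in simp)
  qed
  thus ?thesis using that unfolding Q_def par_eval_def by blast
qed

lemma par_eval_vanishing:
  fixes P :: "'a::{field_char_0,field_gcd} poly fract \<times> 'a poly fract"
  assumes "\<forall>\<^sub>\<infinity>t. eval2 g (par_eval P t) = 0" "par_defined P t"
  shows "eval2 g (par_eval P t) = 0"
proof -
  obtain p q where pq: "\<And>t. par_defined P t \<Longrightarrow> poly q t \<noteq> 0"
    "\<And>t. par_defined P t \<Longrightarrow> eval2 g (par_eval P t) = poly p t / poly q t"
    by (rule par_eval_regular[of P g]) blast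
  have "\<forall>\<^sub>\<infinity>t. poly p t = 0"
    using assms(1) par_defined_MOST[of P] by eventually_elim (use pq in force)
  hence "p = 0" by (rule MOST_poly_zero)
  thus ?thesis using pq[OF assms(2)] by simp
qed

lemma zariski_closure_par:
  fixes P :: "'a::{field_char_0,field_gcd} poly fract \<times> 'a poly fract"
  shows "zariski_closure (par_eval P ` {t. par_defined P t}) = locus (par_eval P)"
proof -
  have "(\<forall>z\<in>par_eval P ` {t. par_defined P t}. eval2 g z = 0) \<longleftrightarrow> (\<forall>\<^sub>\<infinity>t. eval2 g (par_eval P t) = 0)" for g
  proof
    assume "\<forall>z\<in>par_eval P ` {t. par_defined P t}. eval2 g z = 0"
    with par_defined_MOST[of P] show "\<forall>\<^sub>\<infinity>t. eval2 g (par_eval P t) = 0" by (elim eventually_mono) auto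
  next
    assume "\<forall>\<^sub>\<infinity>t. eval2 g (par_eval P t) = 0"
    from par_eval_vanishing[OF this] show "\<forall>z\<in>par_eval P ` {t. par_defined P t}. eval2 g z = 0" by blast
  qed
  thus ?thesis by (simp add: zariski_closure_def locus_def)
qed

lemma const_rf_iff:
  fixes r :: "'a::{field_char_0,field_gcd} poly fract"
  shows "r \<in> range const_rf \<longleftrightarrow> \<not> nonconst (rf_eval r)"
proof -
  have "(\<forall>\<^sub>\<infinity>t. rf_eval r t = c) \<longleftrightarrow> r = const_rf c" for c
  proof -
    have "(\<forall>\<^sub>\<infinity>t. rf_eval r t = c) \<longleftrightarrow> (\<forall>\<^sub>\<infinity>t. rf_eval r t = rf_eval (const_rf c) t)"
      using eventually_subst[of "\<lambda>t. rf_eval r t = c" _ cofinite] rf_eval_const[of c]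
      by (intro eventually_subst) (auto elim: eventually_mono)
    thus ?thesis by (simp only: rf_eval_eq_iff)
  qed
  thus ?thesis by (auto simp: nonconst_def rat_germ_rf_eval)
qed

lemma parametrization_iff:
  fixes P :: "'a::{field_char_0,field_gcd} poly fract \<times> 'a poly fract"
  shows "parametrization P C \<longleftrightarrow> nonconst_map (par_eval P) \<and> locus (par_eval P) = C"
  by (simp add: parametrization_def zariski_closure_par nonconst_map_iff const_rf_iff
      rat_map_par_eval) (simp add: par_eval_def)

lemma rat_map_par:
  fixes X :: "'a::{field_char_0,field_gcd} \<Rightarrow> 'a \<times> 'a"
  assumes "rat_map X" obtains P where "\<forall>\<^sub>\<infinity>t. par_eval P t = X t"
proof -
  obtain r s where "\<forall>\<^sub>\<infinity>t. rf_eval r t = fst (X t)" "\<forall>\<^sub>\<infinity>t. rf_eval s t = snd (X t)"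
    using assms rat_germ_fract unfolding rat_map_def by metis
  hence "\<forall>\<^sub>\<infinity>t. par_eval (r, s) t = X t"
    by eventually_elim (simp add: par_eval_def prod_eq_iff)
  thus ?thesis by (rule that)
qed

lemma rational_curve_locus:
  fixes X :: "'a::{alg_closed_field,field_char_0,field_gcd} \<Rightarrow> 'a \<times> 'a"
  assumes "nonconst_map X" shows "rational_curve (locus X)"
proof -
  obtain P where P: "\<forall>\<^sub>\<infinity>t. par_eval P t = X t"
    by (rule rat_map_par[OF nonconst_map_rat_map[OF assms]])
  obtain h where h: "irreducible h" "locus X = zero_set h" by (rule locus_irreducible[OF assms])
  hence "irreducible_curve (locus X)"
    unfolding irreducible_curve_def by (intro exI[of _ h]) (simp add: defining_poly_self)
  moreover have "parametrization P (locus X)"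
    using nonconst_map_cong[OF assms P] locus_cong[OF P] by (simp add: parametrization_iff)
  ultimately show ?thesis unfolding rational_curve_def by blast
qed

section \<open>Lueroth's theorem for plane curves\<close>

subsection \<open>Separable fibres\<close>

lemma rsquarefree_dvd:
  fixes p q :: "'a::field_char_0 poly"
  assumes "rsquarefree p" "q dvd p" shows "rsquarefree q"
proof -
  obtain k where "p = q * k" using assms(2) by (elim dvdE)
  thus ?thesis using assms(1) unfolding rsquarefree_roots by (auto simp: pderiv_mult)
qed

text \<open>
  This turns degrees into numbers of points in a fibre.
\<close>

lemma card_roots_rsquarefree:
  fixes p :: "'a::{alg_closed_field,field_char_0} poly"
  assumes "rsquarefree p" shows "card {x. poly p x = 0} = degree p"
  using assms
proof (induction "degree p" arbitrary: p)
  case 0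
  then obtain c where "p = [:c:]" by (metis degree_eq_zeroE)
  with 0 show ?case by (auto simp: rsquarefree_def)
next
  case (Suc n)
  then obtain x where x: "poly p x = 0" using alg_closed_imp_poly_has_root[of p] by auto
  then obtain k where k: "p = [:-x, 1:] * k" by (auto simp: poly_eq_0_iff_dvd elim!: dvdE)
  have p0: "p \<noteq> 0" using Suc.prems by (simp add: rsquarefree_def)
  hence "k \<noteq> 0" using k by auto
  hence "degree p = Suc (degree k)" unfolding k by (subst degree_mult_eq) auto
  hence deg: "degree k = n" using Suc.hyps by simp
  have "rsquarefree k" by (rule rsquarefree_dvd[OF Suc.prems]) (simp only: k dvd_triv_right)
  hence card: "card {x. poly k x = 0} = n" using Suc.hyps(1)[of k] deg by simp
  have "poly k x \<noteq> 0"
  proof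
    assume "poly k x = 0"
    hence "poly (pderiv p) x = 0" unfolding k pderiv_mult by simp
    thus False using Suc.prems x unfolding rsquarefree_roots by blast
  qed
  moreover have "{x. poly p x = 0} = insert x {x. poly k x = 0}" by (auto simp: k)
  ultimately show ?case
    using poly_roots_finite[OF \<open>k \<noteq> 0\<close>] card Suc.hyps(2) by simp
qed

lemma coprime_no_common_root:
  fixes p q :: "'a::field_gcd poly"
  assumes "coprime p q" "poly p x = 0" shows "poly q x \<noteq> 0"
proof
  assume "poly q x = 0"
  hence "is_unit [:-x, 1:]"
    using assms by (intro coprime_common_divisor[OF assms(1)]) (simp_all add: poly_eq_0_iff_dvd)
  thus False by (auto simp: is_unit_poly_iff)
qed

lemma pderiv_dvd_self:
  fixes p :: "'a::field_char_0 poly"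
  assumes "p dvd pderiv p" shows "degree p = 0"
proof (rule ccontr)
  assume "degree p \<noteq> 0"
  moreover from this have "pderiv p \<noteq> 0" by (simp add: pderiv_eq_0_iff)
  ultimately show False using dvd_imp_degree_le[OF assms] by (simp add: degree_pderiv)
qed

lemma wronskian_nonzero:
  fixes p q :: "'a::{field_char_0,field_gcd} poly"
  assumes "coprime p q" "degree p \<noteq> 0 \<or> degree q \<noteq> 0"
  shows "pderiv p * q - p * pderiv q \<noteq> 0"
proof
  have cop: "coprime q p" using assms(1) by (simp only: coprime_commute)
  assume "pderiv p * q - p * pderiv q = 0"
  hence eq: "pderiv p * q = p * pderiv q" by simp
  have "p dvd pderiv p * q" unfolding eq by simp
  hence "p dvd pderiv p" by (rule coprime_dvd_mult_left_iff[OF assms(1), THEN iffD1])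
  moreover have "q dvd p * pderiv q" unfolding eq[symmetric] by simp
  hence "q dvd pderiv q"
    by (rule coprime_dvd_mult_right_iff[OF cop, THEN iffD1])
  ultimately have "degree p = 0" "degree q = 0" by (simp_all add: pderiv_dvd_self)
  thus False using assms(2) by simp
qed

text \<open>
  A multiple root \<open>x\<close> of \<open>c q - p\<close> is a zero of the Wronskian of \<open>p\<close> and \<open>q\<close>, and it
  determines \<open>c = p(x) / q(x)\<close>; so only finitely many values \<open>c\<close> have multiple roots.
\<close>

lemma MOST_fibre_rsquarefree:
  fixes p q :: "'a::{field_char_0,field_gcd} poly"
  assumes "coprime p q" "nonconst (\<lambda>t. poly p t / poly q t)"
  shows "\<forall>\<^sub>\<infinity>t. rsquarefree (smult (poly p t / poly q t) q - p)"
proof -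
  define W where "W = pderiv p * q - p * pderiv q"
  have "degree p \<noteq> 0 \<or> degree q \<noteq> 0"
  proof (rule ccontr)
    assume "\<not> (degree p \<noteq> 0 \<or> degree q \<noteq> 0)"
    then obtain a b where "p = [:a:]" "q = [:b:]" by (auto elim!: degree_eq_zeroE)
    hence "\<forall>\<^sub>\<infinity>t. poly p t / poly q t = a / b" by simp
    thus False using assms(2) unfolding nonconst_def by blast
  qed
  hence "W \<noteq> 0" unfolding W_def by (rule wronskian_nonzero[OF assms(1)])
  hence "finite ((\<lambda>x. poly p x / poly q x) ` {x. poly W x = 0})"
    by (intro finite_imageI poly_roots_finite)
  from nonconst_notin[OF assms(2) this] show ?thesis
  proof eventually_elim
    case (elim t)
    define c where "c = poly p t / poly q t"
    show ?case unfolding rsquarefree_roots c_def[symmetric]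
    proof (intro allI notI, elim conjE)
      fix x assume "poly (smult c q - p) x = 0" "poly (pderiv (smult c q - p)) x = 0"
      hence x: "poly p x = c * poly q x" "poly (pderiv p) x = c * poly (pderiv q) x"
        by (simp_all add: pderiv_diff pderiv_smult)
      hence "poly W x = 0" by (simp add: W_def)
      moreover have "poly q x \<noteq> 0" using coprime_no_common_root[OF assms(1), of x] x(1) by auto
      ultimately have "c \<in> (\<lambda>x. poly p x / poly q x) ` {x. poly W x = 0}"
        using x(1) by (intro image_eqI[of _ _ x]) auto
      thus False using elim by (simp add: c_def)
    qed
  qed
qed

lemma rat_germ_coprime:
  fixes F :: "'a::{field_char_0,field_gcd} \<Rightarrow> 'a"
  assumes "rat_germ F"
  obtains p q where "q \<noteq> 0" "coprime p q" "\<forall>\<^sub>\<infinity>t. F t = poly p t / poly q t"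
proof -
  obtain r where r: "\<forall>\<^sub>\<infinity>t. rf_eval r t = F t" by (rule rat_germ_fract[OF assms])
  hence "\<forall>\<^sub>\<infinity>t. F t = poly (fst (quot_of_fract r)) t / poly (snd (quot_of_fract r)) t"
    by (elim eventually_mono) (simp add: rf_eval_def)
  thus ?thesis using coprime_quot_of_fract[of r] by (intro that) auto
qed

subsection \<open>Polynomials in one variable over the coordinate ring\<close>

definition lift_poly :: "'a::comm_ring_1 poly \<Rightarrow> 'a poly poly" where
  "lift_poly p = map_poly (\<lambda>c. [:c:]) p"

lemma coeff_lift_poly [simp]: "coeff (lift_poly p) i = [:coeff p i:]"
  by (simp add: lift_poly_def coeff_map_poly)

lemma specialize_lift_poly [simp]: "specialize t (lift_poly p) = p"
  by (rule poly_eqI) simp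

lemma poly_lift_poly: "poly (lift_poly p) [:T:] = [:poly p T:]"
  by (induction p) (simp_all add: lift_poly_def map_poly_pCons)

lemma specialize_add [simp]: "specialize t (g + h) = specialize t g + specialize t h"
  and specialize_diff [simp]: "specialize t (g - h) = specialize t g - specialize t h"
  and specialize_smult [simp]: "specialize t (smult c g) = smult (poly c t) (specialize t g)"
  and specialize_pCons [simp]: "specialize t (pCons c g) = pCons (poly c t) (specialize t g)"
  for g h :: "'a::comm_ring_1 poly poly"
  by (rule poly_eqI, simp add: coeff_pCons split: nat.splits)+

lemma specialize_mult [simp]: "specialize t (g * h) = specialize t g * specialize t h"
  by (rule poly_eqI) (simp add: coeff_mult poly_sum)

text \<open>
  A polynomial \<open>G\<close> in \<open>T\<close> over \<open>K[y\<^sub>1, y\<^sub>2]\<close>, specialised at a point \<open>y\<close>. With \<open>y = X(t)\<close> its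
  coefficients run through the field \<open>K(X\<^sub>1, X\<^sub>2)\<close>.
\<close>

definition fibre_poly :: "'a::comm_ring_1 \<times> 'a \<Rightarrow> 'a poly poly poly \<Rightarrow> 'a poly" where
  "fibre_poly y G = map_poly (\<lambda>c. eval2 c y) G"

lemma coeff_fibre_poly [simp]: "coeff (fibre_poly y G) i = eval2 (coeff G i) y"
  by (simp add: fibre_poly_def coeff_map_poly)

lemma fibre_poly_add [simp]: "fibre_poly y (G + H) = fibre_poly y G + fibre_poly y H"
  and fibre_poly_diff [simp]: "fibre_poly y (G - H) = fibre_poly y G - fibre_poly y H"
  and fibre_poly_smult [simp]: "fibre_poly y (smult c G) = smult (eval2 c y) (fibre_poly y G)"
  and fibre_poly_pCons [simp]: "fibre_poly y (pCons c G) = pCons (eval2 c y) (fibre_poly y G)"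
  by (rule poly_eqI, simp add: coeff_pCons split: nat.splits)+

lemma fibre_poly_mult [simp]: "fibre_poly y (G * H) = fibre_poly y G * fibre_poly y H"
  by (rule poly_eqI) (simp add: coeff_mult eval2_sum)

lemma fibre_poly_lift_poly [simp]: "fibre_poly y (map_poly (\<lambda>c. [:[:c:]:]) p) = p"
  by (rule poly_eqI) (simp add: coeff_map_poly)

text \<open>
  An algebraic equation for \<open>t\<close> over \<open>K(X\<^sub>1, X\<^sub>2)\<close>, without denominators; its degree over that
  field is the formal one because the leading coefficient does not vanish along \<open>X\<close>.
\<close>

definition relation_at :: "('a::field \<Rightarrow> 'a \<times> 'a) \<Rightarrow> 'a poly poly poly \<Rightarrow> bool" where
  "relation_at X G \<longleftrightarrow> (\<forall>\<^sub>\<infinity>t. poly (fibre_poly (X t) G) t = 0) \<and> (\<forall>\<^sub>\<infinity>t. eval2 (lead_coeff G) (X t) \<noteq> 0)"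

lemma drop_vanishing_leading_terms:
  fixes X :: "'a::field_char_0 \<Rightarrow> 'a \<times> 'a"
  assumes "rat_map X" "\<not> (\<forall>\<^sub>\<infinity>t. eval2 (coeff G i) (X t) = 0)"
  obtains G' where "degree G' \<le> degree G" "\<forall>\<^sub>\<infinity>t. eval2 (lead_coeff G') (X t) \<noteq> 0"
    "\<forall>\<^sub>\<infinity>t. fibre_poly (X t) G' = fibre_poly (X t) G"
proof -
  define J where "J = {i. \<not> (\<forall>\<^sub>\<infinity>t. eval2 (coeff G i) (X t) = 0)}"
  have J: "J \<subseteq> {..degree G}"
  proof
    fix i assume "i \<in> J"
    hence "coeff G i \<noteq> 0" by (auto simp: J_def)
    thus "i \<in> {..degree G}" by (simp add: le_degree)
  qed
  define j where "j = Max J"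
  have "finite J" "i \<in> J" using J assms(2) by (auto simp: J_def finite_subset)
  hence j: "j \<in> J" and j_max: "\<And>k. k \<in> J \<Longrightarrow> k \<le> j" unfolding j_def by (auto intro: Max_in)
  define G' where "G' = poly_cutoff (Suc j) G"
  have cG': "coeff G' k = (if k \<le> j then coeff G k else 0)" for k
    by (simp add: G'_def coeff_poly_cutoff less_Suc_eq_le)
  have "coeff G j \<noteq> 0" using j by (auto simp: J_def)
  hence "degree G' = j" by (intro antisym degree_le le_degree) (auto simp: cG')
  show ?thesis
  proof (rule that[of G'])
    show "degree G' \<le> degree G" using j J \<open>degree G' = j\<close> by auto
    show "\<forall>\<^sub>\<infinity>t. eval2 (lead_coeff G') (X t) \<noteq> 0"
      unfolding \<open>degree G' = j\<close> cG'
      using j rat_map_vanishing[OF assms(1), of "coeff G j"] by (auto simp only: J_def order_refl if_True)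
    have "\<forall>k\<in>{j<..degree G}. \<forall>\<^sub>\<infinity>t. eval2 (coeff G k) (X t) = 0"
      using j_max by (force simp: J_def)
    hence "\<forall>\<^sub>\<infinity>t. \<forall>k\<in>{j<..degree G}. eval2 (coeff G k) (X t) = 0"
      by (intro eventually_ball_finite) auto
    thus "\<forall>\<^sub>\<infinity>t. fibre_poly (X t) G' = fibre_poly (X t) G"
    proof eventually_elim
      case (elim t)
      show ?case
      proof (rule poly_eqI)
        fix k show "coeff (fibre_poly (X t) G') k = coeff (fibre_poly (X t) G) k"
          using elim by (cases "k \<le> degree G") (auto simp: cG' coeff_eq_0)
      qed
    qed
  qed
qed

text \<open>
  A relation of least degree is the minimal polynomial of \<open>t\<close> over \<open>K(X\<^sub>1, X\<^sub>2)\<close>; the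
  statement is that it divides every other relation. Pseudo-division avoids denominators, and the
  leading coefficient does not vanish along \<open>X\<close>.
\<close>

lemma minimal_relation_dvd:
  fixes X :: "'a::field_char_0 \<Rightarrow> 'a \<times> 'a"
  assumes "rat_map X" "relation_at X G" "\<And>G'. relation_at X G' \<Longrightarrow> degree G \<le> degree G'"
    "\<forall>\<^sub>\<infinity>t. poly (fibre_poly (X t) H) t = 0"
  shows "\<forall>\<^sub>\<infinity>t. fibre_poly (X t) G dvd fibre_poly (X t) H"
proof -
  have lc: "\<forall>\<^sub>\<infinity>t. eval2 (lead_coeff G) (X t) \<noteq> 0" and
    root: "\<forall>\<^sub>\<infinity>t. poly (fibre_poly (X t) G) t = 0"
    using assms(2) by (simp_all add: relation_at_def)
  have G0: "G \<noteq> 0"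
  proof
    assume "G = 0"
    with lc have "\<forall>\<^sub>\<infinity>t::'a. False" by simp
    thus False using MOST_ex by blast
  qed
  obtain Q R where QR: "pseudo_divmod H G = (Q, R)" by force
  define k where "k = Suc (degree H) - degree G"
  have eq: "smult (lead_coeff G ^ k) H = G * Q + R" and deg: "R = 0 \<or> degree R < degree G"
    using pseudo_divmod[OF G0 QR] by (simp_all add: k_def)
  have eqt: "smult (eval2 (lead_coeff G) (X t) ^ k) (fibre_poly (X t) H) =
      fibre_poly (X t) G * fibre_poly (X t) Q + fibre_poly (X t) R" for t
    using arg_cong[OF eq, of "fibre_poly (X t)"] by simp
  have rootR: "\<forall>\<^sub>\<infinity>t. poly (fibre_poly (X t) R) t = 0"
    using root assms(4)
  proof eventually_elim
    case (elim t)
    thus ?case using arg_cong[OF eqt[of t], of "\<lambda>p. poly p t"] by simp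
  qed
  have "\<forall>\<^sub>\<infinity>t. eval2 (coeff R i) (X t) = 0" for i
  proof (rule ccontr)
    assume *: "\<not> (\<forall>\<^sub>\<infinity>t. eval2 (coeff R i) (X t) = 0)"
    hence "R \<noteq> 0" by auto
    obtain R' where R': "degree R' \<le> degree R" "\<forall>\<^sub>\<infinity>t. eval2 (lead_coeff R') (X t) \<noteq> 0"
      "\<forall>\<^sub>\<infinity>t. fibre_poly (X t) R' = fibre_poly (X t) R" by (rule drop_vanishing_leading_terms[OF assms(1) *])
    have "\<forall>\<^sub>\<infinity>t. poly (fibre_poly (X t) R') t = 0" using R'(3) rootR by eventually_elim simp
    hence "degree G \<le> degree R'" using R'(2) by (intro assms(3)) (simp add: relation_at_def)
    thus False using R'(1) deg \<open>R \<noteq> 0\<close> by simp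
  qed
  hence "\<forall>\<^sub>\<infinity>t. \<forall>i\<in>{..degree R}. eval2 (coeff R i) (X t) = 0"
    by (intro eventually_ball_finite) auto
  with lc show ?thesis
  proof eventually_elim
    case (elim t)
    have "fibre_poly (X t) R = 0"
    proof (rule poly_eqI)
      fix i show "coeff (fibre_poly (X t) R) i = coeff 0 i"
        using elim(2) by (cases "i \<le> degree R") (auto simp: coeff_eq_0)
    qed
    hence "fibre_poly (X t) G dvd smult (eval2 (lead_coeff G) (X t) ^ k) (fibre_poly (X t) H)"
      using eqt[of t] by simp
    thus ?case using elim(1) by (simp add: dvd_smult_iff)
  qed
qed

text \<open>
  Moves a relation into \<open>K[t][T]\<close>, where its degree in \<open>t\<close> makes sense and Gauss's lemma applies.
\<close>

lemma clear_denominators: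
  fixes X :: "'a::{field_char_0,field_gcd} \<Rightarrow> 'a \<times> 'a"
  assumes "rat_map X"
  shows "\<exists>D e. e \<noteq> 0 \<and> (\<forall>\<^sub>\<infinity>t. specialize t D = smult (poly e t) (fibre_poly (X t) G))"
proof (induction G)
  case 0
  show ?case by (rule exI[of _ 0], rule exI[of _ 1]) (simp add: fibre_poly_def specialize_def)
next
  case (pCons c G)
  then obtain D e where 1: "e \<noteq> 0" "\<forall>\<^sub>\<infinity>t. specialize t D = smult (poly e t) (fibre_poly (X t) G)" by blast
  obtain p q where 2: "q \<noteq> 0" "\<forall>\<^sub>\<infinity>t. eval2 c (X t) = poly p t / poly q t"
    using rat_map_eval2[OF assms, of c] by (auto simp: rat_germ_def)
  have "\<forall>\<^sub>\<infinity>t. specialize t (pCons (e * p) (smult q D)) = smult (poly (q * e) t) (fibre_poly (X t) (pCons c G))"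
    using 1(2) 2(2) MOST_poly_nonzero[OF 2(1)] by eventually_elim simp
  thus ?case using 1(1) 2(1)
    by (intro exI[of _ "pCons (e * p) (smult q D)"] exI[of _ "q * e"]) simp
qed

text \<open>
  Divisibility of almost all specialisations makes the remainder of a pseudo-division vanish; by
  Gauss's lemma the constant that the pseudo-division introduces can be removed.
\<close>

lemma primitive_dvd_of_specialize:
  fixes D F :: "'a::{field_char_0,field_gcd} poly poly"
  assumes "content D = 1" "\<forall>\<^sub>\<infinity>t. specialize t D dvd specialize t F"
  shows "D dvd F"
proof -
  have D0: "D \<noteq> 0" using assms(1) by auto
  obtain a Q where a: "a \<noteq> 0" "smult a F = D * Q + pseudo_mod F D"
    using pseudo_mod(1)[OF D0, of F] by blast
  define R where "R = pseudo_mod F D"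
  have "R = 0"
  proof (rule ccontr)
    assume R0: "R \<noteq> 0"
    hence deg: "degree R < degree D" using pseudo_mod(2)[OF D0, of F] by (simp add: R_def)
    have "\<forall>\<^sub>\<infinity>t::'a. False"
      using assms(2) MOST_poly_nonzero[OF leading_coeff_neq_0[OF D0]]
        MOST_poly_nonzero[OF leading_coeff_neq_0[OF R0]]
    proof eventually_elim
      case (elim t)
      have "specialize t R = smult (poly a t) (specialize t F) - specialize t D * specialize t Q"
        using arg_cong[OF a(2), of "specialize t"] by (simp add: R_def)
      hence "specialize t D dvd specialize t R" using elim(1) by (simp add: dvd_smult)
      moreover have "specialize t R \<noteq> 0" using elim(3) by (metis coeff_0 coeff_specialize)
      ultimately have "degree (specialize t D) \<le> degree (specialize t R)" by (rule dvd_imp_degree_le)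
      moreover have "degree D \<le> degree (specialize t D)" using elim(2) by (intro le_degree) simp
      ultimately show ?case using degree_specialize_le[of t R] deg by simp
    qed
    thus False using MOST_ex by blast
  qed
  hence "D dvd smult a F" using a(2) by (simp add: R_def)
  thus ?thesis by (rule primitive_dvd_smultD[OF assms(1) a(1)])
qed

text \<open>
  Lueroth's theorem, with \<open>X = Y \<circ> s\<close> and \<open>s = u / v\<close> an element of \<open>K(X\<^sub>1, X\<^sub>2)\<close>.

  Let \<open>\<Phi>\<close> be the minimal polynomial of \<open>t\<close> over \<open>K(X\<^sub>1, X\<^sub>2)\<close> and \<open>n\<close> its degree. For general \<open>t\<close> the
  roots of \<open>\<Phi>\<^sub>t\<close> are the \<open>n\<close> points of the fibre of \<open>X\<close> through \<open>t\<close>. A primitive multiple \<open>D\<^sub>0(t, T)\<close>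
  of \<open>\<Phi>\<close> divides \<open>p(t) q(T) - q(t) p(T)\<close>, where \<open>p / q\<close> is a non-constant component of \<open>X\<close>. So for
  general \<open>T\<close> the roots of \<open>D\<^sub>0(-, T)\<close> are simple and lie in a fibre, and the degree of \<open>D\<^sub>0\<close> in \<open>t\<close> is
  at most \<open>n\<close> as well. A non-constant quotient \<open>s\<close> of two coefficients of \<open>D\<^sub>0\<close> is constant on the
  fibres of \<open>X\<close> and has degree at most \<open>n\<close>. Finally, reducing numerator and denominator of a component
  of \<open>X\<close> modulo \<open>g(T) - S h(T)\<close>, where \<open>s = g / h\<close>, leaves remainders of degree below \<open>n\<close> whose
  ratio is the value of that component at \<open>n\<close> points; so the remainders are proportional and the
  component is a function of \<open>s\<close>.

  The components are indexed by \<open>bool\<close> so that either of them can be the non-constant one.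
\<close>

lemma lueroth_normal_form:
  fixes p q :: "bool \<Rightarrow> 'a::{alg_closed_field,field_char_0,field_gcd} poly"
  defines "Z \<equiv> \<lambda>j t. poly (p j) t / poly (q j) t"
  defines "X \<equiv> \<lambda>t. (Z True t, Z False t)"
  assumes cop: "\<And>j. coprime (p j) (q j)" and q0: "\<And>j. q j \<noteq> 0" and nc: "nonconst (Z b)"
  shows "\<exists>Y s u v. rat_map Y \<and> nonconst s \<and> (\<forall>\<^sub>\<infinity>t. X t = Y (s t)) \<and>
    (\<forall>\<^sub>\<infinity>t. eval2 v (X t) \<noteq> 0 \<and> eval2 u (X t) / eval2 v (X t) = s t)"
proof -
  define w :: "bool \<Rightarrow> 'a poly poly" where "w j = (if j then [:[:0, 1:]:] else [:0, 1:])" for j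
  have ev_w: "eval2 (w j) (X t) = Z j t" for j t by (simp add: w_def X_def)
  have X_eqI: "X t = X T" if "\<And>j. Z j t = Z j T" for t T using that by (simp add: X_def)
  have Z_eq: "Z j t = Z j T" if "X t = X T" for j t T using that by (cases j) (auto simp: X_def)
  have rat_Z: "rat_germ (Z j)" for j unfolding Z_def by (intro rat_germ_intros)
  have rat: "rat_map X" unfolding rat_map_def by (simp add: X_def rat_Z)
  have q_MOST: "\<forall>\<^sub>\<infinity>t. \<forall>j. poly (q j) t \<noteq> 0"
  proof -
    have "\<forall>\<^sub>\<infinity>t. poly (q True) t \<noteq> 0" "\<forall>\<^sub>\<infinity>t. poly (q False) t \<noteq> 0"
      by (intro MOST_poly_nonzero q0)+
    thus ?thesis by eventually_elim (metis (full_types))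
  qed

  \<comment> \<open>The relation \<open>X\<^sub>j q\<^sub>j(T) - p\<^sub>j(T)\<close> that \<open>t\<close> satisfies for each component.\<close>
  define \<Psi> where "\<Psi> j = smult (w j) (map_poly (\<lambda>c. [:[:c:]:]) (q j)) - map_poly (\<lambda>c. [:[:c:]:]) (p j)"
    for j
  have fibre_poly_\<Psi>: "fibre_poly (X t) (\<Psi> j) = smult (Z j t) (q j) - p j" for j t by (simp add: \<Psi>_def ev_w)
  have root_\<Psi>: "\<forall>\<^sub>\<infinity>t. poly (fibre_poly (X t) (\<Psi> j)) t = 0" for j
    using q_MOST by eventually_elim (simp add: fibre_poly_\<Psi>, simp add: Z_def)

  have "\<exists>G. relation_at X G"
  proof -
    have "\<exists>i. \<not> (\<forall>\<^sub>\<infinity>t. eval2 (coeff (\<Psi> b) i) (X t) = 0)"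
    proof (intro exI notI)
      define i where "i = degree (q b)"
      have qi: "coeff (q b) i \<noteq> 0" using q0 by (simp add: i_def)
      assume "\<forall>\<^sub>\<infinity>t. eval2 (coeff (\<Psi> b) i) (X t) = 0"
      hence "\<forall>\<^sub>\<infinity>t. Z b t = coeff (p b) i / coeff (q b) i"
      proof eventually_elim
        case (elim t)
        hence "coeff (fibre_poly (X t) (\<Psi> b)) i = 0" by simp
        thus ?case using qi unfolding fibre_poly_\<Psi> by (simp add: field_simps)
      qed
      thus False using nc unfolding nonconst_def by blast
    qed
    then obtain i where "\<not> (\<forall>\<^sub>\<infinity>t. eval2 (coeff (\<Psi> b) i) (X t) = 0)" ..
    from drop_vanishing_leading_terms[OF rat this] obtain G' where
      "\<forall>\<^sub>\<infinity>t. eval2 (lead_coeff G') (X t) \<noteq> 0" and G': "\<forall>\<^sub>\<infinity>t. fibre_poly (X t) G' = fibre_poly (X t) (\<Psi> b)"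
      by blast
    moreover have "\<forall>\<^sub>\<infinity>t. poly (fibre_poly (X t) G') t = 0"
      using G' root_\<Psi>[of b] by eventually_elim simp
    ultimately show ?thesis by (auto simp: relation_at_def)
  qed
  then obtain G0 where G0: "relation_at X G0" ..
  define G where "G = (ARG_MIN degree G. relation_at X G)"
  have G: "relation_at X G" and G_min: "\<And>G'. relation_at X G' \<Longrightarrow> degree G \<le> degree G'"
    unfolding G_def using arg_min_nat_lemma[of "relation_at X" G0 degree, OF G0] by auto
  define n where "n = degree G"
  define \<Phi> where "\<Phi> t = fibre_poly (X t) G" for t
  have lc: "\<forall>\<^sub>\<infinity>t. eval2 (lead_coeff G) (X t) \<noteq> 0" and root: "\<forall>\<^sub>\<infinity>t. poly (\<Phi> t) t = 0"
    using G by (simp_all add: relation_at_def \<Phi>_def)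
  have deg_\<Phi>_le: "degree (\<Phi> t) \<le> n" for t
    unfolding \<Phi>_def n_def by (rule degree_le) (simp add: coeff_eq_0)
  have deg_\<Phi>: "degree (\<Phi> t) = n" if "eval2 (lead_coeff G) (X t) \<noteq> 0" for t
    using that by (intro antisym deg_\<Phi>_le le_degree) (simp add: \<Phi>_def n_def)
  have dvd: "\<forall>\<^sub>\<infinity>t. \<forall>j. \<Phi> t dvd smult (Z j t) (q j) - p j"
  proof -
    have "\<forall>\<^sub>\<infinity>t. \<Phi> t dvd smult (Z j t) (q j) - p j" for j
      using minimal_relation_dvd[OF rat G G_min root_\<Psi>[of j]] by (simp add: fibre_poly_\<Psi> \<Phi>_def)
    from this[of True] this[of False] show ?thesis by eventually_elim (metis (full_types))
  qed
  have rsq: "\<forall>\<^sub>\<infinity>t. rsquarefree (smult (Z b t) (q b) - p b)"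
    using MOST_fibre_rsquarefree[OF cop[of b]] nc by (simp add: Z_def)

  obtain D e where e: "e \<noteq> 0" "\<forall>\<^sub>\<infinity>t. specialize t D = smult (poly e t) (\<Phi> t)"
    using clear_denominators[OF rat, of G] by (auto simp: \<Phi>_def)
  define D0 where "D0 = primitive_part D"
  have D: "D = smult (content D) D0" by (simp add: D0_def)
  have "D \<noteq> 0"
  proof
    assume "D = 0"
    have "\<forall>\<^sub>\<infinity>t::'a. False"
      using e(2) lc MOST_poly_nonzero[OF e(1)]
    proof eventually_elim
      case (elim t)
      hence "\<Phi> t = 0" by (simp add: specialize_def \<open>D = 0\<close>)
      hence "coeff (\<Phi> t) (degree G) = 0" by simp
      thus ?case using elim by (simp add: \<Phi>_def)
    qed
    thus False using MOST_ex by blast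
  qed
  hence cD: "content D \<noteq> 0" and prim: "content D0 = 1" by (simp_all add: D0_def)
  have prop_\<Phi>: "\<forall>\<^sub>\<infinity>t. \<exists>\<kappa>. \<kappa> \<noteq> 0 \<and> specialize t D0 = smult \<kappa> (\<Phi> t)"
    using e(2) MOST_poly_nonzero[OF e(1)] MOST_poly_nonzero[OF cD]
  proof eventually_elim
    case (elim t)
    have "smult (poly (content D) t) (specialize t D0) = smult (poly e t) (\<Phi> t)"
      using arg_cong[OF D, of "specialize t"] elim(1) by simp
    hence "specialize t D0 = smult (poly e t / poly (content D) t) (\<Phi> t)"
      using elim(3) by (metis divide_inverse_commute right_inverse smult_1_left smult_smult mult.commute)
    thus ?case using elim by (intro exI[of _ "poly e t / poly (content D) t"]) simp
  qed

  \<comment> \<open>A point is good if none of the exceptional events occurs there. In the sequel \<open>t\<close> is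
    general enough for its whole fibre to be good.\<close>
  define good where "good t \<longleftrightarrow> (\<forall>j. poly (q j) t \<noteq> 0) \<and> poly (\<Phi> t) t = 0 \<and>
    eval2 (lead_coeff G) (X t) \<noteq> 0 \<and> (\<forall>j. \<Phi> t dvd smult (Z j t) (q j) - p j) \<and>
    rsquarefree (smult (Z b t) (q b) - p b) \<and>
    (\<exists>\<kappa>. \<kappa> \<noteq> 0 \<and> specialize t D0 = smult \<kappa> (\<Phi> t))" for t
  have good0: "\<forall>\<^sub>\<infinity>t. good t"
    using q_MOST root lc dvd rsq prop_\<Phi> unfolding good_def by eventually_elim blast
  have good: "\<forall>\<^sub>\<infinity>t. good t \<and> (\<forall>T. Z b T = Z b t \<longrightarrow> good T)"
  proof -
    have "finite (Z b ` {t. \<not> good t})" using good0 by (simp add: eventually_cofinite)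
    from nonconst_notin[OF nc this] good0 show ?thesis
      by eventually_elim (metis (mono_tags, lifting) image_eqI mem_Collect_eq)
  qed
  have fibre: "X T = X t \<and> (\<forall>j. poly (q j) T \<noteq> 0)" if "good t" "poly (\<Phi> t) T = 0" for t T
  proof -
    have *: "poly (q j) T \<noteq> 0 \<and> Z j T = Z j t" for j
    proof -
      have "poly (smult (Z j t) (q j) - p j) T = 0"
        using that unfolding good_def by (metis dvdE mult_zero_left poly_mult)
      hence pq: "poly (p j) T = Z j t * poly (q j) T" by simp
      hence "poly (q j) T \<noteq> 0" using coprime_no_common_root[OF cop[of j], of T] by auto
      thus ?thesis using pq by (simp add: Z_def)
    qed
    thus ?thesis using X_eqI by blast
  qed
  have card_fibre: "card {T. poly (\<Phi> t) T = 0} = n" if "good t" for t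
  proof -
    have "rsquarefree (\<Phi> t)" using that rsquarefree_dvd unfolding good_def by blast
    from card_roots_rsquarefree[OF this] show ?thesis using that by (simp add: deg_\<Phi> good_def)
  qed
  have finite_fibre: "finite {T. poly (\<Phi> t) T = 0}" if "good t" for t
  proof (rule poly_roots_finite)
    show "\<Phi> t \<noteq> 0" using that rsquarefree_dvd unfolding good_def rsquarefree_def by blast
  qed

  \<comment> \<open>A coefficient of \<open>D\<^sub>0\<close> has degree \<open>k\<close> in \<open>t\<close>, so \<open>D\<^sub>0(-, T\<^sub>0)\<close> has degree at least \<open>k\<close> for general \<open>T\<^sub>0\<close>.\<close>
  have deg_D0: "degree (coeff D0 i) \<le> n" for i
  proof (cases "coeff D0 i = 0")
    case False
    define k where "k = degree (coeff D0 i)"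
    define A where "A = map_poly (\<lambda>c. coeff c k) D0"
    have "coeff A i \<noteq> 0" using False by (simp add: A_def coeff_map_poly k_def)
    hence "A \<noteq> 0" by auto
    have coeff_A: "coeff (poly D0 [:T:]) k = poly A T" for T
      unfolding A_def by (induction D0) (simp_all add: map_poly_pCons)
    define F where "F = smult (p b) (lift_poly (q b)) - smult (q b) (lift_poly (p b))"
    have "D0 dvd F"
    proof (rule primitive_dvd_of_specialize[OF prim])
      show "\<forall>\<^sub>\<infinity>t. specialize t D0 dvd specialize t F" using good0
      proof eventually_elim
        case (elim t)
        have "specialize t F = smult (poly (q b) t) (smult (Z b t) (q b) - p b)"
          using elim by (simp add: F_def Z_def good_def smult_diff_right)
        moreover obtain \<kappa> where "\<kappa> \<noteq> 0" "specialize t D0 = smult \<kappa> (\<Phi> t)" using elim by (auto simp: good_def)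
        moreover have "\<Phi> t dvd smult (Z b t) (q b) - p b" using elim by (auto simp: good_def)
        ultimately show ?case by (simp add: smult_dvd_iff dvd_smult)
      qed
    qed
    then obtain H where H: "F = D0 * H" by (elim dvdE)
    have "\<forall>\<^sub>\<infinity>T0. poly A T0 \<noteq> 0 \<and> good T0 \<and> (\<forall>T. Z b T = Z b T0 \<longrightarrow> good T)"
      using MOST_poly_nonzero[OF \<open>A \<noteq> 0\<close>] good by eventually_elim blast
    from MOST_ex[OF this] obtain T0 where T0: "poly A T0 \<noteq> 0" "good T0" "\<And>T. Z b T = Z b T0 \<Longrightarrow> good T" by blast
    have qT0: "poly (q j) T0 \<noteq> 0" for j using T0(2) by (simp add: good_def)
    define d where "d = poly D0 [:T0:]"
    have F_T0: "poly F [:T0:] = smult (- poly (q b) T0) (smult (Z b T0) (q b) - p b)"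
      using qT0[of b] by (simp add: F_def poly_lift_poly Z_def smult_diff_right)
    have "d dvd poly F [:T0:]" by (simp add: H d_def)
    hence "d dvd smult (Z b T0) (q b) - p b" using qT0[of b] by (simp add: F_T0 dvd_smult_iff)
    then obtain k' where k': "smult (Z b T0) (q b) - p b = d * k'" by (elim dvdE)
    have "rsquarefree (smult (Z b T0) (q b) - p b)" using T0(2) unfolding good_def by blast
    hence rsq_d: "rsquarefree d" by (rule rsquarefree_dvd) (simp only: k' dvd_triv_left)
    have d_dvd: "poly (smult (Z b T0) (q b) - p b) t = 0" if "poly d t = 0" for t
      unfolding k' using that by simp
    have "{t. poly d t = 0} \<subseteq> {T. poly (\<Phi> T0) T = 0}"
    proof safe
      fix t assume t: "poly d t = 0"
      hence pq: "poly (p b) t = Z b T0 * poly (q b) t" using d_dvd[OF t] by simp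
      hence "poly (q b) t \<noteq> 0" using coprime_no_common_root[OF cop[of b], of t] by auto
      hence "good t" using pq by (intro T0(3)) (simp add: Z_def)
      moreover have "poly (specialize t D0) T0 = 0" using t by (simp add: d_def poly_specialize eval2_conv_poly)
      hence "poly (\<Phi> t) T0 = 0" using \<open>good t\<close> by (auto simp: good_def)
      ultimately have "X T0 = X t" using fibre by blast
      thus "poly (\<Phi> T0) t = 0" using \<open>good t\<close> by (simp add: \<Phi>_def good_def)
    qed
    hence "card {t. poly d t = 0} \<le> n"
      using card_mono[OF finite_fibre[OF T0(2)]] card_fibre[OF T0(2)] by simp
    moreover have "k \<le> degree d" using T0(1) by (intro le_degree) (simp add: d_def coeff_A)
    ultimately show ?thesis using card_roots_rsquarefree[OF rsq_d] by (simp add: k_def)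
  qed simp

  define h where "h = coeff D0 n"
  have h_eq: "poly h t \<noteq> 0 \<and>
      poly (coeff D0 i) t / poly h t = eval2 (coeff G i) (X t) / eval2 (lead_coeff G) (X t)"
    if t: "good t" for i t
  proof -
    obtain \<kappa> where \<kappa>: "\<kappa> \<noteq> 0" "specialize t D0 = smult \<kappa> (\<Phi> t)"
      using t unfolding good_def by blast
    have "poly (coeff D0 i) t = \<kappa> * eval2 (coeff G i) (X t)" for i
      using arg_cong[OF \<kappa>(2), of "\<lambda>p. coeff p i"] by (simp add: \<Phi>_def)
    thus ?thesis using \<kappa>(1) that by (simp add: h_def n_def good_def)
  qed
  \<comment> \<open>With constant quotients only, \<open>t\<close> would be algebraic over \<open>K\<close>.\<close>
  have "\<exists>i. nonconst (\<lambda>t. poly (coeff D0 i) t / poly h t)"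
  proof (rule ccontr)
    assume "\<nexists>i. nonconst (\<lambda>t. poly (coeff D0 i) t / poly h t)"
    moreover have "rat_germ (\<lambda>t. poly (coeff D0 i) t / poly h t)" for i by (intro rat_germ_intros)
    ultimately obtain c where c: "\<And>i. \<forall>\<^sub>\<infinity>t. poly (coeff D0 i) t / poly h t = c i"
      unfolding nonconst_def by metis
    define f where "f = (\<Sum>i\<le>n. monom (c i) i)"
    have "\<forall>\<^sub>\<infinity>t. \<forall>i\<in>{..n}. poly (coeff D0 i) t / poly h t = c i"
      using c by (intro eventually_ball_finite) auto
    hence f: "\<forall>\<^sub>\<infinity>t. \<Phi> t = smult (eval2 (lead_coeff G) (X t)) f" using good0
    proof eventually_elim
      case (elim t)
      show ?case
      proof (rule poly_eqI)
        fix i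
        have "coeff f i = (if i \<le> n then c i else 0)" by (simp add: f_def coeff_sum)
        thus "coeff (\<Phi> t) i = coeff (smult (eval2 (lead_coeff G) (X t)) f) i"
          using elim h_eq[OF elim(2), of i] by (auto simp: \<Phi>_def n_def coeff_eq_0 good_def)
      qed
    qed
    hence "\<forall>\<^sub>\<infinity>t. poly f t = 0" using root lc by eventually_elim simp
    hence "f = 0" by (rule MOST_poly_zero)
    have "\<forall>\<^sub>\<infinity>t::'a. False"
      using f good0
    proof eventually_elim
      case (elim t)
      hence "coeff (\<Phi> t) (degree G) = 0" by (simp add: \<open>f = 0\<close>)
      thus ?case using elim by (simp add: \<Phi>_def good_def)
    qed
    thus False using MOST_ex by blast
  qed
  then obtain i0 where i0: "nonconst (\<lambda>t. poly (coeff D0 i0) t / poly h t)" ..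
  define g where "g = coeff D0 i0"
  define s where "s = (\<lambda>t. poly g t / poly h t)"
  have nc_s: "nonconst s" using i0 by (simp add: s_def g_def)
  define E where "E = lift_poly g - smult [:0, 1:] (lift_poly h)"
  have specialize_E: "specialize S E = g - smult S h" for S by (simp add: E_def)
  have E0: "E \<noteq> 0"
  proof
    assume "E = 0"
    hence "specialize S E = 0" for S by (simp add: specialize_def)
    hence "g - smult 0 h = 0" "g - smult 1 h = 0" by (simp_all only: specialize_E)
    hence "h = 0" by simp
    hence "\<forall>\<^sub>\<infinity>t. s t = 0" by (simp add: s_def)
    thus False using nc_s unfolding nonconst_def by blast
  qed
  have deg_E: "degree E \<le> n"
  proof (rule degree_le, intro allI impI)
    fix i assume "n < i"
    hence "coeff g i = 0" "coeff h i = 0"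
      using deg_D0[of i0] deg_D0[of n] by (simp_all add: g_def h_def coeff_eq_0)
    thus "coeff E i = 0" by (simp add: E_def)
  qed

  \<comment> \<open>Here \<open>S\<close>, the inner variable of \<open>E = g(T) - S h(T)\<close>, stands for the value of \<open>s\<close>.\<close>
  have "\<exists>y. rat_germ y \<and> (\<forall>\<^sub>\<infinity>t. Z j t = y (s t))" for j
  proof -
    obtain c1 Q1 where 1: "c1 \<noteq> 0" "smult c1 (lift_poly (p j)) = E * Q1 + pseudo_mod (lift_poly (p j)) E"
      using pseudo_mod(1)[OF E0] by blast
    obtain c2 Q2 where 2: "c2 \<noteq> 0" "smult c2 (lift_poly (q j)) = E * Q2 + pseudo_mod (lift_poly (q j)) E"
      using pseudo_mod(1)[OF E0] by blast
    define r where "r = smult c2 (pseudo_mod (lift_poly (p j)) E)"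
    define r' where "r' = smult c1 (pseudo_mod (lift_poly (q j)) E)"
    define c where "c = c1 * c2"
    have c0: "c \<noteq> 0" using 1 2 by (simp add: c_def)
    have r: "smult c (lift_poly (p j)) = E * smult c2 Q1 + r"
      using arg_cong[OF 1(2), of "smult c2"] by (simp add: c_def r_def mult.commute smult_add_right)
    have r': "smult c (lift_poly (q j)) = E * smult c1 Q2 + r'"
      using arg_cong[OF 2(2), of "smult c1"] by (simp add: c_def r'_def smult_add_right)
    have small: "coeff (pseudo_mod f E) i = 0" if "n \<le> i" for f i
      using pseudo_mod(2)[OF E0, of f] deg_E that by (auto intro: coeff_eq_0)
    have small_r: "coeff r i = 0" "coeff r' i = 0" if "n \<le> i" for i
      using small[OF that] by (simp_all add: r_def r'_def)
    have key: "\<forall>\<^sub>\<infinity>t. specialize (s t) r = smult (Z j t) (specialize (s t) r') \<and>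
        poly (c) (s t) * poly (q j) t = poly (specialize (s t) r') t"
      using good
    proof eventually_elim
      case (elim t)
      define f where "f = specialize (s t) r - smult (Z j t) (specialize (s t) r')"
      have T: "poly (c) (s t) * poly (p j) T = poly (specialize (s t) r) T \<and>
          poly (c) (s t) * poly (q j) T = poly (specialize (s t) r') T \<and> poly (p j) T = Z j t * poly (q j) T"
        if T: "poly (\<Phi> t) T = 0" for T
      proof -
        have XT: "X T = X t" "poly (q j) T \<noteq> 0" using fibre[OF _ T] elim by auto
        hence "good T" using elim Z_eq by blast
        hence "s T = s t" using h_eq[of T i0] h_eq[of t i0] elim XT by (simp add: s_def g_def)
        hence "poly g T = s t * poly h T" using h_eq[OF \<open>good T\<close>, of 0] by (auto simp: s_def field_simps)
        hence E_T: "poly (specialize (s t) E) T = 0" by (simp add: specialize_E)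
        have "poly (p j) T = Z j t * poly (q j) T"
          unfolding Z_eq[OF XT(1), of j, symmetric] using XT(2) by (simp add: Z_def)
        thus ?thesis
          using arg_cong[OF r, of "\<lambda>f. poly (specialize (s t) f) T"]
            arg_cong[OF r', of "\<lambda>f. poly (specialize (s t) f) T"] E_T by simp
      qed
      have "f = 0"
      proof (rule ccontr)
        assume "f \<noteq> 0"
        have "coeff f i = 0" if "n \<le> i" for i using small_r[OF that] by (simp add: f_def)
        hence "degree f < n" using leading_coeff_neq_0[OF \<open>f \<noteq> 0\<close>] not_le by blast
        moreover have "{T. poly (\<Phi> t) T = 0} \<subseteq> {T. poly f T = 0}"
        proof safe
          fix x assume "poly (\<Phi> t) x = 0"
          from T[OF this] show "poly f x = 0" by (simp add: f_def) (metis mult.left_commute)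
        qed
        hence "n \<le> card {T. poly f T = 0}"
          using card_mono[OF poly_roots_finite[OF \<open>f \<noteq> 0\<close>]] card_fibre elim by metis
        ultimately show False using card_poly_roots_bound[OF \<open>f \<noteq> 0\<close>] by simp
      qed
      moreover have "poly (\<Phi> t) t = 0" using elim by (simp add: good_def)
      ultimately show ?case using T[of t] by (simp add: f_def)
    qed
    have "r' \<noteq> 0"
    proof
      assume "r' = 0"
      have "\<forall>\<^sub>\<infinity>t::'a. False"
        using key q_MOST nonconst_MOST[OF nc_s MOST_poly_nonzero[OF c0]]
        by eventually_elim (simp add: specialize_def \<open>r' = 0\<close>)
      thus False using MOST_ex by blast
    qed
    then obtain i where i: "coeff r' i \<noteq> 0" by (metis leading_coeff_neq_0)
    have "\<forall>\<^sub>\<infinity>t. Z j t = poly (coeff r i) (s t) / poly (coeff r' i) (s t)"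
      using key nonconst_MOST[OF nc_s MOST_poly_nonzero[OF i]]
    proof eventually_elim
      case (elim t)
      hence "coeff (specialize (s t) r) i = coeff (smult (Z j t) (specialize (s t) r')) i" by simp
      thus ?case using elim(2) by (simp add: field_simps)
    qed
    moreover have "rat_germ (\<lambda>S. poly (coeff r i) S / poly (coeff r' i) S)" by (intro rat_germ_intros)
    ultimately show ?thesis by blast
  qed
  then obtain y where y: "\<And>j. rat_germ (y j)" "\<And>j. \<forall>\<^sub>\<infinity>t. Z j t = y j (s t)" by metis
  define Y where "Y S = (y True S, y False S)" for S
  have "rat_map Y" by (simp add: rat_map_def Y_def y)
  moreover have "\<forall>\<^sub>\<infinity>t. X t = Y (s t)"
    using y(2)[of True] y(2)[of False] by eventually_elim (simp add: X_def Y_def)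
  moreover have "\<forall>\<^sub>\<infinity>t. eval2 (lead_coeff G) (X t) \<noteq> 0 \<and>
      eval2 (coeff G i0) (X t) / eval2 (lead_coeff G) (X t) = s t"
    using good0 by eventually_elim (use h_eq in \<open>auto simp: s_def g_def good_def\<close>)
  ultimately show ?thesis using nc_s by blast
qed

section \<open>Proper parametrizations\<close>

text \<open>
  One of the two composites in the definition of a proper parametrization. It implies the other one,
  by \<open>rational_inverse_par\<close>.
\<close>

definition rational_inverse ::
    "'a::field poly poly \<Rightarrow> 'a poly poly \<Rightarrow> ('a \<Rightarrow> 'a \<times> 'a) \<Rightarrow> bool" where
  "rational_inverse u v X \<longleftrightarrow>
     (\<forall>\<^sub>\<infinity>t. eval2 v (X t) \<noteq> 0 \<and> eval2 u (X t) / eval2 v (X t) = t)"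

lemma clear_inverse:
  fixes p :: "'a::field poly"
  shows "\<exists>k f. \<forall>y. eval2 v y \<noteq> 0 \<longrightarrow>
    eval2 v y ^ k * poly p (eval2 u y / eval2 v y) = eval2 f y"
proof (induction p)
  case 0
  show ?case by (rule exI[of _ 0], rule exI[of _ 0]) simp
next
  case (pCons a p)
  then obtain k f where f: "\<And>y. eval2 v y \<noteq> 0 \<Longrightarrow>
    eval2 v y ^ k * poly p (eval2 u y / eval2 v y) = eval2 f y" by blast
  show ?case
  proof (rule exI[of _ "Suc k"], rule exI[of _ "smult [:a:] (v ^ Suc k) + u * f"], intro allI impI)
    fix y assume y: "eval2 v y \<noteq> 0"
    have "eval2 v y ^ Suc k * poly (pCons a p) (eval2 u y / eval2 v y) =
        a * eval2 v y ^ Suc k + eval2 u y * (eval2 v y ^ k * poly p (eval2 u y / eval2 v y))"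
      using y by (simp add: field_simps)
    thus "eval2 v y ^ Suc k * poly (pCons a p) (eval2 u y / eval2 v y) =
        eval2 (smult [:a:] (v ^ Suc k) + u * f) y" using f[OF y] by simp
  qed
qed

text \<open>
  After clearing the powers of \<open>v\<close>, the claim is a polynomial equation that holds along \<open>X\<close>.
\<close>

lemma rational_inverse_on_locus:
  fixes X :: "'a::{field_char_0,field_gcd} \<Rightarrow> 'a \<times> 'a"
  assumes "rational_inverse u v X" "\<forall>\<^sub>\<infinity>t. eval2 w (X t) = rf_eval r t"
    "y \<in> locus X" "eval2 v y \<noteq> 0" "rf_defined r (eval2 u y / eval2 v y)"
  shows "rf_eval r (eval2 u y / eval2 v y) = eval2 w y"
proof -
  obtain a b where r: "quot_of_fract r = (a, b)" by force
  have ev: "rf_eval r t = poly a t / poly b t" for t by (simp add: rf_eval_def r)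
  obtain k f where f: "\<And>y. eval2 v y \<noteq> 0 \<Longrightarrow>
    eval2 v y ^ k * poly a (eval2 u y / eval2 v y) = eval2 f y" using clear_inverse by blast
  obtain l g where g: "\<And>y. eval2 v y \<noteq> 0 \<Longrightarrow>
    eval2 v y ^ l * poly b (eval2 u y / eval2 v y) = eval2 g y" using clear_inverse by blast
  define F where "F = v ^ l * f - w * v ^ k * g"
  have F: "eval2 F y = eval2 v y ^ (k + l) *
      (poly a (eval2 u y / eval2 v y) - eval2 w y * poly b (eval2 u y / eval2 v y))"
    if "eval2 v y \<noteq> 0" for y
    unfolding F_def using f[OF that] g[OF that]
    by (simp flip: f[OF that] g[OF that] add: algebra_simps power_add)
  have "\<forall>\<^sub>\<infinity>t. poly b t \<noteq> 0"
    using snd_quot_of_fract_nonzero[of r] by (intro MOST_poly_nonzero) (simp add: r)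
  hence "\<forall>\<^sub>\<infinity>t. eval2 F (X t) = 0"
    using assms(1)[unfolded rational_inverse_def] assms(2)
    by eventually_elim (simp add: F ev)
  hence "eval2 F y = 0" by (rule locusD[OF assms(3)])
  hence "poly a (eval2 u y / eval2 v y) = eval2 w y * poly b (eval2 u y / eval2 v y)"
    using F[OF assms(4)] assms(4) by simp
  thus ?thesis using assms(5) by (simp add: ev rf_defined_def r)
qed

lemma rational_inverse_par:
  fixes P :: "'a::{field_char_0,field_gcd} poly fract \<times> 'a poly fract"
  assumes "rational_inverse u v (par_eval P)" "y \<in> locus (par_eval P)" "eval2 v y \<noteq> 0"
    "par_defined P (eval2 u y / eval2 v y)"
  shows "par_eval P (eval2 u y / eval2 v y) = y"
proof -
  have "rf_eval (fst P) (eval2 u y / eval2 v y) = eval2 [:[:0, 1:]:] y"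
    by (rule rational_inverse_on_locus[OF assms(1) _ assms(2,3)])
      (use assms(4) in \<open>auto simp: par_defined_def par_eval_def\<close>)
  moreover have "rf_eval (snd P) (eval2 u y / eval2 v y) = eval2 [:0, 1:] y"
    by (rule rational_inverse_on_locus[OF assms(1) _ assms(2,3)])
      (use assms(4) in \<open>auto simp: par_defined_def par_eval_def\<close>)
  ultimately show ?thesis by (simp add: par_eval_def prod_eq_iff)
qed

lemma par_eval_in_locus:
  fixes P :: "'a::{field_char_0,field_gcd} poly fract \<times> 'a poly fract"
  shows "par_defined P t \<Longrightarrow> par_eval P t \<in> locus (par_eval P)"
  by (intro locusI par_eval_vanishing)

lemma proper_parametrization_iff:
  fixes P :: "'a::{field_char_0,field_gcd} poly fract \<times> 'a poly fract"
  shows "proper_parametrization P C \<longleftrightarrow>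
    parametrization P C \<and> (\<exists>u v. rational_inverse u v (par_eval P))"
proof (intro iffI conjI)
  assume *: "proper_parametrization P C"
  thus "parametrization P C" by (simp add: proper_parametrization_def)
  from * obtain u v where uv: "\<exists>t. par_defined P t \<and> eval2 v (par_eval P t) \<noteq> 0"
    "\<And>t. par_defined P t \<Longrightarrow> eval2 v (par_eval P t) \<noteq> 0 \<Longrightarrow>
        eval2 u (par_eval P t) / eval2 v (par_eval P t) = t"
    unfolding proper_parametrization_def birational_par_def by blast
  have "\<not> (\<forall>\<^sub>\<infinity>t. eval2 v (par_eval P t) = 0)" using uv(1) par_eval_vanishing by blast
  hence "\<forall>\<^sub>\<infinity>t. eval2 v (par_eval P t) \<noteq> 0" using rat_map_vanishing[OF rat_map_par_eval] by blast
  with par_defined_MOST[of P] have "rational_inverse u v (par_eval P)"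
    unfolding rational_inverse_def by eventually_elim (use uv(2) in blast)
  thus "\<exists>u v. rational_inverse u v (par_eval P)" by blast
next
  assume "parametrization P C \<and> (\<exists>u v. rational_inverse u v (par_eval P))"
  then obtain u v where par: "parametrization P C" and uv: "rational_inverse u v (par_eval P)" by blast
  have C: "C = locus (par_eval P)" using par by (simp add: parametrization_iff)
  have 2: "eval2 u (par_eval P t) / eval2 v (par_eval P t) = t"
    if t: "par_defined P t" "eval2 v (par_eval P t) \<noteq> 0" for t
  proof -
    obtain p q where pq: "\<And>t. par_defined P t \<Longrightarrow> poly q t \<noteq> 0"
      "\<And>t. par_defined P t \<Longrightarrow> eval2 u (par_eval P t) = poly p t / poly q t"
      by (rule par_eval_regular[of P u]) blast
    obtain p' q' where pq': "\<And>t. par_defined P t \<Longrightarrow> poly q' t \<noteq> 0"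
      "\<And>t. par_defined P t \<Longrightarrow> eval2 v (par_eval P t) = poly p' t / poly q' t"
      by (rule par_eval_regular[of P v]) blast
    have "\<forall>\<^sub>\<infinity>t. poly (p * q' - [:0, 1:] * p' * q) t = 0"
      using uv[unfolded rational_inverse_def] par_defined_MOST[of P]
    proof eventually_elim
      case (elim t)
      hence "eval2 u (par_eval P t) = t * eval2 v (par_eval P t)" by (metis nonzero_divide_eq_eq)
      thus ?case using pq[OF elim(2)] pq'[OF elim(2)] by (simp add: field_simps)
    qed
    hence "p * q' - [:0, 1:] * p' * q = 0" by (rule MOST_poly_zero)
    hence "poly (p * q' - [:0, 1:] * p' * q) t = 0" by simp
    hence "poly p t * poly q' t = t * poly p' t * poly q t" by simp
    hence "eval2 u (par_eval P t) = t * eval2 v (par_eval P t)"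
      unfolding pq(2)[OF t(1)] pq'(2)[OF t(1)] using pq(1)[OF t(1)] pq'(1)[OF t(1)]
      by (simp add: frac_eq_eq)
    thus ?thesis using t(2) by simp
  qed
  have "\<forall>\<^sub>\<infinity>t. par_defined P t \<and> eval2 v (par_eval P t) \<noteq> 0"
    using par_defined_MOST[of P] uv[unfolded rational_inverse_def] by eventually_elim blast
  from MOST_ex[OF this] obtain t0 where t0: "par_defined P t0" "eval2 v (par_eval P t0) \<noteq> 0" by blast
  have "birational_par P C"
    unfolding birational_par_def
  proof (rule exI[of _ u], rule exI[of _ v], intro conjI ballI allI impI)
    show "\<exists>t. par_defined P t \<and> eval2 v (par_eval P t) \<noteq> 0" using t0 by blast
    show "\<exists>y\<in>C. eval2 v y \<noteq> 0 \<and> par_defined P (eval2 u y / eval2 v y)"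
      using t0 2[OF t0] par_eval_in_locus[OF t0(1)] unfolding C by (metis (full_types))
  qed (use 2 rational_inverse_par[OF uv] C in auto)
  thus "proper_parametrization P C" using par by (simp add: proper_parametrization_def)
qed

text \<open>
  The parameter \<open>s\<close> of the normal form is a rational function of \<open>X = Y \<circ> s\<close>, and as \<open>s\<close> is not
  constant, the same formula recovers the argument of \<open>Y\<close>.
\<close>

theorem lueroth_proper:
  fixes X :: "'a::{alg_closed_field,field_char_0,field_gcd} \<Rightarrow> 'a \<times> 'a"
  assumes "nonconst_map X"
  obtains P s where "proper_parametrization P (locus X)" "nonconst s"
    "\<forall>\<^sub>\<infinity>t. X t = par_eval P (s t)"
proof -
  have rat: "rat_germ (\<lambda>t. fst (X t))" "rat_germ (\<lambda>t. snd (X t))"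
    using assms by (simp_all add: nonconst_map_def rat_map_def)
  obtain p1 q1 where 1: "q1 \<noteq> 0" "coprime p1 q1" "\<forall>\<^sub>\<infinity>t. fst (X t) = poly p1 t / poly q1 t"
    by (rule rat_germ_coprime[OF rat(1)])
  obtain p2 q2 where 2: "q2 \<noteq> 0" "coprime p2 q2" "\<forall>\<^sub>\<infinity>t. snd (X t) = poly p2 t / poly q2 t"
    by (rule rat_germ_coprime[OF rat(2)])
  define p where "p b = (if b then p1 else p2)" for b
  define q where "q b = (if b then q1 else q2)" for b
  define X' where "X' t = (poly (p True) t / poly (q True) t, poly (p False) t / poly (q False) t)" for t
  have X': "\<forall>\<^sub>\<infinity>t. X' t = X t"
    using 1(3) 2(3) by eventually_elim (simp add: X'_def p_def q_def prod_eq_iff)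
  have "nonconst_map X'" by (rule nonconst_map_cong[OF assms X'])
  hence "\<exists>b. nonconst (\<lambda>t. poly (p b) t / poly (q b) t)"
    unfolding nonconst_map_iff X'_def by auto
  then obtain b where "nonconst (\<lambda>t. poly (p b) t / poly (q b) t)" ..
  moreover have "coprime (p b) (q b)" "q b \<noteq> 0" for b using 1(1,2) 2(1,2) by (simp_all add: p_def q_def)
  ultimately obtain Y s u v where
    Y: "rat_map Y" "nonconst s" "\<forall>\<^sub>\<infinity>t. X' t = Y (s t)" and
    uv: "\<forall>\<^sub>\<infinity>t. eval2 v (X' t) \<noteq> 0 \<and> eval2 u (X' t) / eval2 v (X' t) = s t"
    using lueroth_normal_form[of p q b] unfolding X'_def by blast
  obtain P where P: "\<forall>\<^sub>\<infinity>t. par_eval P t = Y t" by (rule rat_map_par[OF Y(1)])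
  have XP: "\<forall>\<^sub>\<infinity>t. X t = par_eval P (s t)"
    using X' Y(3) nonconst_MOST[OF Y(2) P] by eventually_elim simp
  have transfer: "(\<forall>\<^sub>\<infinity>t. F t) \<longleftrightarrow> (\<forall>\<^sub>\<infinity>t. F (s t))"
    if "(\<forall>\<^sub>\<infinity>t. F t) \<or> (\<forall>\<^sub>\<infinity>t. \<not> F t)" for F
    using that nonconst_MOST[OF Y(2), of F] nonconst_MOST[OF Y(2), of "\<lambda>t. \<not> F t"]
      MOST_contr[of F] MOST_contr[of "\<lambda>t. F (s t)"] by blast
  have vanish: "(\<forall>\<^sub>\<infinity>t. eval2 g (par_eval P t) = 0) \<longleftrightarrow> (\<forall>\<^sub>\<infinity>t. eval2 g (X t) = 0)" for g
  proof -
    have "(\<forall>\<^sub>\<infinity>t. eval2 g (par_eval P t) = 0) \<longleftrightarrow> (\<forall>\<^sub>\<infinity>t. eval2 g (par_eval P (s t)) = 0)"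
      by (rule transfer[OF rat_map_vanishing[OF rat_map_par_eval]])
    also have "\<dots> \<longleftrightarrow> (\<forall>\<^sub>\<infinity>t. eval2 g (X t) = 0)"
      by (rule MOST_eq_cong[OF XP, symmetric, where P = "\<lambda>z. eval2 g z = 0"])
    finally show ?thesis .
  qed
  have "locus (par_eval P) = locus X" by (simp add: locus_def vanish)
  moreover have "nonconst_map (par_eval P)"
    unfolding nonconst_map_def
  proof (intro conjI rat_map_par_eval allI notI)
    fix c assume "\<forall>\<^sub>\<infinity>t. par_eval P t = c"
    from nonconst_MOST[OF Y(2) this] XP have "\<forall>\<^sub>\<infinity>t. X t = c" by eventually_elim simp
    thus False using assms unfolding nonconst_map_def by blast
  qed
  moreover have "rational_inverse u v (par_eval P)"
  proof -
    have uv': "\<forall>\<^sub>\<infinity>t. eval2 v (par_eval P (s t)) \<noteq> 0 \<and>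
        eval2 u (par_eval P (s t)) / eval2 v (par_eval P (s t)) = s t"
      using uv X' XP by eventually_elim simp
    have "(\<forall>\<^sub>\<infinity>t. eval2 v (par_eval P t) \<noteq> 0) \<or> (\<forall>\<^sub>\<infinity>t. \<not> eval2 v (par_eval P t) \<noteq> 0)"
      using rat_map_vanishing[OF rat_map_par_eval, of v P] by auto
    from transfer[OF this] uv' have "\<forall>\<^sub>\<infinity>t. eval2 v (par_eval P t) \<noteq> 0"
      by (simp add: eventually_conj_iff)
    moreover have "(\<forall>\<^sub>\<infinity>t. eval2 u (par_eval P t) / eval2 v (par_eval P t) = t) \<or>
        (\<forall>\<^sub>\<infinity>t. eval2 u (par_eval P t) / eval2 v (par_eval P t) \<noteq> t)"
      by (intro rat_germ_eq_or_neq rat_germ_divide rat_map_eval2 rat_map_par_eval rat_germ_id)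
    from transfer[OF this] uv' have "\<forall>\<^sub>\<infinity>t. eval2 u (par_eval P t) / eval2 v (par_eval P t) = t"
      by (simp add: eventually_conj_iff)
    ultimately show ?thesis unfolding rational_inverse_def by (rule eventually_conj)
  qed
  ultimately have "proper_parametrization P (locus X)"
    by (auto simp: proper_parametrization_iff parametrization_iff)
  thus ?thesis using Y(2) XP by (rule that)
qed

subsection \<open>Maps into the same curve\<close>

lemma MOST_in_locus:
  fixes X :: "'a::{alg_closed_field,field_char_0,field_gcd} \<Rightarrow> 'a \<times> 'a"
  assumes "nonconst_map X" shows "\<forall>\<^sub>\<infinity>t. X t \<in> locus X"
proof -
  obtain h where h: "irreducible h" "locus X = zero_set h"
    "\<And>g. (\<forall>\<^sub>\<infinity>t. eval2 g (X t) = 0) \<longleftrightarrow> h dvd g" using locus_irreducible[OF assms] by blast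
  have "\<forall>\<^sub>\<infinity>t. eval2 h (X t) = 0" using h(3) by simp
  thus ?thesis by (simp add: h(2) zero_set_def)
qed

text \<open>
  The ideals of \<open>X\<close> and \<open>W\<close> are generated by irreducible polynomials, and one contains the other.
\<close>

lemma locus_vanishing_eq:
  fixes X W :: "'a::{alg_closed_field,field_char_0,field_gcd} \<Rightarrow> 'a \<times> 'a"
  assumes "nonconst_map X" "nonconst_map W" "\<forall>\<^sub>\<infinity>t. W t \<in> locus X"
  shows "(\<forall>\<^sub>\<infinity>t. eval2 g (W t) = 0) \<longleftrightarrow> (\<forall>\<^sub>\<infinity>t. eval2 g (X t) = 0)"
proof -
  obtain h where h: "irreducible h" "locus X = zero_set h"
    "\<And>g. (\<forall>\<^sub>\<infinity>t. eval2 g (X t) = 0) \<longleftrightarrow> h dvd g" using locus_irreducible[OF assms(1)] by blast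
  obtain k where k: "irreducible k" "\<And>g. (\<forall>\<^sub>\<infinity>t. eval2 g (W t) = 0) \<longleftrightarrow> k dvd g"
    using locus_irreducible[OF assms(2)] by blast
  have "k dvd h" using assms(3) k(2)[of h] by (simp add: h(2) zero_set_def)
  moreover from this have "h dvd k" by (rule irreducible_associated[OF k(1) h(1)])
  ultimately show ?thesis unfolding h(3) k(2) by (meson dvd_trans)
qed

text \<open>
  The factor is the rational inverse of \<open>P\<close> applied to \<open>W\<close>. It is not constant, since otherwise the
  inverse would be constant on the curve.
\<close>

theorem factor_through_proper:
  fixes W :: "'a::{alg_closed_field,field_char_0,field_gcd} \<Rightarrow> 'a \<times> 'a"
  assumes P: "proper_parametrization P C" and W: "nonconst_map W" "\<forall>\<^sub>\<infinity>t. W t \<in> C"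
  obtains s where "nonconst s" "\<forall>\<^sub>\<infinity>t. W t = par_eval P (s t)"
proof -
  have X: "nonconst_map (par_eval P)" and C: "C = locus (par_eval P)"
    using P by (auto simp: proper_parametrization_iff parametrization_iff)
  obtain u v where uv: "rational_inverse u v (par_eval P)"
    using P by (auto simp: proper_parametrization_iff)
  note vanish = locus_vanishing_eq[OF X W(1) W(2)[unfolded C]]
  define s where "s = (\<lambda>t. eval2 u (W t) / eval2 v (W t))"
  note ratW = nonconst_map_rat_map[OF W(1)]
  have "\<not> (\<forall>\<^sub>\<infinity>t. eval2 v (W t) = 0)"
  proof
    assume "\<forall>\<^sub>\<infinity>t. eval2 v (W t) = 0"
    hence "\<forall>\<^sub>\<infinity>t. eval2 v (par_eval P t) = 0" by (simp add: vanish)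
    with uv[unfolded rational_inverse_def] have "\<forall>\<^sub>\<infinity>t::'a. False" by eventually_elim simp
    thus False using MOST_ex by blast
  qed
  hence v: "\<forall>\<^sub>\<infinity>t. eval2 v (W t) \<noteq> 0" using rat_map_vanishing[OF ratW] by blast
  have s: "nonconst s"
    unfolding nonconst_def
  proof (intro conjI allI notI)
    show "rat_germ s" unfolding s_def by (intro rat_germ_divide rat_map_eval2 ratW)
    fix c assume "\<forall>\<^sub>\<infinity>t. s t = c"
    with v have "\<forall>\<^sub>\<infinity>t. eval2 (u - smult [:c:] v) (W t) = 0"
      by eventually_elim (auto simp: s_def field_simps)
    hence "\<forall>\<^sub>\<infinity>t. eval2 (u - smult [:c:] v) (par_eval P t) = 0" by (simp only: vanish)
    with uv[unfolded rational_inverse_def] have "\<forall>\<^sub>\<infinity>t. t = c"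
      by eventually_elim (auto simp: field_simps)
    thus False using nonconst_id unfolding nonconst_def by blast
  qed
  have "\<forall>\<^sub>\<infinity>t. W t = par_eval P (s t)"
    using W(2) v nonconst_MOST[OF s par_defined_MOST[of P]]
  proof eventually_elim
    case (elim t)
    thus ?case using rational_inverse_par[OF uv, of "W t"] by (simp add: s_def C)
  qed
  with s show ?thesis by (rule that)
qed

lemma nonconst_almost_onto:
  fixes s :: "'a::{alg_closed_field,field_char_0,field_gcd} \<Rightarrow> 'a"
  assumes "nonconst s" "finite B"
  shows "\<forall>\<^sub>\<infinity>c. \<exists>t. t \<notin> B \<and> s t = c"
proof -
  obtain p q where pq: "q \<noteq> 0" "coprime p q" "\<forall>\<^sub>\<infinity>t. s t = poly p t / poly q t"
    by (rule rat_germ_coprime[OF nonconst_rat_germ[OF assms(1)]])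
  have "\<exists>i>0. coeff p i \<noteq> 0 \<or> coeff q i \<noteq> 0"
  proof (rule ccontr)
    assume "\<not> (\<exists>i>0. coeff p i \<noteq> 0 \<or> coeff q i \<noteq> 0)"
    hence "degree p = 0" "degree q = 0" by (metis leading_coeff_0_iff degree_0 gr0I)+
    then obtain a b where "p = [:a:]" "q = [:b:]" by (auto elim!: degree_eq_zeroE)
    hence "\<forall>\<^sub>\<infinity>t. s t = a / b" using pq(3) by simp
    thus False using assms(1) unfolding nonconst_def by blast
  qed
  then obtain i where i: "i > 0" "coeff p i \<noteq> 0 \<or> coeff q i \<noteq> 0" by blast
  hence "[:coeff p i, - coeff q i:] \<noteq> 0" by auto
  define B' where "B' = B \<union> {t. \<not> s t = poly p t / poly q t}"
  have "finite B'" using pq(3) assms(2) by (simp add: B'_def eventually_cofinite)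
  hence "\<forall>\<^sub>\<infinity>c. c \<notin> (\<lambda>t. poly p t / poly q t) ` B'" by (intro MOST_notin finite_imageI)
  with MOST_poly_nonzero[OF \<open>[:coeff p i, - coeff q i:] \<noteq> 0\<close>] show ?thesis
  proof eventually_elim
    case (elim c)
    have "coeff (p - smult c q) i \<noteq> 0" using elim(1) by (simp add: mult.commute)
    hence "0 < degree (p - smult c q)" using i(1) le_degree[of "p - smult c q" i] by simp
    then obtain t where t: "poly (p - smult c q) t = 0" using alg_closed_imp_poly_has_root by blast
    hence "poly q t \<noteq> 0" using coprime_no_common_root[OF pq(2), of t] by auto
    hence "poly p t / poly q t = c" using t by simp
    moreover from this have "t \<notin> B'" using elim(2) by blast
    ultimately show ?case by (auto simp: B'_def)
  qed
qed

text \<open>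
  Both maps factor through one proper parametrization, and a non-constant rational function takes
  all but finitely many values, even outside a given finite set.
\<close>

lemma same_locus_hits:
  fixes X W :: "'a::{alg_closed_field,field_char_0,field_gcd} \<Rightarrow> 'a \<times> 'a"
  assumes "nonconst_map X" "nonconst_map W" "locus W = locus X" "finite B"
  shows "\<forall>\<^sub>\<infinity>t. \<exists>t'. t' \<notin> B \<and> X t' = W t"
proof -
  obtain P s where P: "proper_parametrization P (locus X)" and s: "nonconst s"
    "\<forall>\<^sub>\<infinity>t. X t = par_eval P (s t)" by (rule lueroth_proper[OF assms(1)])
  obtain r where r: "nonconst r" "\<forall>\<^sub>\<infinity>t. W t = par_eval P (r t)"
    using factor_through_proper[OF P assms(2)] MOST_in_locus[OF assms(2)] assms(3) by auto
  define B' where "B' = B \<union> {t. \<not> X t = par_eval P (s t)}"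
  have "finite B'" using s(2) assms(4) by (simp add: B'_def eventually_cofinite)
  from nonconst_MOST[OF r(1) nonconst_almost_onto[OF s(1) this]] r(2) show ?thesis
  proof eventually_elim
    case (elim t)
    then obtain t' where "t' \<notin> B'" "s t' = r t" by blast
    thus ?case using elim(2) by (intro exI[of _ t']) (auto simp: B'_def)
  qed
qed

section \<open>Excluded curves\<close>

definition dist2 :: "'a::comm_ring_1 \<times> 'a \<Rightarrow> 'a \<times> 'a \<Rightarrow> 'a" where
  "dist2 A y = (fst y - fst A)\<^sup>2 + (snd y - snd A)\<^sup>2"

text \<open>
  If \<open>X\<close> factors through a map \<open>\<phi>\<close> that is regular away from \<open>0\<close>, an equation of the curve
  becomes a polynomial in \<open>\<tau>\<close> with infinitely many zeros.
\<close>

lemma factored_image_in_locus: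
  fixes X :: "'a::field_char_0 \<Rightarrow> 'a \<times> 'a" and \<phi> :: "'a \<Rightarrow> 'a \<times> 'a"
  assumes "nonconst \<tau>" "\<forall>\<^sub>\<infinity>t. X t = \<phi> (\<tau> t)"
    and "\<exists>p k. \<forall>s. s \<noteq> 0 \<longrightarrow> s ^ k * fst (\<phi> s) = poly p s"
    and "\<exists>p k. \<forall>s. s \<noteq> 0 \<longrightarrow> s ^ k * snd (\<phi> s) = poly p s"
    and "s0 \<noteq> 0"
  shows "\<phi> s0 \<in> locus X"
proof (rule locusI)
  fix g assume g: "\<forall>\<^sub>\<infinity>t. eval2 g (X t) = 0"
  define Q where "Q F \<longleftrightarrow> (\<exists>p k. \<forall>s. s \<noteq> 0 \<longrightarrow> s ^ k * F s = poly p s)" for F :: "'a \<Rightarrow> 'a"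
  have "Q (\<lambda>s. eval2 g (fst (\<phi> s), snd (\<phi> s)))"
  proof (rule eval2_closed)
    show "Q (\<lambda>s. c)" for c unfolding Q_def by (intro exI[of _ "[:c:]"] exI[of _ 0]) simp
    show "Q (\<lambda>s. fst (\<phi> s))" "Q (\<lambda>s. snd (\<phi> s))" unfolding Q_def by fact+
  next
    fix F G assume "Q F" "Q G"
    then obtain p k q l where *: "\<And>s. s \<noteq> 0 \<Longrightarrow> s ^ k * F s = poly p s"
      "\<And>s. s \<noteq> 0 \<Longrightarrow> s ^ l * G s = poly q s" unfolding Q_def by metis
    have "s ^ (k + l) * (F s + G s) = poly (monom 1 l * p + monom 1 k * q) s" if "s \<noteq> 0" for s
      using *(1)[OF that] *(2)[OF that] by (simp add: poly_monom power_add algebra_simps flip: *(1)[OF that] *(2)[OF that])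
    thus "Q (\<lambda>s. F s + G s)" unfolding Q_def by blast
    have "s ^ (k + l) * (F s * G s) = poly (p * q) s" if "s \<noteq> 0" for s
      using *(1)[OF that] *(2)[OF that] by (simp add: power_add algebra_simps flip: *(1)[OF that] *(2)[OF that])
    thus "Q (\<lambda>s. F s * G s)" unfolding Q_def by blast
  qed
  then obtain p k where pk: "\<And>s. s \<noteq> 0 \<Longrightarrow> s ^ k * eval2 g (\<phi> s) = poly p s"
    unfolding Q_def by auto
  have "p = 0"
  proof (rule ccontr)
    assume "p \<noteq> 0"
    have "\<forall>\<^sub>\<infinity>t::'a. False"
      using nonconst_MOST[OF assms(1) MOST_poly_nonzero[OF \<open>p \<noteq> 0\<close>]] g assms(2)
        nonconst_neq[OF assms(1), of 0]
      by eventually_elim (use pk in force)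
    thus False using MOST_ex by blast
  qed
  thus "eval2 g (\<phi> s0) = 0" using pk[OF assms(5)] assms(5) by simp
qed

text \<open>
  Coordinate \<open>\<tau>\<close> along the line, shifted so that the given point \<open>y\<close> has \<open>\<tau> = 1\<close> and not the
  excluded value \<open>0\<close>.
\<close>

lemma locus_line:
  fixes X :: "'a::field_char_0 \<Rightarrow> 'a \<times> 'a"
  assumes X: "nonconst_map X" and uv: "(u, v) \<noteq> (0, 0)"
    and line: "\<forall>\<^sub>\<infinity>t. u * (fst (X t) - a) + v * (snd (X t) - b) = 0"
  shows "locus X = {(y1, y2). u * (y1 - a) + v * (y2 - b) = 0}"
proof (intro equalityI subsetI)
  define g where "g = [:[:- u * a - v * b, u:], [:v:]:]"
  have g: "eval2 g y = u * (fst y - a) + v * (snd y - b)" for y by (simp add: g_def algebra_simps)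
  fix y assume "y \<in> locus X"
  hence "eval2 g y = 0" by (rule locusD) (simp add: g line)
  thus "y \<in> {(y1, y2). u * (y1 - a) + v * (y2 - b) = 0}" by (auto simp: g)
next
  fix y assume "y \<in> {(y1, y2). u * (y1 - a) + v * (y2 - b) = 0}"
  hence y: "u * (fst y - a) + v * (snd y - b) = 0" by auto
  define \<tau>0 where "\<tau>0 z = (if v \<noteq> 0 then (fst z - a) / v else - ((snd z - b) / u))" for z
  define \<tau> where "\<tau> z = \<tau>0 z - \<tau>0 y + 1" for z
  define \<phi> where "\<phi> s = (a + (s + \<tau>0 y - 1) * v, b - (s + \<tau>0 y - 1) * u)" for s
  have on: "\<phi> (\<tau> z) = z" if "u * (fst z - a) + v * (snd z - b) = 0" for z
  proof (cases "v = 0")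
    case True
    thus ?thesis using that uv by (auto simp: \<phi>_def \<tau>_def \<tau>0_def prod_eq_iff)
  next
    case False
    have "snd z = b - (fst z - a) / v * u"
      using that False by (simp add: field_simps)
    thus ?thesis using False by (simp add: \<phi>_def \<tau>_def \<tau>0_def prod_eq_iff)
  qed
  have XM: "\<forall>\<^sub>\<infinity>t. X t = \<phi> (\<tau> (X t))" using line by eventually_elim (simp add: on)
  have rat: "rat_germ (\<lambda>t. fst (X t))" "rat_germ (\<lambda>t. snd (X t))"
    using X by (simp_all add: nonconst_map_def rat_map_def)
  have "nonconst (\<lambda>t. \<tau> (X t))"
    unfolding nonconst_def
  proof (intro conjI allI notI)
    show "rat_germ (\<lambda>t. \<tau> (X t))"
      unfolding \<tau>_def \<tau>0_def using rat by (cases "v = 0") (auto intro!: rat_germ_intros)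
    fix c assume "\<forall>\<^sub>\<infinity>t. \<tau> (X t) = c"
    with XM have "\<forall>\<^sub>\<infinity>t. X t = \<phi> c" by eventually_elim simp
    thus False using X unfolding nonconst_map_def by blast
  qed
  moreover have "\<exists>p k. \<forall>s. s \<noteq> 0 \<longrightarrow> s ^ k * fst (\<phi> s) = poly p s"
    by (rule exI[of _ "[:a + (\<tau>0 y - 1) * v, v:]"], rule exI[of _ 0]) (simp add: \<phi>_def algebra_simps)
  moreover have "\<exists>p k. \<forall>s. s \<noteq> 0 \<longrightarrow> s ^ k * snd (\<phi> s) = poly p s"
    by (rule exI[of _ "[:b - (\<tau>0 y - 1) * u, - u:]"], rule exI[of _ 0]) (simp add: \<phi>_def algebra_simps)
  ultimately have "\<phi> 1 \<in> locus X" using XM by (intro factored_image_in_locus) auto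
  thus "y \<in> locus X" using on[OF y] by (simp add: \<tau>_def)
qed

lemma imaginary_unit_exists: "\<exists>i :: 'a::alg_closed_field. i\<^sup>2 = -1"
  using nth_root_exists[of 2] by auto

lemma locus_circle:
  fixes X :: "'a::{alg_closed_field,field_char_0} \<Rightarrow> 'a \<times> 'a"
  assumes X: "nonconst_map X" and d: "d \<noteq> 0"
    and circle: "\<forall>\<^sub>\<infinity>t. dist2 (a, b) (X t) = d\<^sup>2"
  shows "locus X = {(y1, y2). (y1 - a)\<^sup>2 + (y2 - b)\<^sup>2 = d\<^sup>2}"
proof (intro equalityI subsetI)
  define g where "g = [:[:- a, 1:]\<^sup>2 - [:d\<^sup>2:], 0:] + [:[:- b:], 1:]\<^sup>2"
  have g: "eval2 g y = dist2 (a, b) y - d\<^sup>2" for y by (simp add: g_def dist2_def algebra_simps)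
  fix y assume "y \<in> locus X"
  hence "eval2 g y = 0" by (rule locusD) (use circle in \<open>simp add: g\<close>)
  thus "y \<in> {(y1, y2). (y1 - a)\<^sup>2 + (y2 - b)\<^sup>2 = d\<^sup>2}" by (auto simp: g dist2_def)
next
  fix y assume "y \<in> {(y1, y2). (y1 - a)\<^sup>2 + (y2 - b)\<^sup>2 = d\<^sup>2}"
  hence y: "dist2 (a, b) y = d\<^sup>2" by (auto simp: dist2_def)
  obtain i :: 'a where i: "i\<^sup>2 = -1" using imaginary_unit_exists by blast
  have i0: "i \<noteq> 0" using i by auto
  \<comment> \<open>In the isotropic coordinates \<open>\<tau>\<close> and \<open>\<tau>'\<close> the circle is the hyperbola \<open>\<tau> \<tau>' = d\<^sup>2\<close>.\<close>
  define \<tau> where "\<tau> z = (fst z - a) + i * (snd z - b)" for z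
  define \<tau>' where "\<tau>' z = (fst z - a) - i * (snd z - b)" for z
  define \<phi> where "\<phi> s = (a + (s + d\<^sup>2 / s) / 2, b + (s - d\<^sup>2 / s) / (2 * i))" for s
  have prod: "\<tau> z * \<tau>' z = dist2 (a, b) z" for z
  proof -
    have "\<tau> z * \<tau>' z = (fst z - a)\<^sup>2 - i\<^sup>2 * (snd z - b)\<^sup>2"
      by (simp add: \<tau>_def \<tau>'_def algebra_simps power2_eq_square)
    thus ?thesis by (simp add: i dist2_def)
  qed
  have on: "\<tau> z \<noteq> 0 \<and> \<phi> (\<tau> z) = z" if "dist2 (a, b) z = d\<^sup>2" for z
  proof -
    have p: "\<tau> z * \<tau>' z = d\<^sup>2" using prod that by simp
    hence nz: "\<tau> z \<noteq> 0" using d by auto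
    hence "d\<^sup>2 / \<tau> z = \<tau>' z" using p by (simp add: field_simps)
    moreover have "\<tau> z + \<tau>' z = 2 * (fst z - a)" "\<tau> z - \<tau>' z = 2 * i * (snd z - b)"
      by (simp_all add: \<tau>_def \<tau>'_def algebra_simps)
    ultimately show ?thesis using nz i0 by (simp add: \<phi>_def prod_eq_iff del: right_diff_distrib_numeral)
  qed
  have XM: "\<forall>\<^sub>\<infinity>t. X t = \<phi> (\<tau> (X t))" using circle by eventually_elim (simp add: on)
  have rat: "rat_germ (\<lambda>t. fst (X t))" "rat_germ (\<lambda>t. snd (X t))"
    using X by (simp_all add: nonconst_map_def rat_map_def)
  have "nonconst (\<lambda>t. \<tau> (X t))"
    unfolding nonconst_def
  proof (intro conjI allI notI)
    show "rat_germ (\<lambda>t. \<tau> (X t))" unfolding \<tau>_def using rat by (auto intro!: rat_germ_intros)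
    fix c assume "\<forall>\<^sub>\<infinity>t. \<tau> (X t) = c"
    with XM have "\<forall>\<^sub>\<infinity>t. X t = \<phi> c" by eventually_elim simp
    thus False using X unfolding nonconst_map_def by blast
  qed
  moreover have "\<exists>p k. \<forall>s. s \<noteq> 0 \<longrightarrow> s ^ k * fst (\<phi> s) = poly p s"
    by (rule exI[of _ "[:d\<^sup>2 / 2, a, 1 / 2:]"], rule exI[of _ 1])
      (simp add: \<phi>_def field_simps power2_eq_square)
  moreover have "\<exists>p k. \<forall>s. s \<noteq> 0 \<longrightarrow> s ^ k * snd (\<phi> s) = poly p s"
    by (rule exI[of _ "[:- d\<^sup>2 / (2 * i), b, 1 / (2 * i):]"], rule exI[of _ 1])
      (simp add: \<phi>_def i0 field_simps power2_eq_square)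
  ultimately have "\<phi> (\<tau> y) \<in> locus X" using XM on[OF y] by (intro factored_image_in_locus) auto
  thus "y \<in> locus X" using on[OF y] by simp
qed

text \<open>
  The isotropic lines through \<open>A\<close> count as well; this keeps \<open>\<parallel>X - A\<parallel>\<^sup>2\<close> from vanishing
  identically.
\<close>

definition off_lines :: "'a::field \<times> 'a \<Rightarrow> ('a \<Rightarrow> 'a \<times> 'a) \<Rightarrow> bool" where
  "off_lines A X \<longleftrightarrow> (\<forall>u v. (u, v) \<noteq> (0, 0) \<longrightarrow>
     \<not> (\<forall>\<^sub>\<infinity>t. u * (fst (X t) - fst A) + v * (snd (X t) - snd A) = 0))"

lemma off_linesD: "off_lines A X \<Longrightarrow> (u, v) \<noteq> (0, 0) \<Longrightarrow>
    \<forall>\<^sub>\<infinity>t. u * (fst (X t) - fst A) + v * (snd (X t) - snd A) = 0 \<Longrightarrow> False"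
  unfolding off_lines_def by blast

lemma rat_germ_dist2: "rat_map X \<Longrightarrow> rat_germ (\<lambda>t. dist2 A (X t))"
  unfolding dist2_def rat_map_def by (intro rat_germ_intros) auto

text \<open>
  \<open>\<parallel>X - A\<parallel>\<^sup>2\<close> is the product of the two linear forms that define the isotropic lines through \<open>A\<close>.
\<close>

lemma off_lines_dist2:
  fixes X :: "'a::{alg_closed_field,field_char_0} \<Rightarrow> 'a \<times> 'a"
  assumes "rat_map X" "off_lines A X"
  shows "\<forall>\<^sub>\<infinity>t. dist2 A (X t) \<noteq> 0"
proof (rule ccontr)
  assume "\<not> (\<forall>\<^sub>\<infinity>t. dist2 A (X t) \<noteq> 0)"
  hence 0: "\<forall>\<^sub>\<infinity>t. dist2 A (X t) = 0"
    using rat_germ_zero_or_nonzero[OF rat_germ_dist2[OF assms(1)]] by blast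
  obtain i :: 'a where i: "i\<^sup>2 = -1" using imaginary_unit_exists by blast
  define F where "F j t = 1 * (fst (X t) - fst A) + j * (snd (X t) - snd A)" for j t
  have "rat_germ (F i)"
    using assms(1) unfolding F_def rat_map_def by (intro rat_germ_intros) auto
  moreover have "\<not> (\<forall>\<^sub>\<infinity>t. F i t = 0)" "\<not> (\<forall>\<^sub>\<infinity>t. F (- i) t = 0)"
    unfolding F_def by (rule notI, erule off_linesD[OF assms(2), rotated], simp)+
  ultimately have "\<forall>\<^sub>\<infinity>t. F i t \<noteq> 0" using rat_germ_zero_or_nonzero by blast
  with 0 have "\<forall>\<^sub>\<infinity>t. F (- i) t = 0"
  proof eventually_elim
    case (elim t)
    have "F i t * F (- i) t = (fst (X t) - fst A)\<^sup>2 - i\<^sup>2 * (snd (X t) - snd A)\<^sup>2"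
      by (simp add: F_def algebra_simps power2_eq_square)
    hence "F i t * F (- i) t = 0" using elim(1) by (simp add: i dist2_def)
    thus ?case using elim(2) by simp
  qed
  thus False using \<open>\<not> (\<forall>\<^sub>\<infinity>t. F (- i) t = 0)\<close> by blast
qed

section \<open>Rational distance and the reparametrizing curve\<close>

definition rational_distance :: "'a::field \<times> 'a \<Rightarrow> ('a \<Rightarrow> 'a \<times> 'a) \<Rightarrow> bool" where
  "rational_distance A X \<longleftrightarrow> (\<exists>m. rat_germ m \<and> (\<forall>\<^sub>\<infinity>t. dist2 A (X t) = (m t)\<^sup>2))"

lemma rf_eval_dist2:
  fixes P :: "'a::{field_char_0,field_gcd} poly fract \<times> 'a poly fract"
  shows "\<forall>\<^sub>\<infinity>t. rf_eval (sqnorm (fst P - const_rf (fst A), snd P - const_rf (snd A))) t =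
    dist2 A (par_eval P t)"
proof -
  define \<alpha> where "\<alpha> = fst P - const_rf (fst A)"
  define \<beta> where "\<beta> = snd P - const_rf (snd A)"
  have "\<forall>\<^sub>\<infinity>t. rf_eval \<alpha> t = fst (par_eval P t) - fst A"
    using rf_eval_diff[of "fst P" "const_rf (fst A)"] rf_eval_const[of "fst A"]
    by eventually_elim (simp add: \<alpha>_def par_eval_def)
  moreover have "\<forall>\<^sub>\<infinity>t. rf_eval \<beta> t = snd (par_eval P t) - snd A"
    using rf_eval_diff[of "snd P" "const_rf (snd A)"] rf_eval_const[of "snd A"]
    by eventually_elim (simp add: \<beta>_def par_eval_def)
  moreover note rf_eval_add[of "\<alpha> * \<alpha>" "\<beta> * \<beta>"] rf_eval_mult[of \<alpha> \<alpha>] rf_eval_mult[of \<beta> \<beta>]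
  ultimately show ?thesis unfolding \<alpha>_def[symmetric] \<beta>_def[symmetric]
    by eventually_elim (simp add: sqnorm_def dist2_def power2_eq_square)
qed

lemma rdf_iff:
  fixes P :: "'a::{field_char_0,field_gcd} poly fract \<times> 'a poly fract"
  shows "rdf A P \<longleftrightarrow> rational_distance A (par_eval P)"
proof
  assume "rdf A P"
  then obtain m where m: "sqnorm (fst P - const_rf (fst A), snd P - const_rf (snd A)) = m\<^sup>2"
    by (auto simp: rdf_def)
  have "\<forall>\<^sub>\<infinity>t. dist2 A (par_eval P t) = (rf_eval m t)\<^sup>2"
    using rf_eval_dist2[of P A] rf_eval_mult[of m m] unfolding m
    by eventually_elim (simp add: power2_eq_square)
  thus "rational_distance A (par_eval P)" unfolding rational_distance_def using rat_germ_rf_eval by blast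
next
  assume "rational_distance A (par_eval P)"
  then obtain m where m: "rat_germ m" "\<forall>\<^sub>\<infinity>t. dist2 A (par_eval P t) = (m t)\<^sup>2"
    by (auto simp: rational_distance_def)
  obtain r where r: "\<forall>\<^sub>\<infinity>t. rf_eval r t = m t" by (rule rat_germ_fract[OF m(1)])
  have "\<forall>\<^sub>\<infinity>t. rf_eval (sqnorm (fst P - const_rf (fst A), snd P - const_rf (snd A))) t = rf_eval (r * r) t"
    using rf_eval_dist2[of P A] rf_eval_mult[of r r] m(2) r
    by eventually_elim (simp add: power2_eq_square)
  thus "rdf A P" unfolding rdf_def rf_eval_eq_iff by (auto simp: power2_eq_square)
qed

text \<open>
  With \<open>P = Q \<circ> s\<close>, a square root of \<open>\<parallel>Q - A\<parallel>\<^sup>2\<close> composed with \<open>s\<close> is one of \<open>\<parallel>P - A\<parallel>\<^sup>2\<close>.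
\<close>

lemma rdf_transfer:
  fixes P Q :: "'a::{alg_closed_field,field_char_0,field_gcd} poly fract \<times> 'a poly fract"
  assumes "proper_parametrization Q C" "rdf A Q" "parametrization P C"
  shows "rdf A P"
proof -
  have W: "nonconst_map (par_eval P)" "\<forall>\<^sub>\<infinity>t. par_eval P t \<in> C"
    using assms(3) MOST_in_locus[of "par_eval P"] by (auto simp: parametrization_iff)
  obtain s where s: "nonconst s" "\<forall>\<^sub>\<infinity>t. par_eval P t = par_eval Q (s t)"
    by (rule factor_through_proper[OF assms(1) W])
  obtain m where m: "rat_germ m" "\<forall>\<^sub>\<infinity>t. dist2 A (par_eval Q t) = (m t)\<^sup>2"
    using assms(2) unfolding rdf_iff rational_distance_def by blast
  have "\<forall>\<^sub>\<infinity>t. dist2 A (par_eval P t) = (m (s t))\<^sup>2"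
    using s(2) nonconst_MOST[OF s(1) m(2)] by eventually_elim simp
  thus ?thesis unfolding rdf_iff rational_distance_def using rat_germ_compose[OF m(1) s(1)] by blast
qed

lemma linear_poly_has_root:
  fixes f :: "'b::field poly"
  assumes "degree f = 1" shows "\<exists>x. poly f x = 0"
proof -
  have "f = [:coeff f 0, coeff f 1:]"
    using assms by (intro poly_eqI) (auto simp: coeff_pCons coeff_eq_0 split: nat.split)
  moreover have "coeff f 1 \<noteq> 0" using assms leading_coeff_0_iff[of f] by auto
  ultimately have "poly f (- coeff f 0 / coeff f 1) = 0"
    by (metis (no_types, lifting) add.right_inverse add.right_neutral mult_zero_right
        nonzero_eq_divide_eq poly_0 poly_pCons mult.commute)
  thus ?thesis ..
qed

lemma irreducible_quadratic:
  fixes p :: "'b::field poly"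
  assumes "degree p = 2" "\<And>x. poly p x \<noteq> 0"
  shows "irreducible p"
proof (rule irreducibleI)
  show "p \<noteq> 0" using assms(1) by auto
  show "\<not> is_unit p" using assms(1) by (auto simp: is_unit_poly_iff)
  fix f g assume fg: "p = f * g"
  hence nz: "f \<noteq> 0" "g \<noteq> 0" using \<open>p \<noteq> 0\<close> by auto
  have "degree f \<noteq> 1" "degree g \<noteq> 1"
    using assms(2) unfolding fg by (metis linear_poly_has_root mult_eq_0_iff poly_mult)+
  moreover have "degree f + degree g = 2" using assms(1) degree_mult_eq[OF nz] fg by simp
  ultimately have "degree f = 0 \<or> degree g = 0" by arith
  thus "is_unit f \<or> is_unit g" using nz by (auto simp: is_unit_iff_degree)
qed

lemma fract_poly_primitive_part_fract:
  fixes p :: "'a::field_gcd poly fract poly"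
  assumes "p \<noteq> 0"
  obtains c where "c \<noteq> 0" "fract_poly (primitive_part_fract p) = smult c p"
proof -
  have "fract_content p \<noteq> 0" using assms by simp
  moreover have "fract_poly (primitive_part_fract p) =
      smult (inverse (fract_content p)) (smult (fract_content p) (fract_poly (primitive_part_fract p)))"
    using \<open>fract_content p \<noteq> 0\<close> by simp
  hence "fract_poly (primitive_part_fract p) = smult (inverse (fract_content p)) p"
    by (simp only: content_times_primitive_part_fract)
  ultimately show ?thesis by (intro that[of "inverse (fract_content p)"]) auto
qed

text \<open>
  The quadratic polynomial over \<open>K(x\<^sub>1)\<close> has leading coefficient \<open>\<beta> = P\<^sub>2 - b\<close> and a quarter of its
  discriminant is \<open>\<parallel>P - A\<parallel>\<^sup>2\<close>. A square root \<open>m\<close> of it splits the polynomial into the two factors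
  with the roots \<open>(\<alpha> \<plusminus> m) / \<beta>\<close>; conversely a root \<open>r\<close> yields the square root \<open>\<beta> r - \<alpha>\<close>.
\<close>

lemma reparam_curve_reducible_iff:
  fixes P :: "'a::{alg_closed_field,field_char_0,field_gcd} poly fract \<times> 'a poly fract"
  assumes off: "off_lines A (par_eval P)"
  shows "reducible_curve (reparam_curve A P) \<longleftrightarrow> rdf A P"
proof -
  define \<alpha> where "\<alpha> = fst P - const_rf (fst A)"
  define \<beta> where "\<beta> = snd P - const_rf (snd A)"
  define q where "q = [:- \<beta>, - 2 * \<alpha>, \<beta>:]"
  have q: "reparam_poly A P = primitive_part_fract q"
    unfolding reparam_poly_def q_def \<alpha>_def \<beta>_def
    by (rule arg_cong[of _ _ primitive_part_fract]) (simp add: power2_eq_square one_pCons)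
  have \<beta>0: "\<beta> \<noteq> 0"
  proof
    assume "\<beta> = 0"
    hence "snd P = const_rf (snd A)" by (simp add: \<beta>_def)
    hence "\<forall>\<^sub>\<infinity>t. 0 * (fst (par_eval P t) - fst A) + 1 * (snd (par_eval P t) - snd A) = 0"
      using rf_eval_const[of "snd A"] by (simp add: par_eval_def)
    thus False by (intro off_linesD[OF off, of 0 1]) auto
  qed
  have n0: "\<alpha>\<^sup>2 + \<beta>\<^sup>2 \<noteq> 0"
  proof
    assume "\<alpha>\<^sup>2 + \<beta>\<^sup>2 = 0"
    hence "\<forall>\<^sub>\<infinity>t. rf_eval 0 t = dist2 A (par_eval P t)"
      using rf_eval_dist2[of P A] by (simp add: sqnorm_def \<alpha>_def \<beta>_def)
    with off_lines_dist2[OF rat_map_par_eval off] have "\<forall>\<^sub>\<infinity>t::'a. False"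
      by eventually_elim (simp add: rf_eval_def)
    thus False using MOST_ex by blast
  qed
  have deg_q: "degree q = 2" and q0: "q \<noteq> 0" using \<beta>0 by (auto simp: q_def)
  define R where "R = primitive_part_fract q"
  obtain c where c: "c \<noteq> 0" "fract_poly R = smult c q"
    unfolding R_def by (rule fract_poly_primitive_part_fract[OF q0])
  have R1: "content R = 1" using q0 by (simp add: R_def)
  have degR: "degree R = 2" by (simp add: R_def deg_q)
  have rdf: "rdf A P \<longleftrightarrow> (\<exists>m. \<alpha>\<^sup>2 + \<beta>\<^sup>2 = m\<^sup>2)"
    by (simp add: rdf_def sqnorm_def \<alpha>_def \<beta>_def)
  have "reducible_curve (zero_set R) \<longleftrightarrow> (\<exists>m. \<alpha>\<^sup>2 + \<beta>\<^sup>2 = m\<^sup>2)"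
  proof
    assume red: "reducible_curve (zero_set R)"
    have "\<exists>x. poly q x = 0"
    proof (rule ccontr)
      assume "\<nexists>x. poly q x = 0"
      hence "irreducible (fract_poly R)" using c deg_q by (intro irreducible_quadratic) auto
      hence "irreducible R" using R1 degR by (subst nonconst_poly_irreducible_iff) auto
      thus False using not_reducible_zero_set red by blast
    qed
    then obtain x where "poly q x = 0" ..
    hence x: "\<beta> * x\<^sup>2 - 2 * \<alpha> * x = \<beta>" by (simp add: q_def algebra_simps power2_eq_square)
    have "(\<beta> * x - \<alpha>)\<^sup>2 = \<beta> * (\<beta> * x\<^sup>2 - 2 * \<alpha> * x) + \<alpha>\<^sup>2"
      by (simp add: algebra_simps power2_eq_square)
    also have "\<dots> = \<alpha>\<^sup>2 + \<beta>\<^sup>2" unfolding x by (simp add: power2_eq_square)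
    finally show "\<exists>m. \<alpha>\<^sup>2 + \<beta>\<^sup>2 = m\<^sup>2" by metis
  next
    assume "\<exists>m. \<alpha>\<^sup>2 + \<beta>\<^sup>2 = m\<^sup>2"
    then obtain m where m: "\<alpha>\<^sup>2 + \<beta>\<^sup>2 = m\<^sup>2" ..
    have m0: "m \<noteq> 0" using m n0 by auto
    have "m \<noteq> - m"
    proof
      assume "m = - m"
      have "\<forall>\<^sub>\<infinity>t. rf_eval m t = rf_eval 0 t"
        using rf_eval_uminus[of m] unfolding \<open>m = - m\<close>[symmetric]
        by eventually_elim (simp add: rf_eval_def)
      thus False using m0 rf_eval_eq_iff by blast
    qed
    define x1 where "x1 = (\<alpha> + m) / \<beta>"
    define x2 where "x2 = (\<alpha> - m) / \<beta>"
    have x12: "x1 \<noteq> x2"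
    proof
      assume "x1 = x2"
      hence "\<alpha> + m = \<alpha> - m" using \<beta>0 by (simp add: x1_def x2_def)
      hence "\<alpha> + m = \<alpha> + (- m)" by simp
      thus False using \<open>m \<noteq> - m\<close> by (simp only: add_left_cancel)
    qed
    have s: "\<beta> * (x1 + x2) = 2 * \<alpha>" using \<beta>0 by (simp add: x1_def x2_def field_simps)
    have "\<beta> * \<beta> * (x1 * x2) = (\<alpha> + m) * (\<alpha> - m)"
      using \<beta>0 by (simp add: x1_def x2_def)
    also have "\<dots> = \<alpha>\<^sup>2 - m\<^sup>2" by (simp add: algebra_simps power2_eq_square)
    also have "\<dots> = - (\<beta> * \<beta>)" using m by (simp add: algebra_simps power2_eq_square flip: m)
    finally have "\<beta> * (\<beta> * (x1 * x2)) = \<beta> * (- \<beta>)" by (simp add: mult.assoc)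
    hence p: "\<beta> * (x1 * x2) = - \<beta>" by (rule mult_left_cancel[OF \<beta>0, THEN iffD1])
    have fac: "q = smult \<beta> ([:- x1, 1:] * [:- x2, 1:])"
      using s p by (simp add: q_def algebra_simps)
    define R1 where "R1 = primitive_part_fract [:- x1, 1:]"
    define R2 where "R2 = primitive_part_fract [:- x2, 1:]"
    obtain c1 where c1: "c1 \<noteq> 0" "fract_poly R1 = smult c1 [:- x1, 1:]"
      unfolding R1_def by (rule fract_poly_primitive_part_fract[of "[:- x1, 1:]"]) (simp, blast)
    obtain c2 where c2: "c2 \<noteq> 0" "fract_poly R2 = smult c2 [:- x2, 1:]"
      unfolding R2_def by (rule fract_poly_primitive_part_fract[of "[:- x2, 1:]"]) (simp, blast)
    have irr: "irreducible R1" "irreducible R2"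
      unfolding R1_def R2_def
      by (intro irreducible_primitive_part_fract irreducible_linear_field_poly; simp)+
    have "\<not> R1 dvd R2"
    proof
      assume "R1 dvd R2"
      hence "fract_poly R1 dvd fract_poly R2" by (rule fract_poly_dvd)
      hence "[:- x1, 1:] dvd [:- x2, 1:]"
        using c1 c2 by (simp add: smult_dvd_iff dvd_smult_iff del: smult_pCons)
      thus False using x12 by (simp flip: poly_eq_0_iff_dvd)
    qed
    note comp = two_component_curve(1)[OF irr this]
    have prod: "fract_poly (R1 * R2) = smult (c1 * c2) ([:- x1, 1:] * [:- x2, 1:])"
      by (simp add: c1(2) c2(2) mult.commute[of c2] del: smult_pCons mult_pCons_left mult_pCons_right)
    have "fract_poly R = smult (c * \<beta> / (c1 * c2)) (fract_poly (R1 * R2))"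
      unfolding prod c(2) fac using c1 c2 by simp
    moreover from this have "fract_poly (R1 * R2) = smult (c1 * c2 / (c * \<beta>)) (fract_poly R)"
      using c c1 c2 \<beta>0 by simp
    ultimately have "fract_poly (R1 * R2) dvd fract_poly R" "fract_poly R dvd fract_poly (R1 * R2)"
      by (metis dvd_smult dvd_refl)+
    moreover have "content (R1 * R2) = 1" by (simp add: content_mult R1_def R2_def)
    ultimately have "R1 * R2 dvd R" "R dvd R1 * R2" 
      using R1 by (simp_all only: fract_poly_dvdD)
    hence "zero_set R = zero_set (R1 * R2)" by (intro zero_set_eqI)
    thus "reducible_curve (zero_set R)" using comp by simp
  qed
  thus ?thesis by (simp add: reparam_curve_def q rdf R_def)
qed

section \<open>The ideal of the conchoid\<close>

text \<open>
  Measuring along the line through \<open>A\<close> from \<open>y\<close> rather than from \<open>A\<close> makes the distance condition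
  \<open>\<mu>\<^sup>2 \<parallel>y - A\<parallel>\<^sup>2 = d\<^sup>2\<close> even in \<open>\<mu>\<close>.
\<close>

definition displaced :: "'a::comm_ring_1 \<times> 'a \<Rightarrow> 'a \<Rightarrow> 'a \<times> 'a \<Rightarrow> 'a \<times> 'a" where
  "displaced A \<mu> y = (fst y + \<mu> * (fst y - fst A), snd y + \<mu> * (snd y - snd A))"

text \<open>
  The scalar of the definition is \<open>\<lambda> = 1 + \<mu>\<close>.
\<close>

lemma conchoid_alt:
  "conchoid A d C = zariski_closure {displaced A \<mu> y | \<mu> y. y \<in> C \<and> \<mu>\<^sup>2 * dist2 A y = d\<^sup>2}"
proof -
  have "{(x1, x2). \<exists>y1 y2 l. (y1, y2) \<in> C \<and> sqnorm (x1 - y1, x2 - y2) = d\<^sup>2 \<and>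
      x1 = fst A + l * (y1 - fst A) \<and> x2 = snd A + l * (y2 - snd A)} =
    {displaced A \<mu> y | \<mu> y. y \<in> C \<and> \<mu>\<^sup>2 * dist2 A y = d\<^sup>2}" (is "?L = ?R")
  proof (intro equalityI subsetI)
    fix x assume "x \<in> ?L"
    then obtain x1 x2 y1 y2 l where *: "x = (x1, x2)" "(y1, y2) \<in> C" "sqnorm (x1 - y1, x2 - y2) = d\<^sup>2"
      "x1 = fst A + l * (y1 - fst A)" "x2 = snd A + l * (y2 - snd A)" by auto
    have "x1 - y1 = (l - 1) * (y1 - fst A)" "x2 - y2 = (l - 1) * (y2 - snd A)"
      using *(4,5) by (simp_all add: algebra_simps)
    hence "(l - 1)\<^sup>2 * dist2 A (y1, y2) = d\<^sup>2"
      using *(3) by (simp add: sqnorm_def dist2_def power_mult_distrib distrib_left)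
    moreover have "x = displaced A (l - 1) (y1, y2)"
      using *(1,4,5) by (simp add: displaced_def algebra_simps)
    ultimately show "x \<in> ?R" using *(2) by blast
  next
    fix x assume "x \<in> ?R"
    then obtain \<mu> y1 y2 where *: "x = displaced A \<mu> (y1, y2)" "(y1, y2) \<in> C"
      "\<mu>\<^sup>2 * dist2 A (y1, y2) = d\<^sup>2" by force
    define x1 where "x1 = y1 + \<mu> * (y1 - fst A)"
    define x2 where "x2 = y2 + \<mu> * (y2 - snd A)"
    have "sqnorm (x1 - y1, x2 - y2) = d\<^sup>2"
      using *(3) by (simp add: x1_def x2_def sqnorm_def dist2_def power_mult_distrib distrib_left)
    moreover have "x1 = fst A + (1 + \<mu>) * (y1 - fst A)" "x2 = snd A + (1 + \<mu>) * (y2 - snd A)"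
      by (simp_all add: x1_def x2_def algebra_simps)
    moreover have "x = (x1, x2)" by (simp add: *(1) displaced_def x1_def x2_def)
    ultimately show "x \<in> ?L" using *(2) by blast
  qed
  thus ?thesis by (simp add: conchoid_def)
qed

definition dist2_poly :: "'a::comm_ring_1 \<times> 'a \<Rightarrow> 'a poly poly" where
  "dist2_poly A = [:[:- fst A, 1:]\<^sup>2:] + [:[:- snd A:], 1:]\<^sup>2"

lemma eval2_dist2_poly [simp]: "eval2 (dist2_poly A) y = dist2 A y"
  by (simp add: dist2_poly_def dist2_def algebra_simps)

text \<open>
  Since \<open>\<mu>\<^sup>2 \<parallel>y - A\<parallel>\<^sup>2 = d\<^sup>2\<close>, even powers of \<open>\<mu>\<close> can be eliminated at the price of powers of
  \<open>\<parallel>y - A\<parallel>\<^sup>2\<close>.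
\<close>

lemma conchoid_normal_form:
  fixes A :: "'a::field \<times> 'a"
  obtains k p q where "\<And>y \<mu>. \<mu>\<^sup>2 * dist2 A y = d\<^sup>2 \<Longrightarrow>
    dist2 A y ^ k * eval2 g (displaced A \<mu> y) = eval2 p y + \<mu> * eval2 q y"
proof -
  define Q where "Q F \<longleftrightarrow> (\<exists>k p q. \<forall>y \<mu>. \<mu>\<^sup>2 * dist2 A y = d\<^sup>2 \<longrightarrow>
    dist2 A y ^ k * F (\<mu>, y) = eval2 p y + \<mu> * eval2 q y)" for F :: "'a \<times> 'a \<times> 'a \<Rightarrow> 'a"
  have "Q (\<lambda>z. eval2 g (fst (displaced A (fst z) (snd z)), snd (displaced A (fst z) (snd z))))"
  proof (rule eval2_closed)
    show "Q (\<lambda>z. c)" for c unfolding Q_def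
      by (rule exI[of _ 0], rule exI[of _ "[:[:c:]:]"], rule exI[of _ 0]) simp
    show "Q (\<lambda>z. fst (displaced A (fst z) (snd z)))" unfolding Q_def
      by (rule exI[of _ 0], rule exI[of _ "[:[:0, 1:]:]"], rule exI[of _ "[:[:- fst A, 1:]:]"])
        (simp add: displaced_def)
    show "Q (\<lambda>z. snd (displaced A (fst z) (snd z)))" unfolding Q_def
      by (rule exI[of _ 0], rule exI[of _ "[:0, 1:]"], rule exI[of _ "[:[:- snd A:], 1:]"])
        (simp add: displaced_def)
  next
    fix F G :: "'a \<times> 'a \<times> 'a \<Rightarrow> 'a" assume "Q F" "Q G"
    from \<open>Q F\<close> obtain k p q where F: "\<And>y \<mu>. \<mu>\<^sup>2 * dist2 A y = d\<^sup>2 \<Longrightarrow>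
        dist2 A y ^ k * F (\<mu>, y) = eval2 p y + \<mu> * eval2 q y" unfolding Q_def by blast
    from \<open>Q G\<close> obtain k' p' q' where G: "\<And>y \<mu>. \<mu>\<^sup>2 * dist2 A y = d\<^sup>2 \<Longrightarrow>
        dist2 A y ^ k' * G (\<mu>, y) = eval2 p' y + \<mu> * eval2 q' y" unfolding Q_def by blast
    let ?N = "dist2_poly A"
    show "Q (\<lambda>z. F z + G z)" unfolding Q_def
    proof (rule exI[of _ "k + k'"], rule exI[of _ "?N ^ k' * p + ?N ^ k * p'"],
        rule exI[of _ "?N ^ k' * q + ?N ^ k * q'"], intro allI impI)
      fix y \<mu> assume *: "\<mu>\<^sup>2 * dist2 A y = d\<^sup>2"
      have "dist2 A y ^ (k + k') * (F (\<mu>, y) + G (\<mu>, y)) =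
          dist2 A y ^ k' * (dist2 A y ^ k * F (\<mu>, y)) + dist2 A y ^ k * (dist2 A y ^ k' * G (\<mu>, y))"
        by (simp add: algebra_simps power_add)
      thus "dist2 A y ^ (k + k') * (F (\<mu>, y) + G (\<mu>, y)) =
          eval2 (?N ^ k' * p + ?N ^ k * p') y + \<mu> * eval2 (?N ^ k' * q + ?N ^ k * q') y"
        unfolding F[OF *] G[OF *] by (simp add: algebra_simps)
    qed
    show "Q (\<lambda>z. F z * G z)" unfolding Q_def
    proof (rule exI[of _ "Suc (k + k')"], rule exI[of _ "?N * p * p' + [:[:d\<^sup>2:]:] * q * q'"],
        rule exI[of _ "?N * (p * q' + p' * q)"], intro allI impI)
      fix y \<mu> assume *: "\<mu>\<^sup>2 * dist2 A y = d\<^sup>2"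
      have "dist2 A y ^ Suc (k + k') * (F (\<mu>, y) * G (\<mu>, y)) =
          dist2 A y * ((dist2 A y ^ k * F (\<mu>, y)) * (dist2 A y ^ k' * G (\<mu>, y)))"
        by (simp add: algebra_simps power_add)
      also have "\<dots> = dist2 A y * eval2 p y * eval2 p' y + (\<mu>\<^sup>2 * dist2 A y) * eval2 q y * eval2 q' y +
          \<mu> * (dist2 A y * (eval2 p y * eval2 q' y + eval2 p' y * eval2 q y))"
        unfolding F[OF *] G[OF *] by (simp add: algebra_simps power2_eq_square)
      finally show "dist2 A y ^ Suc (k + k') * (F (\<mu>, y) * G (\<mu>, y)) =
          eval2 (?N * p * p' + [:[:d\<^sup>2:]:] * q * q') y + \<mu> * eval2 (?N * (p * q' + p' * q)) y"
        unfolding * by simp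
    qed
  qed
  hence "\<exists>k p q. \<forall>y \<mu>. \<mu>\<^sup>2 * dist2 A y = d\<^sup>2 \<longrightarrow>
    dist2 A y ^ k * eval2 g (displaced A \<mu> y) = eval2 p y + \<mu> * eval2 q y"
    unfolding Q_def by simp
  thus ?thesis using that by blast
qed

locale conchoid_of_curve =
  fixes X :: "'a::{alg_closed_field,field_char_0,field_gcd} \<Rightarrow> 'a \<times> 'a"
    and A :: "'a \<times> 'a" and d :: 'a
  assumes X: "nonconst_map X" and off: "off_lines A X" and d: "d \<noteq> 0"
begin

definition points :: "('a \<times> 'a) set" where
  "points = {displaced A \<mu> y | \<mu> y. y \<in> locus X \<and> \<mu>\<^sup>2 * dist2 A y = d\<^sup>2}"

lemma rat: "rat_map X" by (rule nonconst_map_rat_map[OF X])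

lemma dist2_MOST: "\<forall>\<^sub>\<infinity>t. dist2 A (X t) \<noteq> 0"
  by (rule off_lines_dist2[OF rat off])

lemma displacement_exists: "n \<noteq> 0 \<Longrightarrow> \<exists>\<mu>. \<mu> \<noteq> 0 \<and> \<mu>\<^sup>2 * n = d\<^sup>2"
proof -
  assume n: "n \<noteq> 0"
  obtain \<mu> where "\<mu>\<^sup>2 = d\<^sup>2 / n" using nth_root_exists[of 2 "d\<^sup>2 / n"] by auto
  thus ?thesis using n d by (intro exI[of _ \<mu>]) auto
qed

lemma vanishing_both_signs:
  assumes "n \<noteq> 0" "\<And>\<mu>. \<mu>\<^sup>2 * n = d\<^sup>2 \<Longrightarrow> p + \<mu> * q = 0"
  shows "p = 0 \<and> q = (0 :: 'a)"
proof -
  obtain \<mu> where \<mu>: "\<mu> \<noteq> 0" "\<mu>\<^sup>2 * n = d\<^sup>2" using displacement_exists[OF assms(1)] by blast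
  have "p + \<mu> * q = 0" by (rule assms(2)[OF \<mu>(2)])
  moreover have "p + (- \<mu>) * q = 0" by (rule assms(2)) (simp add: \<mu>(2))
  ultimately have "2 * p = 0" "2 * (\<mu> * q) = 0" by algebra+
  thus ?thesis using \<mu>(1) by simp
qed

text \<open>
  The two displaced points over \<open>y\<close> are interchanged by \<open>\<mu> \<mapsto> - \<mu>\<close>. Hence an equation that holds
  at both of them means that both coefficients of its normal form vanish at \<open>y\<close>, which is a
  closed condition on \<open>y\<close>; points of the curve that \<open>X\<close> misses add nothing.
\<close>

lemma vanishing_on_points_iff:
  "(\<forall>z\<in>points. eval2 g z = 0) \<longleftrightarrow>
    (\<forall>\<^sub>\<infinity>t. \<forall>\<mu>. \<mu>\<^sup>2 * dist2 A (X t) = d\<^sup>2 \<longrightarrow> eval2 g (displaced A \<mu> (X t)) = 0)"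
proof
  assume *: "\<forall>z\<in>points. eval2 g z = 0"
  show "\<forall>\<^sub>\<infinity>t. \<forall>\<mu>. \<mu>\<^sup>2 * dist2 A (X t) = d\<^sup>2 \<longrightarrow> eval2 g (displaced A \<mu> (X t)) = 0"
    using MOST_in_locus[OF X]
  proof eventually_elim
    case (elim t)
    thus ?case using * unfolding points_def by blast
  qed
next
  assume *: "\<forall>\<^sub>\<infinity>t. \<forall>\<mu>. \<mu>\<^sup>2 * dist2 A (X t) = d\<^sup>2 \<longrightarrow> eval2 g (displaced A \<mu> (X t)) = 0"
  obtain k p q where nf: "\<And>y \<mu>. \<mu>\<^sup>2 * dist2 A y = d\<^sup>2 \<Longrightarrow>
    dist2 A y ^ k * eval2 g (displaced A \<mu> y) = eval2 p y + \<mu> * eval2 q y"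
    by (rule conchoid_normal_form[of A d g]) blast
  have pq: "\<forall>\<^sub>\<infinity>t. eval2 p (X t) = 0 \<and> eval2 q (X t) = 0"
    using * dist2_MOST
  proof eventually_elim
    case (elim t)
    show ?case
    proof (rule vanishing_both_signs[OF elim(2)])
      fix \<mu> assume \<mu>: "\<mu>\<^sup>2 * dist2 A (X t) = d\<^sup>2"
      show "eval2 p (X t) + \<mu> * eval2 q (X t) = 0"
        using nf[OF \<mu>] elim(1) \<mu> by simp
    qed
  qed
  show "\<forall>z\<in>points. eval2 g z = 0"
  proof
    fix z assume "z \<in> points"
    then obtain \<mu> y where z: "z = displaced A \<mu> y" "y \<in> locus X" and \<mu>: "\<mu>\<^sup>2 * dist2 A y = d\<^sup>2"
      by (auto simp: points_def)
    have "eval2 p y = 0" "eval2 q y = 0"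
      using pq by (auto intro!: locusD[OF z(2)] elim: eventually_mono)
    hence "dist2 A y ^ k * eval2 g z = 0" using nf[OF \<mu>] by (simp add: z(1))
    moreover have "dist2 A y \<noteq> 0" using \<mu> d by auto
    ultimately show "eval2 g z = 0" by simp
  qed
qed

lemma conchoid_eq: "conchoid A d (locus X) = {y. \<forall>g. (\<forall>z\<in>points. eval2 g z = 0) \<longrightarrow> eval2 g y = 0}"
  by (simp add: conchoid_alt points_def zariski_closure_def)

subsection \<open>Irrational distance\<close>

text \<open>
  Multiplicativity of the norm \<open>p\<^sup>2 - \<mu>\<^sup>2 q\<^sup>2\<close> from the quadratic extension of \<open>K(t)\<close> generated by
  \<open>\<mu>\<close>: it vanishes only at zero unless \<open>\<parallel>X - A\<parallel>\<^sup>2 = (d / \<mu>)\<^sup>2\<close> is a square in \<open>K(t)\<close>.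
\<close>

lemma vanishing_on_points_prime:
  assumes "\<not> rational_distance A X" "\<forall>z\<in>points. eval2 (g1 * g2) z = 0"
  shows "(\<forall>z\<in>points. eval2 g1 z = 0) \<or> (\<forall>z\<in>points. eval2 g2 z = 0)"
proof -
  obtain k1 p1 q1 where nf1: "\<And>y \<mu>. \<mu>\<^sup>2 * dist2 A y = d\<^sup>2 \<Longrightarrow>
    dist2 A y ^ k1 * eval2 g1 (displaced A \<mu> y) = eval2 p1 y + \<mu> * eval2 q1 y"
    by (rule conchoid_normal_form[of A d g1]) blast
  obtain k2 p2 q2 where nf2: "\<And>y \<mu>. \<mu>\<^sup>2 * dist2 A y = d\<^sup>2 \<Longrightarrow>
    dist2 A y ^ k2 * eval2 g2 (displaced A \<mu> y) = eval2 p2 y + \<mu> * eval2 q2 y"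
    by (rule conchoid_normal_form[of A d g2]) blast
  define R where "R p q t = (eval2 p (X t))\<^sup>2 * dist2 A (X t) - d\<^sup>2 * (eval2 q (X t))\<^sup>2" for p q t
  have R_mu: "R p q t = dist2 A (X t) *
      ((eval2 p (X t) + \<mu> * eval2 q (X t)) * (eval2 p (X t) + (- \<mu>) * eval2 q (X t)))"
    if "\<mu>\<^sup>2 * dist2 A (X t) = d\<^sup>2" for p q t \<mu>
    unfolding R_def that[symmetric] by (simp add: algebra_simps power2_eq_square)
  have rat_R: "rat_germ (R p q)" for p q
    unfolding R_def
    by (intro rat_germ_diff rat_germ_mult rat_germ_power rat_germ_const rat_map_eval2[OF rat] rat_germ_dist2[OF rat])
  have "\<forall>\<^sub>\<infinity>t. R p1 q1 t = 0 \<or> R p2 q2 t = 0"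
    using assms(2)[unfolded vanishing_on_points_iff] dist2_MOST
  proof eventually_elim
    case (elim t)
    obtain \<mu> where \<mu>: "\<mu>\<^sup>2 * dist2 A (X t) = d\<^sup>2" using displacement_exists[OF elim(2)] by blast
    hence \<mu>': "(- \<mu>)\<^sup>2 * dist2 A (X t) = d\<^sup>2" by simp
    have "eval2 g1 (displaced A \<mu> (X t)) = 0 \<or> eval2 g2 (displaced A \<mu> (X t)) = 0"
      using elim(1) \<mu> by auto
    thus ?case unfolding R_mu[OF \<mu>] using nf1[OF \<mu>] nf2[OF \<mu>] by auto
  qed
  hence "(\<forall>\<^sub>\<infinity>t. R p1 q1 t = 0) \<or> (\<forall>\<^sub>\<infinity>t. R p2 q2 t = 0)"
  proof -
    assume *: "\<forall>\<^sub>\<infinity>t. R p1 q1 t = 0 \<or> R p2 q2 t = 0"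
    show ?thesis
    proof (rule disjCI)
      assume "\<not> (\<forall>\<^sub>\<infinity>t. R p2 q2 t = 0)"
      hence "\<forall>\<^sub>\<infinity>t. R p2 q2 t \<noteq> 0" using rat_germ_zero_or_nonzero[OF rat_R] by blast
      with * show "\<forall>\<^sub>\<infinity>t. R p1 q1 t = 0" by eventually_elim simp
    qed
  qed
  moreover have "\<forall>z\<in>points. eval2 g z = 0"
    if "\<forall>\<^sub>\<infinity>t. R p q t = 0" and nf: "\<And>y \<mu>. \<mu>\<^sup>2 * dist2 A y = d\<^sup>2 \<Longrightarrow>
      dist2 A y ^ k * eval2 g (displaced A \<mu> y) = eval2 p y + \<mu> * eval2 q y" for g k p q
  proof -
    have "\<forall>\<^sub>\<infinity>t. eval2 q (X t) = 0"
    proof (rule ccontr)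
      assume "\<not> (\<forall>\<^sub>\<infinity>t. eval2 q (X t) = 0)"
      hence "\<forall>\<^sub>\<infinity>t. eval2 q (X t) \<noteq> 0" using rat_map_vanishing[OF rat] by blast
      with that(1) have "\<forall>\<^sub>\<infinity>t. dist2 A (X t) = (d * eval2 q (X t) / eval2 p (X t))\<^sup>2"
      proof eventually_elim
        case (elim t)
        hence eq: "(eval2 p (X t))\<^sup>2 * dist2 A (X t) = d\<^sup>2 * (eval2 q (X t))\<^sup>2" by (simp add: R_def)
        hence "eval2 p (X t) \<noteq> 0" using elim(2) d by auto
        thus ?case using eq by (simp add: power_divide power_mult_distrib field_simps)
      qed
      moreover have "rat_germ (\<lambda>t. d * eval2 q (X t) / eval2 p (X t))"
        by (intro rat_germ_divide rat_germ_mult rat_germ_const rat_map_eval2[OF rat])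
      ultimately show False using assms(1) unfolding rational_distance_def by blast
    qed
    with that(1) dist2_MOST show ?thesis unfolding vanishing_on_points_iff
    proof eventually_elim
      case (elim t)
      have "eval2 p (X t) = 0" using elim by (simp add: R_def)
      thus ?case using elim(2,3) nf[of _ "X t"] by auto
    qed
  qed
  ultimately show ?thesis using nf1 nf2 by blast
qed

text \<open>
  If \<open>h = f g\<close> with \<open>f\<close> vanishing on the conchoid, the zeros of \<open>g\<close> are zeros of \<open>f\<close>, so \<open>f\<close> and \<open>g\<close>
  share a factor and \<open>h\<close> is not squarefree.
\<close>

lemma conchoid_not_reducible:
  assumes "\<not> rational_distance A X"
  shows "\<not> reducible_curve (conchoid A d (locus X))"
proof
  assume "reducible_curve (conchoid A d (locus X))"
  then obtain h where h: "squarefree h" "\<not> is_unit h" "conchoid A d (locus X) = zero_set h"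
    and red: "\<not> irreducible h" by (auto simp: reducible_curve_def defining_poly_def)
  have "h \<noteq> 0" using h(1) by auto
  then obtain h1 h2 where h12: "h = h1 * h2" "\<not> is_unit h1" "\<not> is_unit h2"
    using red h(2) by (auto simp: irreducible_def)
  have "points \<subseteq> zero_set h" by (subst h(3)[symmetric]) (auto simp: conchoid_eq)
  hence "\<forall>z\<in>points. eval2 (h1 * h2) z = 0" by (auto simp: zero_set_def h12(1))
  from vanishing_on_points_prime[OF assms this]
  obtain f g where fg: "h = f * g" "\<not> is_unit g" "\<forall>z\<in>points. eval2 f z = 0"
    using h12 by (metis mult.commute)
  have "zero_set h \<subseteq> zero_set f"
    using fg(3) by (subst h(3)[symmetric]) (auto simp: conchoid_eq zero_set_def)
  obtain p where p: "irreducible p" "p dvd g"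
    using irreducible_factor_exists[of g] fg(1,2) \<open>h \<noteq> 0\<close> by auto
  have "p dvd h" using p(2) fg(1) by simp
  hence "zero_set p \<subseteq> zero_set f" using zero_set_mono \<open>zero_set h \<subseteq> zero_set f\<close> by blast
  hence "p dvd f" by (simp only: irreducible_dvd_iff_zero_set[OF p(1)])
  hence "p\<^sup>2 dvd h" unfolding fg(1) power2_eq_square using p(2) by (intro mult_dvd_mono)
  hence "is_unit p" by (rule squarefreeD[OF h(1)])
  thus False using p(1) by (simp add: irreducible_def)
qed

end

subsection \<open>Rational distance\<close>

text \<open>
  A finite fibre of \<open>f\<close> cannot carry a function whose set of values there is closed under
  adding \<open>c\<close>.
\<close>

lemma no_shift_along_fibres:
  fixes f m :: "'a::field_char_0 \<Rightarrow> 'a"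
  assumes f: "nonconst f" and c: "c \<noteq> 0"
    and shift: "\<forall>\<^sub>\<infinity>t. \<exists>t'. f t' = f t \<and> m t' = m t + c"
  shows False
proof -
  define B where "B = {t. \<not> (\<exists>t'. f t' = f t \<and> m t' = m t + c)}"
  have "finite B" using shift by (simp add: B_def eventually_cofinite)
  hence "\<forall>\<^sub>\<infinity>t. f t \<notin> f ` B" by (intro nonconst_notin[OF f]) simp
  from MOST_ex[OF this] obtain t0 where t0: "f t0 \<notin> f ` B" ..
  define F where "F = {t. f t = f t0}"
  have "finite F" using nonconst_neq[OF f, of "f t0"] by (simp add: F_def eventually_cofinite)
  have step: "\<exists>t'\<in>F. m t' = m t + c" if "t \<in> F" for t
  proof -
    have "t \<notin> B"
    proof
      assume "t \<in> B"
      hence "f t \<in> f ` B" by (rule imageI)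
      thus False using that t0 by (simp add: F_def)
    qed
    thus ?thesis using that by (auto simp: B_def F_def)
  qed
  have "m t0 + of_nat k * c \<in> m ` F" for k
  proof (induction k)
    case 0 show ?case by (simp add: F_def)
  next
    case (Suc k)
    then obtain t where "t \<in> F" "m t = m t0 + of_nat k * c" by force
    with step[OF \<open>t \<in> F\<close>] show ?case by (force simp: algebra_simps)
  qed
  hence "range (\<lambda>k. m t0 + of_nat k * c) \<subseteq> m ` F" by blast
  hence "finite (range (\<lambda>k. m t0 + of_nat k * c))" using \<open>finite F\<close> by (meson finite_imageI finite_subset)
  moreover have "inj (\<lambda>k. m t0 + of_nat k * c)" using c by (intro injI) simp
  ultimately show False using finite_imageD infinite_UNIV_nat by blast
qed

locale rdf_conchoid = conchoid_of_curve X A d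
  for X :: "'a::{alg_closed_field,field_char_0,field_gcd} \<Rightarrow> 'a \<times> 'a" and A d +
  fixes m :: "'a \<Rightarrow> 'a"
  assumes m: "rat_germ m" and dist: "\<forall>\<^sub>\<infinity>t. dist2 A (X t) = (m t)\<^sup>2"
    and not_circle: "\<not> (\<forall>\<^sub>\<infinity>t. dist2 A (X t) = d\<^sup>2)"
begin

definition branch :: "'a \<Rightarrow> 'a \<Rightarrow> 'a \<times> 'a" where
  "branch e t = displaced A (e / m t) (X t)"

lemma m_nonzero: "\<forall>\<^sub>\<infinity>t. m t \<noteq> 0"
  using dist dist2_MOST by eventually_elim auto

lemma m_neq: "e\<^sup>2 = d\<^sup>2 \<Longrightarrow> \<forall>\<^sub>\<infinity>t. m t \<noteq> e"
proof (rule ccontr)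
  assume e: "e\<^sup>2 = d\<^sup>2" "\<not> (\<forall>\<^sub>\<infinity>t. m t \<noteq> e)"
  hence "\<forall>\<^sub>\<infinity>t. m t = e" using rat_germ_eq_or_neq[OF m rat_germ_const, of e] by blast
  with dist have "\<forall>\<^sub>\<infinity>t. dist2 A (X t) = d\<^sup>2" by eventually_elim (simp add: e)
  thus False using not_circle by blast
qed

text \<open>
  If the factor \<open>1 + e / m\<close> is not zero, a constant value of the branch pins \<open>X - A\<close> to a fixed
  direction; and \<open>m = - e\<close> is the circle.
\<close>

lemma branch_nonconst:
  assumes "e\<^sup>2 = d\<^sup>2" shows "nonconst_map (branch e)"
  unfolding nonconst_map_def
proof (intro conjI allI notI)
  show "rat_map (branch e)"
    using rat unfolding rat_map_def branch_def displaced_def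
    by (auto intro!: rat_germ_add rat_germ_mult rat_germ_divide rat_germ_diff rat_germ_const m)
  fix c assume c: "\<forall>\<^sub>\<infinity>t. branch e t = c"
  define w where "w = (fst c - fst A, snd c - snd A)"
  have "(- e)\<^sup>2 = d\<^sup>2" using assms by simp
  from c m_neq[OF this] m_nonzero
  have *: "\<forall>\<^sub>\<infinity>t. (1 + e / m t) \<noteq> 0 \<and> (1 + e / m t) * (fst (X t) - fst A) = fst w \<and>
      (1 + e / m t) * (snd (X t) - snd A) = snd w"
  proof eventually_elim
    case (elim t)
    hence "1 + e / m t \<noteq> 0" by (auto simp: field_simps add_eq_0_iff)
    thus ?case using elim(1) by (auto simp: w_def branch_def displaced_def algebra_simps)
  qed
  have "w \<noteq> (0, 0)"
  proof
    assume "w = (0, 0)"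
    from * dist2_MOST have "\<forall>\<^sub>\<infinity>t::'a. False"
      by eventually_elim (auto simp: dist2_def \<open>w = (0, 0)\<close>)
    thus False using MOST_ex by blast
  qed
  hence "(snd w, - fst w) \<noteq> (0, 0)" by (auto simp: prod_eq_iff)
  moreover from * have "\<forall>\<^sub>\<infinity>t. snd w * (fst (X t) - fst A) + (- fst w) * (snd (X t) - snd A) = 0"
  proof eventually_elim
    case (elim t)
    thus ?case by (metis (no_types, lifting) add.right_inverse mult.commute mult.left_commute mult_minus_left)
  qed
  ultimately show False by (rule off_linesD[OF off])
qed

lemma displacement_iff:
  assumes "m t \<noteq> 0" "dist2 A (X t) = (m t)\<^sup>2"
  shows "\<mu>\<^sup>2 * dist2 A (X t) = d\<^sup>2 \<longleftrightarrow> \<mu> = d / m t \<or> \<mu> = (- d) / m t"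
proof -
  have "\<mu>\<^sup>2 * dist2 A (X t) = d\<^sup>2 \<longleftrightarrow> (\<mu> * m t)\<^sup>2 = d\<^sup>2" by (simp add: assms(2) power_mult_distrib)
  also have "\<dots> \<longleftrightarrow> \<mu> * m t = d \<or> \<mu> * m t = - d" by (rule power2_eq_iff)
  finally show ?thesis using assms(1) by (auto simp: field_simps)
qed

lemma vanishing_on_points_branches:
  "(\<forall>z\<in>points. eval2 g z = 0) \<longleftrightarrow>
    (\<forall>\<^sub>\<infinity>t. eval2 g (branch d t) = 0) \<and> (\<forall>\<^sub>\<infinity>t. eval2 g (branch (- d) t) = 0)"
proof -
  have "(\<forall>z\<in>points. eval2 g z = 0) \<longleftrightarrow>
      (\<forall>\<^sub>\<infinity>t. eval2 g (branch d t) = 0 \<and> eval2 g (branch (- d) t) = 0)"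
    unfolding vanishing_on_points_iff
  proof (rule eventually_subst)
    show "\<forall>\<^sub>\<infinity>t. (\<forall>\<mu>. \<mu>\<^sup>2 * dist2 A (X t) = d\<^sup>2 \<longrightarrow> eval2 g (displaced A \<mu> (X t)) = 0) =
        (eval2 g (branch d t) = 0 \<and> eval2 g (branch (- d) t) = 0)"
      using m_nonzero dist
    proof eventually_elim
      case (elim t)
      show ?case unfolding displacement_iff[OF elim] branch_def by blast
    qed
  qed
  thus ?thesis by (simp add: eventually_conj_iff)
qed

text \<open>
  Write \<open>X = A + m e\<close> with a unit direction \<open>e\<close>, so that the two branches are \<open>A + (m \<plusminus> d) e\<close>.
  If they traced the same curve, most points of the first branch would be points of the second:
  \<open>(m(t') - d) e(t') = (m(t) + d) e(t)\<close>. Comparing norms, either \<open>e(t') = - e(t)\<close> and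
  \<open>m(t') = - m(t)\<close>, whence \<open>X(t') = X(t)\<close>, which properness excludes; or \<open>e(t') = e(t)\<close> and
  \<open>m(t') = m(t) + 2 d\<close>, which is impossible on a finite fibre of \<open>e\<close>.
\<close>

lemma branches_distinct:
  assumes inv: "rational_inverse u v X"
  shows "locus (branch d) \<noteq> locus (branch (- d))"
proof
  assume same: "locus (branch d) = locus (branch (- d))"
  define e where "e j t = (if j then fst (X t) - fst A else snd (X t) - snd A) / m t" for j t
  have rat_e: "rat_germ (e j)" for j
    using rat unfolding e_def rat_map_def
    by (cases j) (auto intro!: rat_germ_divide rat_germ_diff rat_germ_const m)
  define good where "good t \<longleftrightarrow> m t \<noteq> 0 \<and> dist2 A (X t) = (m t)\<^sup>2 \<and>
    eval2 u (X t) / eval2 v (X t) = t \<and> m t \<noteq> - d" for t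
  have "(- d)\<^sup>2 = d\<^sup>2" by simp
  have good: "\<forall>\<^sub>\<infinity>t. good t"
    using m_nonzero dist inv[unfolded rational_inverse_def] m_neq[OF \<open>(- d)\<^sup>2 = d\<^sup>2\<close>]
    by eventually_elim (simp add: good_def)
  have e_X: "fst (X t) = fst A + m t * e True t" "snd (X t) = snd A + m t * e False t"
    if "good t" for t
    using that by (simp_all add: good_def e_def)
  have unit: "(e True t)\<^sup>2 + (e False t)\<^sup>2 = 1" if "good t" for t
  proof -
    have "(m t)\<^sup>2 * ((e True t)\<^sup>2 + (e False t)\<^sup>2) = dist2 A (X t)"
      using e_X[OF that] by (simp add: dist2_def power_mult_distrib algebra_simps)
    thus ?thesis using that by (simp add: good_def)
  qed
  have br: "branch c t = (fst A + (m t + c) * e True t, snd A + (m t + c) * e False t)"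
    if "good t" for c t
    using e_X[OF that] that by (simp add: branch_def displaced_def good_def field_simps)
  have "finite {t. \<not> good t}" using good by (simp add: eventually_cofinite)
  from same_locus_hits[OF branch_nonconst[OF \<open>(- d)\<^sup>2 = d\<^sup>2\<close>] branch_nonconst[OF refl] same this]
  have shift: "\<forall>\<^sub>\<infinity>t. \<exists>t'. (\<forall>j. e j t' = e j t) \<and> m t' = m t + 2 * d"
    using good
  proof eventually_elim
    case (elim t)
    then obtain t' where t': "good t'" "branch (- d) t' = branch d t" by auto
    have eq: "(m t' - d) * e j t' = (m t + d) * e j t" for j
      using t'(2) unfolding br[OF t'(1)] br[OF elim(2)] by (cases j) auto
    have "(m t' - d)\<^sup>2 = (m t' - d)\<^sup>2 * ((e True t')\<^sup>2 + (e False t')\<^sup>2)" by (simp add: unit[OF t'(1)])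
    also have "\<dots> = ((m t' - d) * e True t')\<^sup>2 + ((m t' - d) * e False t')\<^sup>2"
      by (simp add: power_mult_distrib distrib_left)
    also have "\<dots> = (m t + d)\<^sup>2 * ((e True t)\<^sup>2 + (e False t)\<^sup>2)"
      unfolding eq by (simp add: power_mult_distrib distrib_left)
    finally have "(m t' - d)\<^sup>2 = (m t + d)\<^sup>2" by (simp add: unit[OF elim(2)])
    hence "m t' - d = m t + d \<or> m t' - d = - (m t + d)" by (rule power2_eq_iff[THEN iffD1])
    moreover have nz: "m t + d \<noteq> 0" using elim(2) by (auto simp: good_def add_eq_0_iff)
    moreover have False if neg: "m t' - d = - (m t + d)"
    proof -
      have "(m t + d) * (- e j t') = (m t + d) * e j t" for j using eq[of j] unfolding neg
        by (simp add: algebra_simps)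
      hence e': "e j t' = - e j t" for j using nz by (metis mult_left_cancel minus_minus)
      have m': "m t' = - m t" using neg by (simp add: algebra_simps eq_neg_iff_add_eq_0)
      have "X t' = X t"
        using e_X[OF t'(1)] e_X[OF elim(2)] by (simp add: prod_eq_iff e' m')
      hence "t' = t" using t'(1) elim(2) by (auto simp: good_def)
      thus False using m' elim(2) by (auto simp: good_def)
    qed
    ultimately have m': "m t' - d = m t + d" by blast
    have "e j t' = e j t" for j using eq[of j] nz unfolding m' by simp
    moreover have "m t' = m t + 2 * d" using m' by (simp add: algebra_simps)
    ultimately show ?case by blast
  qed
  have "\<exists>j. nonconst (e j)"
  proof (rule ccontr)
    assume "\<nexists>j. nonconst (e j)"
    then obtain c where c: "\<And>j. \<forall>\<^sub>\<infinity>t. e j t = c j" using rat_e unfolding nonconst_def by metis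
    have "\<forall>\<^sub>\<infinity>t. (c False) * (fst (X t) - fst A) + (- c True) * (snd (X t) - snd A) = 0"
      using c[of True] c[of False] good by eventually_elim (simp add: e_X algebra_simps)
    moreover have "(c False, - c True) \<noteq> (0, 0)"
    proof
      assume "(c False, - c True) = (0, 0)"
      hence "c False = 0" "c True = 0" by auto
      have "\<forall>\<^sub>\<infinity>t::'a. False"
        using c[of True] c[of False] good
      proof eventually_elim
        case (elim t)
        thus ?case using unit[OF elim(3)] \<open>c False = 0\<close> \<open>c True = 0\<close> by simp
      qed
      thus False using MOST_ex by blast
    qed
    ultimately show False by (intro off_linesD[OF off])
  qed
  then obtain j where "nonconst (e j)" ..
  moreover have "2 * d \<noteq> 0" using d by simp
  moreover have "\<forall>\<^sub>\<infinity>t. \<exists>t'. e j t' = e j t \<and> m t' = m t + 2 * d"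
    using shift by eventually_elim blast
  ultimately show False by (rule no_shift_along_fibres)
qed

text \<open>
  An equation of the conchoid is one that both branches satisfy, hence a multiple of both
  irreducible equations.
\<close>

theorem conchoid_two_components:
  assumes inv: "rational_inverse u v X"
  shows "reducible_curve (conchoid A d (locus X))"
    and "card (curve_components (conchoid A d (locus X))) = 2"
    and "\<forall>D\<in>curve_components (conchoid A d (locus X)). rational_curve D"
proof -
  have nc: "nonconst_map (branch d)" "nonconst_map (branch (- d))"
    by (simp_all add: branch_nonconst)
  obtain h where h: "irreducible h" "locus (branch d) = zero_set h"
    "\<And>g. (\<forall>\<^sub>\<infinity>t. eval2 g (branch d t) = 0) \<longleftrightarrow> h dvd g" using locus_irreducible[OF nc(1)] by blast
  obtain k where k: "irreducible k" "locus (branch (- d)) = zero_set k"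
    "\<And>g. (\<forall>\<^sub>\<infinity>t. eval2 g (branch (- d) t) = 0) \<longleftrightarrow> k dvd g" using locus_irreducible[OF nc(2)] by blast
  have ndvd: "\<not> h dvd k"
  proof
    assume "h dvd k"
    moreover from this have "k dvd h" by (rule irreducible_associated[OF h(1) k(1)])
    ultimately show False using branches_distinct[OF inv] zero_set_eqI h(2) k(2) by metis
  qed
  hence "coprime h k" using prime_elem_imp_coprime[OF irreducible_imp_prime_elem[OF h(1)]] by blast
  have van: "(\<forall>z\<in>points. eval2 g z = 0) \<longleftrightarrow> h * k dvd g" for g
    unfolding vanishing_on_points_branches h(3) k(3)
    using divides_mult[OF _ _ \<open>coprime h k\<close>] by (meson dvd_mult_left dvd_mult_right)
  have con: "conchoid A d (locus X) = zero_set (h * k)"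
  proof (intro equalityI subsetI)
    fix y assume "y \<in> conchoid A d (locus X)"
    hence "\<forall>g. h * k dvd g \<longrightarrow> eval2 g y = 0" by (simp only: conchoid_eq van mem_Collect_eq)
    hence "eval2 (h * k) y = 0" by (elim allE[of _ "h * k"] impE) (rule dvd_refl)
    thus "y \<in> zero_set (h * k)" by (simp add: zero_set_def)
  next
    fix y assume "y \<in> zero_set (h * k)"
    hence "\<forall>g. h * k dvd g \<longrightarrow> eval2 g y = 0" using zero_set_mono[of "h * k"] by (force simp: zero_set_def)
    thus "y \<in> conchoid A d (locus X)" by (simp only: conchoid_eq van mem_Collect_eq)
  qed
  note comp = two_component_curve[OF h(1) k(1) ndvd, folded con]
  show "reducible_curve (conchoid A d (locus X))" by (rule comp(1))
  show "card (curve_components (conchoid A d (locus X))) = 2" unfolding comp(2) using comp(3) by simp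
  show "\<forall>D\<in>curve_components (conchoid A d (locus X)). rational_curve D"
    unfolding comp(2) using rational_curve_locus[OF nc(1)] rational_curve_locus[OF nc(2)] h(2) k(2) by simp
qed

end

lemma card_components_imp_reducible:
  fixes C :: "('a::{alg_closed_field,field_char_0,field_gcd} \<times> 'a) set"
  assumes "card (curve_components C) = 2" shows "reducible_curve C"
proof -
  have "curve_components C \<noteq> {}" using assms by auto
  then obtain h where h: "defining_poly h C" unfolding curve_components_def by blast
  have "\<not> irreducible h"
  proof
    assume "irreducible h"
    hence "curve_components C = {C}" using h by (rule curve_components_irreducible)
    thus False using assms by simp
  qed
  thus ?thesis using h by (auto simp: reducible_curve_def)
qed

section \<open>The characterisation of reducible conchoids\<close>

theorem theorem3p12:
  fixes a b d :: "'a :: {alg_closed_field, field_char_0, field_gcd}"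
    and C :: "('a \<times> 'a) set"
  assumes d: "d \<noteq> 0"
    and C: "rational_curve C"
    and not_isotropic: "\<And>i. i\<^sup>2 = - 1 \<Longrightarrow> C \<noteq> {(y1, y2). y1 + i * y2 = 0}"
    and not_circle: "C \<noteq> {(y1, y2). (y1 - a)\<^sup>2 + (y2 - b)\<^sup>2 = d\<^sup>2}"
    and not_line: "\<And>u v. (u, v) \<noteq> (0, 0) \<Longrightarrow>
      C \<noteq> {(y1, y2). u * (y1 - a) + v * (y2 - b) = 0}"
  defines "s1 \<equiv> reducible_curve (conchoid (a, b) d C)"
    and "s2 \<equiv> card (curve_components (conchoid (a, b) d C)) = 2 \<and>
      (\<forall>D \<in> curve_components (conchoid (a, b) d C). rational_curve D)"
    and "s3 \<equiv> \<exists>P. proper_parametrization P C \<and> rdf (a, b) P"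
    and "s4 \<equiv> \<forall>P. proper_parametrization P C \<longrightarrow> rdf (a, b) P"
    and "s5 \<equiv> \<exists>P. proper_parametrization P C \<and> reducible_curve (reparam_curve (a, b) P)"
    and "s6 \<equiv> \<forall>P. proper_parametrization P C \<longrightarrow> reducible_curve (reparam_curve (a, b) P)"
  shows "(s1 \<longleftrightarrow> s2) \<and> (s1 \<longleftrightarrow> s3) \<and> (s1 \<longleftrightarrow> s4) \<and> (s1 \<longleftrightarrow> s5) \<and> (s1 \<longleftrightarrow> s6)"
proof -
  have par: "nonconst_map (par_eval P)" "locus (par_eval P) = C" "off_lines (a, b) (par_eval P)"
    "\<not> (\<forall>\<^sub>\<infinity>t. dist2 (a, b) (par_eval P t) = d\<^sup>2)" if "parametrization P C" for P
  proof -
    show nc: "nonconst_map (par_eval P)" and loc: "locus (par_eval P) = C"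
      using that by (simp_all add: parametrization_iff)
    show "off_lines (a, b) (par_eval P)"
      unfolding off_lines_def
    proof (intro allI impI notI)
      fix u v :: 'a assume uv: "(u, v) \<noteq> (0, 0)"
      assume "\<forall>\<^sub>\<infinity>t. u * (fst (par_eval P t) - fst (a, b)) + v * (snd (par_eval P t) - snd (a, b)) = 0"
      hence "C = {(y1, y2). u * (y1 - a) + v * (y2 - b) = 0}"
        using locus_line[OF nc uv, of a b] by (simp add: loc)
      thus False using not_line[OF uv] by simp
    qed
    show "\<not> (\<forall>\<^sub>\<infinity>t. dist2 (a, b) (par_eval P t) = d\<^sup>2)"
      using locus_circle[OF nc d] not_circle unfolding loc by blast
  qed
  obtain P0 where P0: "parametrization P0 C" using C by (auto simp: rational_curve_def)
  obtain P where P: "proper_parametrization P C"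
    using lueroth_proper[OF par(1)[OF P0]] par(2)[OF P0] by metis
  have P_par: "parametrization P C" using P by (simp add: proper_parametrization_iff)
  have rdf_all: "rdf (a, b) Q \<longleftrightarrow> rdf (a, b) P" if "proper_parametrization Q C" for Q
    using rdf_transfer[OF that _ P_par] rdf_transfer[OF P, of "(a, b)" Q] that
    by (auto simp: proper_parametrization_iff)
  have rep_all: "reducible_curve (reparam_curve (a, b) Q) \<longleftrightarrow> rdf (a, b) P"
    if "proper_parametrization Q C" for Q
    using reparam_curve_reducible_iff[OF par(3)] rdf_all that by (simp add: proper_parametrization_iff)
  obtain u v where inv: "rational_inverse u v (par_eval P)" using P by (auto simp: proper_parametrization_iff)
  interpret conchoid_of_curve "par_eval P" "(a, b)" d
    using par[OF P_par] d by unfold_locales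
  have rdf_imp: "s1 \<and> s2" if P_rdf: "rdf (a, b) P"
  proof -
    obtain m where m: "rat_germ m" "\<forall>\<^sub>\<infinity>t. dist2 (a, b) (par_eval P t) = (m t)\<^sup>2"
      using P_rdf unfolding rdf_iff rational_distance_def by blast
    interpret rdf_conchoid "par_eval P" "(a, b)" d m
      using m par(4)[OF P_par] by unfold_locales
    show ?thesis using conchoid_two_components[OF inv] by (simp add: par(2)[OF P_par] s1_def s2_def)
  qed
  have "rdf (a, b) P" if s1
    using conchoid_not_reducible that by (auto simp: rdf_iff par(2)[OF P_par] s1_def)
  moreover have s1 if s2
    using that card_components_imp_reducible by (auto simp: s1_def s2_def)
  ultimately have "s1 \<longleftrightarrow> rdf (a, b) P" "s2 \<longleftrightarrow> rdf (a, b) P" using rdf_imp by blast+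
  moreover have "s3 \<longleftrightarrow> rdf (a, b) P" "s4 \<longleftrightarrow> rdf (a, b) P" "s5 \<longleftrightarrow> rdf (a, b) P" "s6 \<longleftrightarrow> rdf (a, b) P"
    unfolding s3_def s4_def s5_def s6_def using rdf_all rep_all P by blast+
  ultimately show ?thesis by blast
qed

end
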